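(* Let $T=T_{\min}$, so that $T^*T=-\Delta_D$ is the Dirichlet Laplacian $-\frac{d^2}{dx^2}$ on $L^2(0,1)$, and let $\alpha_0$ be a (real) constant. Consider the map $$\mathcal{F}:\alpha\mapsto\{\mathbf{t}_n(\alpha)\}_{n=0}^\infty:=\{\mathrm{trace}(R_n(\alpha))\}_{n=0}^\infty .$$ Then the Fréchet derivative of $\mathcal{F}$ at the constant function $\alpha=\alpha_0$, $$\mathcal{F}'[\alpha_0]:\ \delta\alpha\mapsto\{\mathbf{t}_n'[\alpha_0](\delta\alpha)\}_{n=0}^\infty=\{\mathrm{trace}(R_n'[\alpha_0](\delta\alpha))\}_{n=0}^\infty,$$ is injective on even perturbations: if $\delta\alpha\in L^\infty(0,1)$ is real-valued with $\delta\alpha(x)=\delta\alpha(1-x)$ and $\mathrm{trace}(R_n'[\alpha_0](\delta\alpha))=0$ for all $n\ge0$, then $\delta\alpha=0$.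
   Context: $-\Delta_D={T_{\min}}^*T_{\min}$ acts by $f\mapsto -f''$ on the domain of all $f\in L^2(0,1)$ with $f,f'\in AC([0,1])$ (absolutely continuous), $f(0)=f(1)=0$, $f''\in L^2(0,1)$. For real-valued $\alpha\in L^\infty(0,1)$ (the damping coefficient, also denoting the multiplication operator by $\alpha$ on $L^2(0,1)$), the trace class operators $R_n(\alpha)$ on $L^2(0,1)$ are $R_n(\alpha)=\frac{1}{n!}R^{(n)}(0)$ where $R(\zeta)=-(2\zeta+\alpha)(T^*T+\zeta^2+\zeta\alpha)^{-1}$ for $\zeta$ near $0$; equivalently $$R_0(\alpha)=-\alpha(T^*T)^{-1},\quad R_1(\alpha)=-2(T^*T)^{-1}+\alpha(T^*T)^{-1}\alpha(T^*T)^{-1},$$ $$R_n(\alpha)=-R_{n-2}(\alpha)(T^*T)^{-1}-R_{n-1}(\alpha)\alpha(T^*T)^{-1}\quad(n\ge2).$$ $R_n'[\alpha_0](\delta\alpha)$ denotes the Fréchet derivative of $\alpha\mapsto R_n(\alpha)$ at $\alpha_0$ in the direction $\delta\alpha$, and $\mathbf{t}_n'[\alpha_0]$ that of $\mathbf{t}_n$; $\mathcal{F}'[\alpha_0]$ is understood componentwise. *)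

theory Defs
  imports "HOL-Analysis.Analysis"
begin

abbreviation I01 :: "real measure" where
  "I01 \<equiv> lebesgue_on {0<..<1}"


section \<open>The complex Hilbert space $L^2(0,1)$\<close>

definition square_integrable :: "(real \<Rightarrow> complex) \<Rightarrow> bool" where
  "square_integrable f \<longleftrightarrow>
     f \<in> borel_measurable I01 \<and> integrable I01 (\<lambda>x. (cmod (f x))\<^sup>2)"

lemma square_integrable_mult:
  assumes f: "square_integrable f" and g: "square_integrable g"
  shows "integrable I01 (\<lambda>x. cnj (f x) * g x)"
proof (rule Bochner_Integration.integrable_bound)
  show "integrable I01 (\<lambda>x. (cmod (f x))\<^sup>2 + (cmod (g x))\<^sup>2)"
    using f g by (simp add: square_integrable_def)
  have [measurable]: "f \<in> borel_measurable I01" "g \<in> borel_measurable I01"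
    using f g by (auto simp: square_integrable_def)
  have "(\<lambda>x. cnj (f x)) \<in> borel_measurable I01"
    by (rule borel_measurable_continuous_on[OF _ \<open>f \<in> borel_measurable I01\<close>])
       (intro continuous_intros)
  then show "(\<lambda>x. cnj (f x) * g x) \<in> borel_measurable I01" by measurable
  have "a * b \<le> a\<^sup>2 + b\<^sup>2" if "a \<ge> 0" "b \<ge> 0" for a b :: real
    using sum_squares_bound[of a b] mult_nonneg_nonneg[OF that] by linarith
  then show "AE x in I01. norm (cnj (f x) * g x) \<le> norm ((cmod (f x))\<^sup>2 + (cmod (g x))\<^sup>2)"
    by (simp add: norm_mult)
qed

lemma square_integrable_add:
  assumes f: "square_integrable f" and g: "square_integrable g"
  shows "square_integrable (\<lambda>x. f x + g x)"
  unfolding square_integrable_def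
proof
  have [measurable]: "f \<in> borel_measurable I01" "g \<in> borel_measurable I01"
    using f g by (auto simp: square_integrable_def)
  show "(\<lambda>x. f x + g x) \<in> borel_measurable I01" by measurable
  show "integrable I01 (\<lambda>x. (cmod (f x + g x))\<^sup>2)"
  proof (rule Bochner_Integration.integrable_bound)
    show "integrable I01 (\<lambda>x. 2 * (cmod (f x))\<^sup>2 + 2 * (cmod (g x))\<^sup>2)"
      using f g by (simp add: square_integrable_def)
    show "(\<lambda>x. (cmod (f x + g x))\<^sup>2) \<in> borel_measurable I01" by measurable
    have "(cmod (a + b))\<^sup>2 \<le> 2 * (cmod a)\<^sup>2 + 2 * (cmod b)\<^sup>2" for a b
    proof -
      have "(cmod (a + b))\<^sup>2 \<le> (cmod a + cmod b)\<^sup>2"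
        by (intro power_mono norm_triangle_ineq) auto
      also have "\<dots> \<le> 2 * (cmod a)\<^sup>2 + 2 * (cmod b)\<^sup>2"
        using sum_squares_bound[of "cmod a" "cmod b"] by (simp add: power2_sum)
      finally show ?thesis .
    qed
    then show "AE x in I01. norm ((cmod (f x + g x))\<^sup>2)
                 \<le> norm (2 * (cmod (f x))\<^sup>2 + 2 * (cmod (g x))\<^sup>2)"
      by simp
  qed
qed

lemma square_integrable_scale:
  assumes f: "square_integrable f"
  shows "square_integrable (\<lambda>x. c * f x)"
  using f unfolding square_integrable_def
  by (auto simp: norm_mult power_mult_distrib)

lemma square_integrable_zero: "square_integrable (\<lambda>x. 0)"
  by (simp add: square_integrable_def)

definition l2_rel :: "(real \<Rightarrow> complex) \<Rightarrow> (real \<Rightarrow> complex) \<Rightarrow> bool" where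
  "l2_rel f g \<longleftrightarrow> square_integrable f \<and> square_integrable g \<and> (AE x in I01. f x = g x)"

quotient_type L2 = "real \<Rightarrow> complex" / partial: l2_rel
  morphisms rep_L2 class_L2
proof (rule part_equivpI)
  show "\<exists>x. l2_rel x x"
    using square_integrable_zero by (auto simp: l2_rel_def)
  show "symp l2_rel"
    by (rule sympI) (auto simp: l2_rel_def elim!: eventually_mono)
  show "transp l2_rel"
  proof (rule transpI)
    fix f g h assume fg: "l2_rel f g" and gh: "l2_rel g h"
    have "AE x in I01. f x = h x"
      using fg gh unfolding l2_rel_def by (auto elim: eventually_elim2)
    then show "l2_rel f h" using fg gh by (simp add: l2_rel_def)
  qed
qed

lift_definition scaleC :: "complex \<Rightarrow> L2 \<Rightarrow> L2" is "\<lambda>c f x. c * f x"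
  by (auto simp: l2_rel_def square_integrable_scale elim!: eventually_mono)

text \<open>The inner product is conjugate linear in the first argument.\<close>

lift_definition cinner :: "L2 \<Rightarrow> L2 \<Rightarrow> complex" is
  "\<lambda>f g. integral\<^sup>L I01 (\<lambda>x. cnj (f x) * g x)"
proof -
  fix f f' g g' assume 1: "l2_rel f f'" and 2: "l2_rel g g'"
  have "AE x in I01. cnj (f x) * g x = cnj (f' x) * g' x"
    using 1 2 unfolding l2_rel_def by (auto elim: eventually_elim2)
  moreover have "integrable I01 (\<lambda>x. cnj (f x) * g x)" "integrable I01 (\<lambda>x. cnj (f' x) * g' x)"
    using 1 2 by (auto simp: l2_rel_def intro: square_integrable_mult)
  ultimately show "integral\<^sup>L I01 (\<lambda>x. cnj (f x) * g x) = integral\<^sup>L I01 (\<lambda>x. cnj (f' x) * g' x)"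
    by (intro integral_cong_AE) auto
qed

instantiation L2 :: real_inner
begin

lift_definition zero_L2 :: L2 is "\<lambda>x. 0"
  by (simp add: l2_rel_def square_integrable_zero)

lift_definition plus_L2 :: "L2 \<Rightarrow> L2 \<Rightarrow> L2" is "\<lambda>f g x. f x + g x"
  unfolding l2_rel_def by (auto simp: square_integrable_add elim: eventually_elim2)

definition uminus_L2 :: "L2 \<Rightarrow> L2" where "uminus_L2 f = scaleC (-1) f"

definition minus_L2 :: "L2 \<Rightarrow> L2 \<Rightarrow> L2" where "minus_L2 f g = f + (- g)" for f g :: L2

definition scaleR_L2 :: "real \<Rightarrow> L2 \<Rightarrow> L2" where "scaleR_L2 r f = scaleC (of_real r) f"

definition inner_L2 :: "L2 \<Rightarrow> L2 \<Rightarrow> real" where "inner_L2 f g = Re (cinner f g)"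

definition norm_L2 :: "L2 \<Rightarrow> real" where "norm_L2 f = sqrt (inner f f)"

definition sgn_L2 :: "L2 \<Rightarrow> L2" where "sgn_L2 f = scaleR (inverse (norm f)) f"

definition dist_L2 :: "L2 \<Rightarrow> L2 \<Rightarrow> real" where "dist_L2 f g = norm (f - g)"

definition uniformity_L2 :: "(L2 \<times> L2) filter" where
  "uniformity_L2 = (INF e\<in>{0<..}. principal {(x, y). dist x y < e})"

definition open_L2 :: "L2 set \<Rightarrow> bool" where
  "open_L2 U \<longleftrightarrow> (\<forall>x\<in>U. eventually (\<lambda>(x', y). x' = x \<longrightarrow> y \<in> U) uniformity)"

instance
proof
  fix f g h :: L2 and r s :: real
  show "f + g + h = f + (g + h)"
    by transfer (auto simp: l2_rel_def square_integrable_add algebra_simps)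
  show "f + g = g + f"
    by transfer (auto simp: l2_rel_def square_integrable_add algebra_simps)
  show "0 + f = f"
    by transfer (auto simp: l2_rel_def)
  show "- f + f = 0"
    unfolding uminus_L2_def
    by transfer (auto simp: l2_rel_def square_integrable_zero)
  show "f - g = f + - g" by (simp add: minus_L2_def)
  show "r *\<^sub>R (f + g) = r *\<^sub>R f + r *\<^sub>R g"
    unfolding scaleR_L2_def
    by transfer (simp add: l2_rel_def distrib_left square_integrable_add square_integrable_scale)
  show "(r + s) *\<^sub>R f = r *\<^sub>R f + s *\<^sub>R f"
    unfolding scaleR_L2_def
    by transfer (simp add: l2_rel_def distrib_right square_integrable_add square_integrable_scale)
  show "r *\<^sub>R s *\<^sub>R f = (r * s) *\<^sub>R f"
    unfolding scaleR_L2_def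
    by transfer (simp add: l2_rel_def mult.assoc square_integrable_scale)
  show "1 *\<^sub>R f = f"
    unfolding scaleR_L2_def by transfer (auto simp: l2_rel_def)
  show "sgn f = scaleR (inverse (norm f)) f" by (simp add: sgn_L2_def)
  show "dist f g = norm (f - g)" by (simp add: dist_L2_def)
  show "inner f g = inner g f"
    unfolding inner_L2_def
  proof transfer
    fix f g
    have "integral\<^sup>L I01 (\<lambda>x. cnj (f x) * g x) = integral\<^sup>L I01 (\<lambda>x. cnj (cnj (g x) * f x))"
      by (simp add: mult.commute)
    also have "\<dots> = cnj (integral\<^sup>L I01 (\<lambda>x. cnj (g x) * f x))"
      by (rule Bochner_Integration.integral_cnj)
    finally show "Re (integral\<^sup>L I01 (\<lambda>x. cnj (f x) * g x)) = Re (integral\<^sup>L I01 (\<lambda>x. cnj (g x) * f x))"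
      by simp
  qed
  show "inner (f + g) h = inner f h + inner g h"
    unfolding inner_L2_def
    by transfer (simp add: l2_rel_def distrib_right square_integrable_mult)
  show "inner (r *\<^sub>R f) g = r * inner f g"
    unfolding inner_L2_def scaleR_L2_def
    by transfer (simp add: mult.assoc)
  have sq: "cnj z * z = of_real ((cmod z)\<^sup>2)" for z
    by (metis complex_norm_square mult.commute)
  show "0 \<le> inner f f"
    unfolding inner_L2_def by transfer (simp add: sq del: of_real_power)
  show "inner f f = 0 \<longleftrightarrow> f = 0"
    unfolding inner_L2_def
  proof transfer
    fix f assume "l2_rel f f"
    then have *: "square_integrable f" by (simp add: l2_rel_def)
    then have i: "integrable I01 (\<lambda>x. (cmod (f x))\<^sup>2)" by (simp add: square_integrable_def)
    have "integral\<^sup>L I01 (\<lambda>x. (cmod (f x))\<^sup>2) = 0 \<longleftrightarrow> (AE x in I01. (cmod (f x))\<^sup>2 = 0)"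
      by (rule integral_nonneg_eq_0_iff_AE[OF i]) simp
    then show "(Re (integral\<^sup>L I01 (\<lambda>x. cnj (f x) * f x)) = 0) = l2_rel f (\<lambda>x. 0)"
      using * by (simp add: sq l2_rel_def square_integrable_zero del: of_real_power)
  qed
  show "norm f = sqrt (inner f f)" by (simp add: norm_L2_def)
qed (fact uniformity_L2_def open_L2_def)+

end


section \<open>The real Banach space $L^\infty(0,1)$\<close>

definition ess_bounded :: "(real \<Rightarrow> real) \<Rightarrow> bool" where
  "ess_bounded f \<longleftrightarrow> f \<in> borel_measurable I01 \<and> (\<exists>c. AE x in I01. \<bar>f x\<bar> \<le> c)"

lemma ess_bounded_add:
  assumes f: "ess_bounded f" and g: "ess_bounded g"
  shows "ess_bounded (\<lambda>x. f x + g x)"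
proof -
  obtain c d where "AE x in I01. \<bar>f x\<bar> \<le> c" "AE x in I01. \<bar>g x\<bar> \<le> d"
    using f g by (auto simp: ess_bounded_def)
  then have "AE x in I01. \<bar>f x + g x\<bar> \<le> c + d"
    by (rule eventually_elim2) (use abs_triangle_ineq in fastforce)
  then show ?thesis using f g by (auto simp: ess_bounded_def)
qed

lemma ess_bounded_scale:
  assumes f: "ess_bounded f"
  shows "ess_bounded (\<lambda>x. r * f x)"
proof -
  obtain c where "AE x in I01. \<bar>f x\<bar> \<le> c"
    using f by (auto simp: ess_bounded_def)
  then have "AE x in I01. \<bar>r * f x\<bar> \<le> \<bar>r\<bar> * c"
    by (rule eventually_mono) (simp add: abs_mult mult_left_mono)
  then show ?thesis using f by (auto simp: ess_bounded_def)
qed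

lemma ess_bounded_const: "ess_bounded (\<lambda>x. c)"
  by (auto simp: ess_bounded_def)

definition linf_rel :: "(real \<Rightarrow> real) \<Rightarrow> (real \<Rightarrow> real) \<Rightarrow> bool" where
  "linf_rel f g \<longleftrightarrow> ess_bounded f \<and> ess_bounded g \<and> (AE x in I01. f x = g x)"

quotient_type Linf = "real \<Rightarrow> real" / partial: linf_rel
  morphisms rep_Linf class_Linf
proof (rule part_equivpI)
  show "\<exists>x. linf_rel x x"
    using ess_bounded_const[of 0] by (auto simp: linf_rel_def)
  show "symp linf_rel"
    by (rule sympI) (auto simp: linf_rel_def elim!: eventually_mono)
  show "transp linf_rel"
  proof (rule transpI)
    fix f g h assume fg: "linf_rel f g" and gh: "linf_rel g h"
    have "AE x in I01. f x = h x"
      using fg gh unfolding linf_rel_def by (auto elim: eventually_elim2)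
    then show "linf_rel f h" using fg gh by (simp add: linf_rel_def)
  qed
qed

lift_definition const_Linf :: "real \<Rightarrow> Linf" is "\<lambda>c x. c"
  by (simp add: linf_rel_def ess_bounded_const)

lemma AE_I01_reflect:
  assumes "AE x in I01. P x"
  shows "AE x in I01. P (1 - x)"
proof -
  have "AE x in lebesgue. x \<in> {0<..<1} \<longrightarrow> P x"
    using assms by (simp add: AE_restrict_space_iff)
  then obtain N where N: "negligible N" "{x. \<not> (x \<in> {0<..<1} \<longrightarrow> P x)} \<subseteq> N"
    by (auto simp: eventually_ae_filter_negligible)
  have "(\<lambda>x::real. 1 - x) differentiable_on N"
    by (intro derivative_intros)
  then have "negligible ((\<lambda>x. 1 - x) ` N)"
    using N(1) by (intro negligible_differentiable_image_negligible) auto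
  moreover have "{x. \<not> (x \<in> {0<..<1} \<longrightarrow> P (1 - x))} \<subseteq> (\<lambda>x. 1 - x) ` N"
  proof
    fix x assume "x \<in> {x. \<not> (x \<in> {0<..<1} \<longrightarrow> P (1 - x))}"
    then have "1 - x \<in> N" using N(2) by auto
    then show "x \<in> (\<lambda>x. 1 - x) ` N" by (intro image_eqI[of _ _ "1 - x"]) auto
  qed
  ultimately have "AE x in lebesgue. x \<in> {0<..<1} \<longrightarrow> P (1 - x)"
    by (auto simp: eventually_ae_filter_negligible)
  then show ?thesis by (simp add: AE_restrict_space_iff)
qed

lift_definition even_Linf :: "Linf \<Rightarrow> bool" is "\<lambda>f. AE x in I01. f x = f (1 - x)"
proof -
  fix f g assume "linf_rel f g"
  then have 1: "AE x in I01. f x = g x" by (simp add: linf_rel_def)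
  have "AE x in I01. f x = g x \<and> f (1 - x) = g (1 - x)"
    using 1 AE_I01_reflect[OF 1] by (rule eventually_conj)
  then show "(AE x in I01. f x = f (1 - x)) = (AE x in I01. g x = g (1 - x))"
    by (intro iffI) (auto elim: eventually_elim2)
qed

lift_definition norm_Linf0 :: "Linf \<Rightarrow> real" is
  "\<lambda>f. Inf {c. 0 \<le> c \<and> (AE x in I01. \<bar>f x\<bar> \<le> c)}"
proof -
  fix f g assume "linf_rel f g"
  then have 1: "AE x in I01. f x = g x" by (simp add: linf_rel_def)
  have "(AE x in I01. \<bar>f x\<bar> \<le> c) = (AE x in I01. \<bar>g x\<bar> \<le> c)" for c
    using 1 by (auto elim: eventually_elim2)
  then show "Inf {c. 0 \<le> c \<and> (AE x in I01. \<bar>f x\<bar> \<le> c)} = Inf {c. 0 \<le> c \<and> (AE x in I01. \<bar>g x\<bar> \<le> c)}"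
    by simp
qed

lift_definition bounded_by :: "Linf \<Rightarrow> real \<Rightarrow> bool" is "\<lambda>f c. AE x in I01. \<bar>f x\<bar> \<le> c"
proof -
  fix f g assume "linf_rel f g"
  then have 1: "AE x in I01. f x = g x" by (simp add: linf_rel_def)
  show "(\<lambda>c. AE x in I01. \<bar>f x\<bar> \<le> c) = (\<lambda>c. AE x in I01. \<bar>g x\<bar> \<le> c)"
  proof
    fix c
    show "(AE x in I01. \<bar>f x\<bar> \<le> c) = (AE x in I01. \<bar>g x\<bar> \<le> c)"
      using 1 by (auto elim: eventually_elim2)
  qed
qed

lemma norm_Linf0_eq: "norm_Linf0 a = Inf {c. 0 \<le> c \<and> bounded_by a c}"
  by transfer simp

lemma bounded_by_mono: "bounded_by a c \<Longrightarrow> c \<le> d \<Longrightarrow> bounded_by a d"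
  by transfer (auto elim!: eventually_mono)

lemma bounded_by_ex: "\<exists>c. 0 \<le> c \<and> bounded_by a c"
proof -
  have "\<exists>c. bounded_by a c" by transfer (auto simp: linf_rel_def ess_bounded_def)
  then obtain c where "bounded_by a c" ..
  then have "bounded_by a (max 0 c)" by (rule bounded_by_mono) simp
  then show ?thesis by (intro exI[of _ "max 0 c"]) simp
qed

lemma norm_Linf0_nonneg: "0 \<le> norm_Linf0 a"
  unfolding norm_Linf0_eq using bounded_by_ex[of a] by (intro cInf_greatest) auto

lemma norm_Linf0_le: "0 \<le> c \<Longrightarrow> bounded_by a c \<Longrightarrow> norm_Linf0 a \<le> c"
  unfolding norm_Linf0_eq by (rule cInf_lower) (auto intro: bdd_belowI)

lemma bounded_by_norm: "bounded_by a (norm_Linf0 a)"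
proof -
  have "bounded_by a (norm_Linf0 a + inverse (of_nat (Suc n)))" for n :: nat
  proof -
    have "Inf {c. 0 \<le> c \<and> bounded_by a c} < norm_Linf0 a + inverse (of_nat (Suc n))"
      by (simp add: norm_Linf0_eq)
    then obtain c where "bounded_by a c" "c < norm_Linf0 a + inverse (of_nat (Suc n))"
      using bounded_by_ex[of a] by (subst (asm) cInf_less_iff) (auto intro: bdd_belowI)
    then show ?thesis by (meson bounded_by_mono less_imp_le)
  qed
  then have *: "\<forall>n. bounded_by a (norm_Linf0 a + inverse (of_nat (Suc n)))" by blast
  have "bounded_by a d" if "\<forall>n. bounded_by a (d + inverse (of_nat (Suc n)))" for d
    using that
  proof transfer
    fix f :: "real \<Rightarrow> real" and d :: real
    assume "\<forall>n. AE x in I01. \<bar>f x\<bar> \<le> d + inverse (of_nat (Suc n))"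
    then have "AE x in I01. \<forall>n. \<bar>f x\<bar> \<le> d + inverse (of_nat (Suc n))"
      by (simp add: AE_all_countable)
    then show "AE x in I01. \<bar>f x\<bar> \<le> d"
    proof (rule eventually_mono)
      fix x assume b: "\<forall>n. \<bar>f x\<bar> \<le> d + inverse (of_nat (Suc n))"
      have "(\<lambda>n. d + inverse (of_nat (Suc n))) \<longlonglongrightarrow> d + 0"
        by (intro tendsto_intros LIMSEQ_inverse_real_of_nat)
      then show "\<bar>f x\<bar> \<le> d" using b by (intro LIMSEQ_le_const[where a="\<bar>f x\<bar>"]) auto
    qed
  qed
  then show ?thesis using * by blast
qed

instantiation Linf :: real_normed_vector
begin

lift_definition zero_Linf :: Linf is "\<lambda>x. 0"
  by (simp add: linf_rel_def ess_bounded_const)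

lift_definition plus_Linf :: "Linf \<Rightarrow> Linf \<Rightarrow> Linf" is "\<lambda>f g x. f x + g x"
  unfolding linf_rel_def by (auto simp: ess_bounded_add elim: eventually_elim2)

lift_definition scaleR_Linf :: "real \<Rightarrow> Linf \<Rightarrow> Linf" is "\<lambda>r f x. r * f x"
  unfolding linf_rel_def by (auto simp: ess_bounded_scale elim!: eventually_mono)

definition uminus_Linf :: "Linf \<Rightarrow> Linf" where "uminus_Linf f = (-1) *\<^sub>R f"

definition minus_Linf :: "Linf \<Rightarrow> Linf \<Rightarrow> Linf" where "minus_Linf f g = f + (- g)" for f g :: Linf

definition norm_Linf :: "Linf \<Rightarrow> real" where "norm_Linf = norm_Linf0"

definition sgn_Linf :: "Linf \<Rightarrow> Linf" where "sgn_Linf f = scaleR (inverse (norm f)) f"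

definition dist_Linf :: "Linf \<Rightarrow> Linf \<Rightarrow> real" where "dist_Linf f g = norm (f - g)"

definition uniformity_Linf :: "(Linf \<times> Linf) filter" where
  "uniformity_Linf = (INF e\<in>{0<..}. principal {(x, y). dist x y < e})"

definition open_Linf :: "Linf set \<Rightarrow> bool" where
  "open_Linf U \<longleftrightarrow> (\<forall>x\<in>U. eventually (\<lambda>(x', y). x' = x \<longrightarrow> y \<in> U) uniformity)"

instance
proof
  fix f g h :: Linf and r s :: real
  show "f + g + h = f + (g + h)"
    by transfer (auto simp: linf_rel_def ess_bounded_add algebra_simps)
  show "f + g = g + f"
    by transfer (auto simp: linf_rel_def ess_bounded_add algebra_simps)
  show "0 + f = f"
    by transfer (auto simp: linf_rel_def)
  show "- f + f = 0"
    unfolding uminus_Linf_def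
    by transfer (auto simp: linf_rel_def ess_bounded_const)
  show "f - g = f + - g" by (simp add: minus_Linf_def)
  show "r *\<^sub>R (f + g) = r *\<^sub>R f + r *\<^sub>R g"
    by transfer (simp add: linf_rel_def distrib_left ess_bounded_add ess_bounded_scale)
  show "(r + s) *\<^sub>R f = r *\<^sub>R f + s *\<^sub>R f"
    by transfer (simp add: linf_rel_def distrib_right ess_bounded_add ess_bounded_scale)
  show "r *\<^sub>R s *\<^sub>R f = (r * s) *\<^sub>R f"
    by transfer (simp add: linf_rel_def mult.assoc ess_bounded_scale)
  show "1 *\<^sub>R f = f"
    by transfer (auto simp: linf_rel_def)
  show "sgn f = scaleR (inverse (norm f)) f" by (simp add: sgn_Linf_def)
  show "dist f g = norm (f - g)" by (simp add: dist_Linf_def)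
  show "norm f = 0 \<longleftrightarrow> f = 0"
  proof
    assume "norm f = 0"
    then have "bounded_by f 0" using bounded_by_norm[of f] by (simp add: norm_Linf_def)
    then show "f = 0" by transfer (auto simp: linf_rel_def ess_bounded_const)
  next
    assume "f = 0"
    then have "bounded_by f 0" by transfer (auto simp: linf_rel_def)
    then show "norm f = 0"
      using norm_Linf0_le[of 0 f] norm_Linf0_nonneg[of f] by (simp add: norm_Linf_def)
  qed
  have "bounded_by (f + g) (c + d)" if "bounded_by f c" "bounded_by g d" for c d
    using that by transfer (auto elim!: eventually_elim2 intro: order_trans[OF abs_triangle_ineq])
  then show "norm (f + g) \<le> norm f + norm g"
    unfolding norm_Linf_def
    by (intro norm_Linf0_le) (auto intro: bounded_by_norm norm_Linf0_nonneg add_nonneg_nonneg)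
  have sc: "norm (t *\<^sub>R k) \<le> \<bar>t\<bar> * norm k" for t and k :: Linf
  proof -
    have "bounded_by (t *\<^sub>R k) (\<bar>t\<bar> * c)" if "bounded_by k c" for c
      using that by transfer (auto elim!: eventually_mono simp: abs_mult mult_left_mono)
    then show ?thesis
      unfolding norm_Linf_def
      by (intro norm_Linf0_le) (auto intro: bounded_by_norm norm_Linf0_nonneg mult_nonneg_nonneg)
  qed
  have one: "1 *\<^sub>R f = f" by transfer (auto simp: linf_rel_def)
  have comp: "r *\<^sub>R s *\<^sub>R f = (r * s) *\<^sub>R f" for r s
    by transfer (simp add: linf_rel_def mult.assoc ess_bounded_scale)
  show "norm (r *\<^sub>R f) = \<bar>r\<bar> * norm f"
  proof (cases "r = 0")
    case True
    then show ?thesis using sc[of r f] norm_Linf0_nonneg[of "r *\<^sub>R f"] by (simp add: norm_Linf_def)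
  next
    case False
    have "norm f = norm (inverse r *\<^sub>R r *\<^sub>R f)" using False by (simp add: comp one)
    also have "\<dots> \<le> \<bar>inverse r\<bar> * norm (r *\<^sub>R f)" by (rule sc)
    finally have "\<bar>r\<bar> * norm f \<le> norm (r *\<^sub>R f)"
      using False by (simp add: field_simps)
    then show ?thesis using sc[of r f] by simp
  qed
qed (fact uniformity_Linf_def open_Linf_def)+

end


section \<open>Multiplication operators\<close>

lemma ess_bounded_mult_square_integrable:
  assumes a: "ess_bounded a" and f: "square_integrable f"
  shows "square_integrable (\<lambda>x. of_real (a x) * f x)"
  unfolding square_integrable_def
proof
  have [measurable]: "a \<in> borel_measurable I01" "f \<in> borel_measurable I01"
    using a f by (auto simp: ess_bounded_def square_integrable_def)
  show "(\<lambda>x. of_real (a x) * f x) \<in> borel_measurable I01" by measurable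
  obtain c where c: "AE x in I01. \<bar>a x\<bar> \<le> c" using a by (auto simp: ess_bounded_def)
  show "integrable I01 (\<lambda>x. (cmod (of_real (a x) * f x))\<^sup>2)"
  proof (rule Bochner_Integration.integrable_bound)
    show "integrable I01 (\<lambda>x. c\<^sup>2 * (cmod (f x))\<^sup>2)"
      using f by (simp add: square_integrable_def)
    show "(\<lambda>x. (cmod (of_real (a x) * f x))\<^sup>2) \<in> borel_measurable I01" by measurable
    show "AE x in I01. norm ((cmod (of_real (a x) * f x))\<^sup>2) \<le> norm (c\<^sup>2 * (cmod (f x))\<^sup>2)"
      using c
    proof (rule eventually_mono)
      fix x assume "\<bar>a x\<bar> \<le> c"
      then have "\<bar>a x\<bar>\<^sup>2 \<le> c\<^sup>2" by (intro power_mono) auto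
      then show "norm ((cmod (of_real (a x) * f x))\<^sup>2) \<le> norm (c\<^sup>2 * (cmod (f x))\<^sup>2)"
        by (simp add: norm_mult power_mult_distrib mult_right_mono)
    qed
  qed
qed

lift_definition mult_L2 :: "Linf \<Rightarrow> L2 \<Rightarrow> L2" is "\<lambda>a f x. of_real (a x) * f x"
  unfolding linf_rel_def l2_rel_def
  by (auto simp: ess_bounded_mult_square_integrable elim: eventually_elim2)

lemma norm_L2_sq: "(norm f)\<^sup>2 = Re (cinner f f)"
  by (simp add: norm_eq_sqrt_inner) (simp add: inner_L2_def)

lemma norm_mult_L2_le: "norm (mult_L2 a f) \<le> norm a * norm f"
proof (rule power2_le_imp_le)
  have sq: "cnj z * z = of_real ((cmod z)\<^sup>2)" for z
    by (metis complex_norm_square mult.commute)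
  have "Re (cinner (mult_L2 a f) (mult_L2 a f)) \<le> c\<^sup>2 * Re (cinner f f)" if "bounded_by a c" for c
    using that
  proof transfer
    fix a f c assume a: "linf_rel a a" and f: "l2_rel f f" and c: "AE x in I01. \<bar>a x\<bar> \<le> c"
    have sa: "square_integrable (\<lambda>x. of_real (a x) * f x)"
      using a f by (simp add: linf_rel_def l2_rel_def ess_bounded_mult_square_integrable)
    have "integral\<^sup>L I01 (\<lambda>x. (cmod (of_real (a x) * f x))\<^sup>2) \<le> integral\<^sup>L I01 (\<lambda>x. c\<^sup>2 * (cmod (f x))\<^sup>2)"
    proof (rule integral_mono_AE)
      show "integrable I01 (\<lambda>x. (cmod (of_real (a x) * f x))\<^sup>2)" "integrable I01 (\<lambda>x. c\<^sup>2 * (cmod (f x))\<^sup>2)"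
        using sa f by (auto simp: square_integrable_def l2_rel_def)
      show "AE x in I01. (cmod (of_real (a x) * f x))\<^sup>2 \<le> c\<^sup>2 * (cmod (f x))\<^sup>2"
        using c
      proof (rule eventually_mono)
        fix x assume "\<bar>a x\<bar> \<le> c"
        then have "\<bar>a x\<bar>\<^sup>2 \<le> c\<^sup>2" by (intro power_mono) auto
        then show "(cmod (of_real (a x) * f x))\<^sup>2 \<le> c\<^sup>2 * (cmod (f x))\<^sup>2"
          by (simp add: norm_mult power_mult_distrib mult_right_mono)
      qed
    qed
    then show "Re (integral\<^sup>L I01 (\<lambda>x. cnj (of_real (a x) * f x) * (of_real (a x) * f x)))
                 \<le> c\<^sup>2 * Re (integral\<^sup>L I01 (\<lambda>x. cnj (f x) * f x))"
      unfolding sq by (simp del: of_real_power)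
  qed
  from this[OF bounded_by_norm]
  show "(norm (mult_L2 a f))\<^sup>2 \<le> (norm a * norm f)\<^sup>2"
    by (simp add: norm_L2_sq power_mult_distrib norm_Linf_def)
qed auto

lift_definition mult_op :: "Linf \<Rightarrow> L2 \<Rightarrow>\<^sub>L L2" is mult_L2
proof -
  fix a :: Linf
  show "bounded_linear (mult_L2 a)"
  proof (rule bounded_linear_intro[where K="norm a"])
    fix f g :: L2 and r :: real
    show "mult_L2 a (f + g) = mult_L2 a f + mult_L2 a g"
      by transfer (simp add: linf_rel_def l2_rel_def distrib_left square_integrable_add
          ess_bounded_mult_square_integrable)
    show "mult_L2 a (r *\<^sub>R f) = r *\<^sub>R mult_L2 a f"
      unfolding scaleR_L2_def
      by transfer (simp add: linf_rel_def l2_rel_def mult.left_commute square_integrable_scale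
          ess_bounded_mult_square_integrable)
    show "norm (mult_L2 a f) \<le> norm f * norm a"
      using norm_mult_L2_le[of a f] by (simp add: mult.commute)
  qed
qed


section \<open>Trace class operators and the trace\<close>

definition complex_linear :: "(L2 \<Rightarrow>\<^sub>L L2) \<Rightarrow> bool" where
  "complex_linear A \<longleftrightarrow> (\<forall>c f. blinfun_apply A (scaleC c f) = scaleC c (blinfun_apply A f))"

definition orthonormal_on :: "nat set \<Rightarrow> (nat \<Rightarrow> L2) \<Rightarrow> bool" where
  "orthonormal_on N e \<longleftrightarrow> (\<forall>i\<in>N. \<forall>j\<in>N. cinner (e i) (e j) = (if i = j then 1 else 0))"

text \<open>
  The trace norm is taken in the form
  $\|A\|_1 = \sup \sum_i |\langle f_i, A e_i\rangle|$, the supremum over all pairs of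
  orthonormal families; \<open>A\<close> is trace class iff this is finite. Finite families suffice.
\<close>

definition trace_sums :: "(L2 \<Rightarrow>\<^sub>L L2) \<Rightarrow> real set" where
  "trace_sums A = {(\<Sum>i<n. cmod (cinner (f i) (blinfun_apply A (e i)))) | n e f.
     orthonormal_on {..<n} e \<and> orthonormal_on {..<n} f}"

definition trace_class_op :: "(L2 \<Rightarrow>\<^sub>L L2) \<Rightarrow> bool" where
  "trace_class_op A \<longleftrightarrow> complex_linear A \<and> bdd_above (trace_sums A)"

definition trace_norm :: "(L2 \<Rightarrow>\<^sub>L L2) \<Rightarrow> real" where
  "trace_norm A = Sup (trace_sums A)"

lemma cinner_add_right: "cinner f (g + h) = cinner f g + cinner f h"
  by transfer (simp add: l2_rel_def distrib_left square_integrable_mult)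

lemma cinner_scaleC_right: "cinner f (scaleC c g) = c * cinner f g"
  by transfer (simp add: mult.left_commute)

lemma cinner_scaleC_left: "cinner (scaleC c f) g = cnj c * cinner f g"
  by transfer (simp add: mult.assoc)

lemma scaleC_add: "scaleC c (f + g) = scaleC c f + scaleC c g"
  by transfer (simp add: l2_rel_def distrib_left square_integrable_add square_integrable_scale)

lemma scaleC_scaleC: "scaleC c (scaleC d f) = scaleC (c * d) f"
  by transfer (simp add: l2_rel_def mult.assoc square_integrable_scale)

lemma cinner_scaleR_right: "cinner f (r *\<^sub>R g) = of_real r * cinner f g"
  by (simp add: scaleR_L2_def cinner_scaleC_right)

lemma cinner_zero_right: "cinner f 0 = 0"
  by transfer simp

lemma cinner_same: "cinner f f = of_real ((norm f)\<^sup>2)"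
proof -
  have sq: "cnj z * z = of_real ((cmod z)\<^sup>2)" for z
    by (metis complex_norm_square mult.commute)
  have "Im (cinner f f) = 0"
    by transfer (simp add: sq del: of_real_power)
  then show ?thesis by (simp add: complex_eq_iff norm_L2_sq del: of_real_power)
qed

lemma zero_in_trace_sums: "0 \<in> trace_sums A"
proof -
  have "orthonormal_on {..<0} (\<lambda>_. 0)" by (simp add: orthonormal_on_def)
  then show ?thesis unfolding trace_sums_def by (intro CollectI exI[of _ 0]) auto
qed

lemma trace_sums_le: "trace_class_op A \<Longrightarrow> s \<in> trace_sums A \<Longrightarrow> s \<le> trace_norm A"
  unfolding trace_norm_def trace_class_op_def by (auto intro: cSup_upper)

lemma trace_class_opI:
  assumes "complex_linear A" "\<And>s. s \<in> trace_sums A \<Longrightarrow> s \<le> C"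
  shows "trace_class_op A" "trace_norm A \<le> C"
proof -
  show "trace_class_op A"
    unfolding trace_class_op_def using assms by (intro conjI bdd_aboveI[of _ C])
  show "trace_norm A \<le> C"
    unfolding trace_norm_def using assms(2) zero_in_trace_sums[of A] by (blast intro: cSup_least)
qed

lemma trace_class_op_zero: "trace_class_op 0"
proof (rule trace_class_opI(1)[where C=0])
  have "scaleC c 0 = 0" for c
    by transfer (simp add: l2_rel_def square_integrable_zero)
  then show "complex_linear 0" by (simp add: complex_linear_def)
qed (auto simp: trace_sums_def cinner_zero_right)

lemma trace_class_op_add:
  assumes A: "trace_class_op A" and B: "trace_class_op B"
  shows "trace_class_op (A + B)" "trace_norm (A + B) \<le> trace_norm A + trace_norm B"
proof -
  have 1: "complex_linear (A + B)"
    using A B by (simp add: trace_class_op_def complex_linear_def plus_blinfun.rep_eq scaleC_add)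
  have 2: "s \<le> trace_norm A + trace_norm B" if s: "s \<in> trace_sums (A + B)" for s
  proof -
    obtain n e f where o: "orthonormal_on {..<n} e" "orthonormal_on {..<n} f"
      and s: "s = (\<Sum>i<n. cmod (cinner (f i) (blinfun_apply (A + B) (e i))))"
      using s by (auto simp: trace_sums_def)
    have "s \<le> (\<Sum>i<n. cmod (cinner (f i) (blinfun_apply A (e i))))
              + (\<Sum>i<n. cmod (cinner (f i) (blinfun_apply B (e i))))"
      unfolding s sum.distrib[symmetric]
      by (intro sum_mono) (simp add: plus_blinfun.rep_eq cinner_add_right norm_triangle_ineq)
    also have "\<dots> \<le> trace_norm A + trace_norm B"
      using o by (intro add_mono trace_sums_le A B) (auto simp: trace_sums_def)
    finally show ?thesis .
  qed
  show "trace_class_op (A + B)" "trace_norm (A + B) \<le> trace_norm A + trace_norm B"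
    using trace_class_opI[OF 1 2] by auto
qed

lemma trace_class_op_scaleR:
  assumes A: "trace_class_op A"
  shows "trace_class_op (r *\<^sub>R A)" "trace_norm (r *\<^sub>R A) \<le> \<bar>r\<bar> * trace_norm A"
proof -
  have 1: "complex_linear (r *\<^sub>R A)"
    using A by (simp add: trace_class_op_def complex_linear_def scaleR_blinfun.rep_eq
        scaleR_L2_def scaleC_scaleC mult.commute)
  have 2: "s \<le> \<bar>r\<bar> * trace_norm A" if s: "s \<in> trace_sums (r *\<^sub>R A)" for s
  proof -
    obtain n e f where o: "orthonormal_on {..<n} e" "orthonormal_on {..<n} f"
      and s: "s = (\<Sum>i<n. cmod (cinner (f i) (blinfun_apply (r *\<^sub>R A) (e i))))"
      using s by (auto simp: trace_sums_def)
    have "s = \<bar>r\<bar> * (\<Sum>i<n. cmod (cinner (f i) (blinfun_apply A (e i))))"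
      unfolding s sum_distrib_left
      by (simp add: scaleR_blinfun.rep_eq cinner_scaleR_right norm_mult)
    also have "\<dots> \<le> \<bar>r\<bar> * trace_norm A"
      using o by (intro mult_left_mono trace_sums_le A) (auto simp: trace_sums_def)
    finally show ?thesis .
  qed
  show "trace_class_op (r *\<^sub>R A)" "trace_norm (r *\<^sub>R A) \<le> \<bar>r\<bar> * trace_norm A"
    using trace_class_opI[OF 1 2] by auto
qed

lemma trace_norm_nonneg: "trace_class_op A \<Longrightarrow> 0 \<le> trace_norm A"
  by (rule trace_sums_le[OF _ zero_in_trace_sums])

lemma trace_norm_eq_0:
  assumes A: "trace_class_op A" and 0: "trace_norm A = 0"
  shows "A = 0"
proof (rule blinfun_eqI)
  fix x
  show "blinfun_apply A x = blinfun_apply 0 x"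
  proof (rule ccontr)
    assume "blinfun_apply A x \<noteq> blinfun_apply 0 x"
    then have Ax: "blinfun_apply A x \<noteq> 0" by simp
    then have x: "x \<noteq> 0" by auto
    define u where "u = inverse (norm x) *\<^sub>R x"
    define y where "y = blinfun_apply A u"
    have y: "y \<noteq> 0" using Ax x by (simp add: y_def u_def blinfun.scaleR_right)
    define v where "v = inverse (norm y) *\<^sub>R y"
    have "orthonormal_on {..<1} (\<lambda>_. u)" "orthonormal_on {..<1} (\<lambda>_. v)"
      using x y by (auto simp: orthonormal_on_def cinner_same u_def v_def)
    then have "(\<Sum>i<(1::nat). cmod (cinner v (blinfun_apply A u))) \<in> trace_sums A"
      unfolding trace_sums_def
      by (intro CollectI exI[of _ 1] exI[of _ "\<lambda>_. u"] exI[of _ "\<lambda>_. v"]) auto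
    from trace_sums_le[OF A this] have "cinner v y = 0" by (simp add: 0 y_def)
    moreover have "cinner v y = of_real (norm y)"
      using y by (simp add: v_def scaleR_L2_def cinner_scaleC_left cinner_same power2_eq_square)
    ultimately show False using y by simp
  qed
qed

typedef trace_class = "{A :: L2 \<Rightarrow>\<^sub>L L2. trace_class_op A}"
  using trace_class_op_zero by auto

setup_lifting type_definition_trace_class

instantiation trace_class :: real_normed_vector
begin

lift_definition zero_trace_class :: trace_class is 0
  by (rule trace_class_op_zero)

lift_definition plus_trace_class :: "trace_class \<Rightarrow> trace_class \<Rightarrow> trace_class" is "(+)"
  by (rule trace_class_op_add)

lift_definition scaleR_trace_class :: "real \<Rightarrow> trace_class \<Rightarrow> trace_class" is "(*\<^sub>R)"
  by (rule trace_class_op_scaleR)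

lift_definition uminus_trace_class :: "trace_class \<Rightarrow> trace_class" is uminus
  using trace_class_op_scaleR(1)[of _ "-1"] by simp

lift_definition minus_trace_class :: "trace_class \<Rightarrow> trace_class \<Rightarrow> trace_class" is "(-)"
  using trace_class_op_add(1)[OF _ trace_class_op_scaleR(1)[of _ "-1"]] by simp

lift_definition norm_trace_class :: "trace_class \<Rightarrow> real" is trace_norm .

definition sgn_trace_class :: "trace_class \<Rightarrow> trace_class" where
  "sgn_trace_class A = scaleR (inverse (norm A)) A"

definition dist_trace_class :: "trace_class \<Rightarrow> trace_class \<Rightarrow> real" where
  "dist_trace_class A B = norm (A - B)"

definition uniformity_trace_class :: "(trace_class \<times> trace_class) filter" where
  "uniformity_trace_class = (INF e\<in>{0<..}. principal {(x, y). dist x y < e})"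

definition open_trace_class :: "trace_class set \<Rightarrow> bool" where
  "open_trace_class U \<longleftrightarrow> (\<forall>x\<in>U. eventually (\<lambda>(x', y). x' = x \<longrightarrow> y \<in> U) uniformity)"

instance
proof
  fix A B C :: trace_class and r s :: real
  show "A + B + C = A + (B + C)" by transfer simp
  show "A + B = B + A" by transfer simp
  show "0 + A = A" by transfer simp
  show "- A + A = 0" by transfer simp
  show "A - B = A + - B" by transfer simp
  show "r *\<^sub>R (A + B) = r *\<^sub>R A + r *\<^sub>R B" by transfer (simp add: scaleR_add_right)
  show "(r + s) *\<^sub>R A = r *\<^sub>R A + s *\<^sub>R A" by transfer (simp add: scaleR_add_left)
  show "r *\<^sub>R s *\<^sub>R A = (r * s) *\<^sub>R A" by transfer simp
  show "1 *\<^sub>R A = A" by transfer simp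
  show "sgn A = scaleR (inverse (norm A)) A" by (simp add: sgn_trace_class_def)
  show "dist A B = norm (A - B)" by (simp add: dist_trace_class_def)
  show "norm A = 0 \<longleftrightarrow> A = 0"
  proof transfer
    fix A assume A: "trace_class_op A"
    have "trace_norm 0 \<le> 0"
      by (rule cSup_least[of "trace_sums 0", folded trace_norm_def])
         (use zero_in_trace_sums[of 0] in \<open>auto simp: trace_sums_def cinner_zero_right\<close>)
    then have "trace_norm 0 = 0"
      using trace_norm_nonneg[OF trace_class_op_zero] by simp
    then show "trace_norm A = 0 \<longleftrightarrow> A = 0" using trace_norm_eq_0[OF A] by auto
  qed
  show "norm (A + B) \<le> norm A + norm B"
    by transfer (rule trace_class_op_add)
  show "norm (r *\<^sub>R A) = \<bar>r\<bar> * norm A"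
  proof transfer
    fix r A assume A: "trace_class_op A"
    show "trace_norm (r *\<^sub>R A) = \<bar>r\<bar> * trace_norm A"
    proof (cases "r = 0")
      case True
      then show ?thesis
        using trace_class_op_scaleR[OF A, of r] trace_norm_nonneg[of "r *\<^sub>R A"] by simp
    next
      case False
      have "trace_norm A = trace_norm (inverse r *\<^sub>R r *\<^sub>R A)" using False by simp
      also have "\<dots> \<le> \<bar>inverse r\<bar> * trace_norm (r *\<^sub>R A)"
        by (intro trace_class_op_scaleR A)
      finally have "\<bar>r\<bar> * trace_norm A \<le> trace_norm (r *\<^sub>R A)"
        using False by (simp add: field_simps)
      then show ?thesis using trace_class_op_scaleR(2)[OF A, of r] by simp
    qed
  qed
qed (fact uniformity_trace_class_def open_trace_class_def)+

end

text \<open>Orthonormal bases are the maximal orthonormal sequences.\<close>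

definition orthonormal_basis :: "(nat \<Rightarrow> L2) \<Rightarrow> bool" where
  "orthonormal_basis e \<longleftrightarrow>
     orthonormal_on UNIV e \<and> (\<forall>f. (\<forall>n. cinner (e n) f = 0) \<longrightarrow> f = 0)"

text \<open>The trace is the common value of $\sum_n \langle e_n, A e_n\rangle$ over all orthonormal bases.\<close>

definition op_trace :: "trace_class \<Rightarrow> complex" where
  "op_trace A = (THE t. \<forall>e. orthonormal_basis e \<longrightarrow>
      (\<lambda>n. cinner (e n) (blinfun_apply (Rep_trace_class A) (e n))) sums t)"


section \<open>The Dirichlet Laplacian and its inverse\<close>

definition absolutely_continuous_on :: "real \<Rightarrow> real \<Rightarrow> (real \<Rightarrow> complex) \<Rightarrow> bool" where
  "absolutely_continuous_on a b f \<longleftrightarrow>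
     (\<forall>\<epsilon>>0. \<exists>\<delta>>0. \<forall>d. d division_of \<Union>d \<and> \<Union>d \<subseteq> {a..b} \<and> (\<Sum>k\<in>d. Sup k - Inf k) < \<delta> \<longrightarrow>
        (\<Sum>k\<in>d. norm (f (Sup k) - f (Inf k))) < \<epsilon>)"

text \<open>
  The graph of \<open>T\<^sup>*T\<close>: \<open>u\<close> is the continuous representative of \<open>f\<close>, \<open>v\<close> its derivative, and
  \<open>w\<close> the almost everywhere defined second derivative.
\<close>

definition dirichlet_laplacian :: "L2 \<Rightarrow> L2 \<Rightarrow> bool" where
  "dirichlet_laplacian f g \<longleftrightarrow>
     (\<exists>u v w. absolutely_continuous_on 0 1 u \<and> absolutely_continuous_on 0 1 v \<and>
        u 0 = 0 \<and> u 1 = 0 \<and>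
        (\<forall>x\<in>{0..1}. (u has_vector_derivative v x) (at x within {0..1})) \<and>
        (AE x in I01. (v has_vector_derivative w x) (at x)) \<and>
        square_integrable w \<and>
        f = class_L2 u \<and> g = - class_L2 w)"

definition dirichlet_inverse :: "L2 \<Rightarrow>\<^sub>L L2" where
  "dirichlet_inverse = (THE G. \<forall>f g. blinfun_apply G g = f \<longleftrightarrow> dirichlet_laplacian f g)"


section \<open>The operators $R_n(\alpha)$ and the trace map\<close>

text \<open>
  Taylor coefficients at $0$ of $R(\zeta) = -(2\zeta+\alpha)(T^*T+\zeta^2+\zeta\alpha)^{-1}$, obtained by
  comparing coefficients in $R(\zeta)(T^*T+\zeta^2+\zeta\alpha) = -(2\zeta+\alpha)$.
\<close>

fun R_op :: "nat \<Rightarrow> Linf \<Rightarrow> (L2 \<Rightarrow>\<^sub>L L2)" where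
  "R_op 0 \<alpha> = - (mult_op \<alpha> o\<^sub>L dirichlet_inverse)"
| "R_op (Suc 0) \<alpha> = - 2 *\<^sub>R dirichlet_inverse
     + (mult_op \<alpha> o\<^sub>L dirichlet_inverse o\<^sub>L mult_op \<alpha> o\<^sub>L dirichlet_inverse)"
| "R_op (Suc (Suc n)) \<alpha> = - (R_op n \<alpha> o\<^sub>L dirichlet_inverse)
     - (R_op (Suc n) \<alpha> o\<^sub>L mult_op \<alpha> o\<^sub>L dirichlet_inverse)"

text \<open>
  Meaningful because every \<open>R_op n \<alpha>\<close> is trace class. The topology on the target is that of the
  trace norm, so Frechet derivatives of \<open>R_tc n\<close> are taken in trace norm.
\<close>

definition R_tc :: "nat \<Rightarrow> Linf \<Rightarrow> trace_class" where
  "R_tc n \<alpha> = Abs_trace_class (R_op n \<alpha>)"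

definition trace_map :: "Linf \<Rightarrow> nat \<Rightarrow> complex" where
  "trace_map \<alpha> n = op_trace (R_tc n \<alpha>)"

definition componentwise_derivative :: "(Linf \<Rightarrow> nat \<Rightarrow> complex) \<Rightarrow> Linf \<Rightarrow> Linf \<Rightarrow> nat \<Rightarrow> complex" where
  "componentwise_derivative F \<alpha> \<delta>\<alpha> = (\<lambda>n. frechet_derivative (\<lambda>\<beta>. F \<beta> n) (at \<alpha>) \<delta>\<alpha>)"

end

theory Submission
  imports Defs
begin

text \<open>
  Every \<open>R_n(\<alpha>)\<close> has the form \<open>B_n(\<alpha>) G\<close> with \<open>G\<close> the Dirichlet inverse and \<open>B_n\<close> polynomial in \<open>\<alpha>\<close>.
  In the sine basis \<open>\<phi>_k\<close>, with \<open>G \<phi>_k = l_k \<phi>_k\<close>, the trace of \<open>B G\<close> is the sum of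
  \<open>l_k \<langle>\<phi>_k, B \<phi>_k\<rangle>\<close>, so everything follows from the bounded operators \<open>B_n\<close> alone.

  At a constant \<open>a\<close>, the diagonal entries of the derivative of \<open>B_n\<close> in the direction \<open>\<delta>\<close> have the
  generating function \<open>- d_k d/d\<zeta> (\<zeta> / (1 + l_k (\<zeta>\<^sup>2 + a \<zeta>)))\<close> with
  \<open>d_k = \<langle>\<phi>_k, \<delta> \<phi>_k\<rangle>\<close>. The vanishing of all trace derivatives thus says that the sum of
  \<open>l_k d_k / (1 + l_k (\<zeta>\<^sup>2 + a \<zeta>))\<close> vanishes as a power series in \<open>\<zeta>\<close>, which is equivalent to the
  vanishing of all moments of the weights \<open>l_k d_k\<close> at the distinct points \<open>l_k\<close>; hence every \<open>d_k\<close> is \<open>0\<close>.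
  As \<open>d_k\<close> is the integral of \<open>\<delta>(x) (1 - cos (2 k \<pi> x))\<close>, an even \<open>\<delta>\<close> is then \<open>0\<close> by completeness of
  the cosines.
\<close>

text \<open>The derivative at a constant is computable because each of its terms contains \<delta>
  exactly once, between functions of \<open>G\<close>, which are diagonal in the sine basis:
  \<open>X \<delta> Y\<close> has the diagonal entry \<open>x_k d_k y_k\<close>. Differentiating
  \<open>- (2 \<zeta> + \<alpha>) / (1 + l (\<zeta>^2 + \<alpha> \<zeta>))\<close> in \<alpha> gives
  \<open>- (1 + l (\<zeta>^2 + a \<zeta>) - l \<zeta> (2 \<zeta> + a)) / (1 + l (\<zeta>^2 + a
  \<zeta>))^2\<close>, an exact \<zeta>-derivative. It only multiplies Taylor coefficients by
  \<open>n + 1\<close>, so no information is lost. Two obstacles account for the analysis.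
  \<open>dirichlet_inverse\<close> is a definite description over the graph of the Laplacian: that
  Green's formula solves the equation needs Lebesgue differentiation, and that nothing else does
  needs an absolutely continuous function to be the integral of its derivative.
  \<open>op_trace\<close> quantifies over all orthonormal bases: the summable bound
  \<open>norm B * lam k\<close> yields basis independence, and also the continuity of
  \<open>B \<mapsto> B G\<close> from operator norm to trace norm, through which derivatives are
  carried.\<close>

section \<open>Differentiation and absolute continuity on the line\<close>

text \<open>Lebesgue differentiation: by Vitali, the points at which all difference quotients stay away
  from \<open>f x\<close> are covered by disjoint intervals, whose total length Henstock's lemma controls.\<close>

lemma negligible_bad_difference_quotients:
  fixes f :: "real \<Rightarrow> 'b::euclidean_space"
  assumes f: "f integrable_on {a..b}" and \<epsilon>: "\<epsilon> > 0"
  shows "negligible {x\<in>{a<..<b}. \<forall>d>0. \<exists>s t. s < t \<and> x \<in> {s..t} \<and> {s..t} \<subseteq> {a..b} \<and> t - s < d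
           \<and> norm ((t - s) *\<^sub>R f x - integral {s..t} f) \<ge> \<epsilon> * (t - s)}" (is "negligible ?B")
  unfolding negligible_outer_le
proof (intro allI impI)
  fix e :: real assume e: "e > 0"
  obtain \<gamma> where \<gamma>: "gauge \<gamma>" and hen: "\<And>p. \<lbrakk>p tagged_partial_division_of (cbox a b); \<gamma> fine p\<rbrakk> \<Longrightarrow>
             sum (\<lambda>(x,k). norm (measure lborel k *\<^sub>R f x - integral k f)) p < \<epsilon> * e"
    using Henstock_lemma[of f a b "\<epsilon> * e"] f \<epsilon> e by auto
  \<comment> \<open>A triple is a tag with the endpoints of a bad interval inside its gauge set.
    Centre \<open>m\<close> and radius \<open>r\<close> recast the interval as a closed ball, the
    shape in which Vitali's theorem takes its cover.\<close>
  define P where "P = (\<lambda>i::real \<times> real \<times> real. case i of (x, s, t) \<Rightarrow> s < t \<and> x \<in> {s..t} \<and> {s..t} \<subseteq> {a..b}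
      \<and> {s..t} \<subseteq> \<gamma> x \<and> norm ((t - s) *\<^sub>R f x - integral {s..t} f) \<ge> \<epsilon> * (t - s))"
  define m where "m = (\<lambda>i::real \<times> real \<times> real. case i of (x, s, t) \<Rightarrow> (s + t) / 2)"
  define r where "r = (\<lambda>i::real \<times> real \<times> real. case i of (x, s, t) \<Rightarrow> (t - s) / 2)"
  have cb: "cball (m i) (r i) = {fst (snd i)..snd (snd i)}" for i
    by (cases i) (auto simp: m_def r_def cball_eq_atLeastAtMost field_simps)
  have Pe: "P i \<longleftrightarrow> fst (snd i) < snd (snd i) \<and> fst i \<in> {fst (snd i)..snd (snd i)} \<and> {fst (snd i)..snd (snd i)} \<subseteq> {a..b}
      \<and> {fst (snd i)..snd (snd i)} \<subseteq> \<gamma> (fst i)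
      \<and> norm ((snd (snd i) - fst (snd i)) *\<^sub>R f (fst i) - integral {fst (snd i)..snd (snd i)} f) \<ge> \<epsilon> * (snd (snd i) - fst (snd i))" for i
    by (simp only: P_def split_beta)
  have 1: "0 < r i" if "i \<in> Collect P" for i
    using that by (auto simp: P_def r_def)
  have 2: "\<exists>i. i \<in> Collect P \<and> x \<in> cball (m i) (r i) \<and> r i < d" if x: "x \<in> ?B" and d: "0 < d" for x d
  proof -
    obtain \<eta> where \<eta>: "\<eta> > 0" "ball x \<eta> \<subseteq> \<gamma> x"
      using \<gamma> by (metis gauge_def open_contains_ball)
    obtain s t where st: "s < t" "x \<in> {s..t}" "{s..t} \<subseteq> {a..b}" "t - s < min d \<eta>"
        "norm ((t - s) *\<^sub>R f x - integral {s..t} f) \<ge> \<epsilon> * (t - s)"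
      using x d \<eta> by (auto dest!: spec[of _ "min d \<eta>"])
    have "{s..t} \<subseteq> ball x \<eta>" using st by (auto simp: dist_real_def)
    then have "P (x, s, t)" using \<eta> st unfolding P_def by auto
    moreover have "x \<in> cball (m (x, s, t)) (r (x, s, t))" unfolding cb using st by simp
    moreover have "r (x, s, t) < d" using st by (simp add: r_def)
    ultimately show ?thesis by blast
  qed
  obtain C where C: "countable C" "C \<subseteq> Collect P"
     "pairwise (\<lambda>i j. disjnt (cball (m i) (r i)) (cball (m j) (r j))) C"
     "negligible (?B - (\<Union>i \<in> C. cball (m i) (r i)))"
    by (rule Vitali_covering_theorem_cballs[of "Collect P" r ?B m, OF 1 2])
  \<comment> \<open>Finitely many of the disjoint intervals form a fine partial tagged division. Its
    error sum is below \<open>\<epsilon> * e\<close> by Henstock, and at least \<epsilon> times the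
    total length by badness.\<close>
  have bound: "measure lebesgue (\<Union>i\<in>D. cball (m i) (r i)) \<le> e" if D: "D \<subseteq> C" "finite D" for D
  proof -
    define p where "p = (\<lambda>i. (fst i, {fst (snd i)..snd (snd i)})) ` D"
    have PD: "P i" if "i \<in> D" for i using that D(1) C(2) by blast
    have ne: "{fst (snd i)..snd (snd i)} \<noteq> {}" if "i \<in> D" for i
      using PD[OF that] unfolding Pe by auto
    have dj: "{fst (snd i)..snd (snd i)} \<inter> {fst (snd j)..snd (snd j)} = {}" if "i \<in> D" "j \<in> D" "i \<noteq> j" for i j
      using pairwiseD[OF C(3), of i j] that D(1) unfolding cb disjnt_def by blast
    have inj: "inj_on (\<lambda>i. (fst i, {fst (snd i)..snd (snd i)})) D"
    proof (rule inj_onI, rule ccontr)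
      fix i j assume ij: "i \<in> D" "j \<in> D" "i \<noteq> j"
        and "(fst i, {fst (snd i)..snd (snd i)}) = (fst j, {fst (snd j)..snd (snd j)})"
      then show False using dj[OF ij] ne[OF ij(1)] by auto
    qed
    have "p tagged_partial_division_of cbox a b"
      unfolding tagged_partial_division_of_def
    proof (intro conjI allI impI)
      show "finite p" using D by (simp add: p_def)
      fix x K assume "(x, K) \<in> p"
      then obtain i where i: "i \<in> D" "x = fst i" "K = {fst (snd i)..snd (snd i)}" by (auto simp: p_def)
      show "x \<in> K" "K \<subseteq> cbox a b" "\<exists>a b. K = cbox a b"
        using PD[OF i(1)] unfolding Pe i by auto
    next
      fix x1 K1 x2 K2 assume "(x1, K1) \<in> p \<and> (x2, K2) \<in> p \<and> (x1, K1) \<noteq> (x2, K2)"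
      then obtain i j where ij: "i \<in> D" "K1 = {fst (snd i)..snd (snd i)}" "j \<in> D" "K2 = {fst (snd j)..snd (snd j)}"
          and "(x1, K1) = (fst i, {fst (snd i)..snd (snd i)})" "(x2, K2) = (fst j, {fst (snd j)..snd (snd j)})"
          "(x1, K1) \<noteq> (x2, K2)"
        unfolding p_def by blast
      then have "i \<noteq> j" by metis
      then have "K1 \<inter> K2 = {}" using dj ij by blast
      then show "interior K1 \<inter> interior K2 = {}" using interior_subset by blast
    qed
    moreover have "\<gamma> fine p"
      unfolding fine_def p_def using PD by (auto simp: Pe)
    ultimately have "sum (\<lambda>(x,k). norm (measure lborel k *\<^sub>R f x - integral k f)) p < \<epsilon> * e"
      by (rule hen)
    then have *: "(\<Sum>i\<in>D. norm ((snd (snd i) - fst (snd i)) *\<^sub>R f (fst i) - integral {fst (snd i)..snd (snd i)} f)) < \<epsilon> * e"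
      unfolding p_def using ne by (subst (asm) sum.reindex[OF inj]) (auto simp: o_def cong: sum.cong)
    have "measure lebesgue (\<Union>i\<in>D. cball (m i) (r i)) \<le> (\<Sum>i\<in>D. measure lebesgue (cball (m i) (r i)))"
      using D by (intro measure_UNION_le) auto
    also have "\<dots> = (\<Sum>i\<in>D. snd (snd i) - fst (snd i))"
      using ne by (intro sum.cong) (auto simp: cb)
    finally have "\<epsilon> * measure lebesgue (\<Union>i\<in>D. cball (m i) (r i)) \<le> \<epsilon> * (\<Sum>i\<in>D. snd (snd i) - fst (snd i))"
      using \<epsilon> by simp
    also have "\<dots> \<le> (\<Sum>i\<in>D. norm ((snd (snd i) - fst (snd i)) *\<^sub>R f (fst i) - integral {fst (snd i)..snd (snd i)} f))"
      unfolding sum_distrib_left using PD unfolding Pe by (intro sum_mono) blast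
    finally have "\<epsilon> * measure lebesgue (\<Union>i\<in>D. cball (m i) (r i)) \<le> \<epsilon> * e" using * by linarith
    then show ?thesis using \<epsilon> by (simp add: mult_le_cancel_left)
  qed
  have lm: "cball (m i) (r i) \<in> lmeasurable" for i by simp
  have U: "(\<Union>i\<in>C. cball (m i) (r i)) \<in> lmeasurable" "measure lebesgue (\<Union>i\<in>C. cball (m i) (r i)) \<le> e"
    using fmeasurable_UN_bound[OF C(1) lm bound] measure_UN_bound[OF C(1) lm bound] by auto
  let ?N = "?B - (\<Union>i \<in> C. cball (m i) (r i))"
  show "\<exists>T. ?B \<subseteq> T \<and> T \<in> lmeasurable \<and> measure lebesgue T \<le> e"
  proof (intro exI[of _ "(\<Union>i\<in>C. cball (m i) (r i)) \<union> ?N"] conjI)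
    have N: "?N \<in> lmeasurable" "measure lebesgue ?N = 0" using C(4) negligible_iff_measure by blast+
    show "(\<Union>i\<in>C. cball (m i) (r i)) \<union> ?N \<in> lmeasurable" using U N by blast
    show "measure lebesgue ((\<Union>i\<in>C. cball (m i) (r i)) \<union> ?N) \<le> e"
      using measure_Un_le[of "\<Union>i\<in>C. cball (m i) (r i)" lebesgue ?N] U N by (auto simp: fmeasurableD)
  qed auto
qed

text \<open>The bad sets for the thresholds \<open>1 / (n + 1)\<close> have a null union. Off it all
  short intervals containing \<open>x\<close> have small error; those with \<open>x\<close> as an
  endpoint give the two one-sided difference quotients.\<close>

lemma AE_has_vector_derivative_integral:
  fixes f :: "real \<Rightarrow> 'b::euclidean_space"
  assumes f: "f integrable_on {a..b}"
  shows "AE x in lebesgue_on {a<..<b}. ((\<lambda>t. integral {a..t} f) has_vector_derivative f x) (at x)"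
proof -
  define B where "B \<epsilon> = {x\<in>{a<..<b}. \<forall>d>0. \<exists>s t. s < t \<and> x \<in> {s..t} \<and> {s..t} \<subseteq> {a..b} \<and> t - s < d
           \<and> norm ((t - s) *\<^sub>R f x - integral {s..t} f) \<ge> \<epsilon> * (t - s)}" for \<epsilon> :: real
  have neg: "negligible (\<Union>n. B (inverse (Suc n)))"
    unfolding B_def
    using negligible_bad_difference_quotients[OF f] by (intro negligible_Union_nat) simp
  have "((\<lambda>t. integral {a..t} f) has_vector_derivative f x) (at x)"
    if x: "x \<in> {a<..<b}" and xB: "x \<notin> (\<Union>n. B (inverse (Suc n)))" for x
    unfolding has_vector_derivative_def has_derivative_at_alt
  proof (intro conjI allI impI)
    show "bounded_linear (\<lambda>h. h *\<^sub>R f x)" by (rule bounded_linear_scaleR_left)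
    fix e :: real assume "e > 0"
    then obtain n where n: "inverse (Suc n) < e" using reals_Archimedean by blast
    have "x \<notin> B (inverse (Suc n))" using xB by blast
    then obtain d where d: "d > 0" and small: "\<And>s t. s < t \<Longrightarrow> x \<in> {s..t} \<Longrightarrow> {s..t} \<subseteq> {a..b} \<Longrightarrow> t - s < d \<Longrightarrow>
        norm ((t - s) *\<^sub>R f x - integral {s..t} f) < inverse (Suc n) * (t - s)"
      using x unfolding B_def by fastforce
    have "norm (integral {a..y} f - integral {a..x} f - (y - x) *\<^sub>R f x) \<le> e * norm (y - x)"
      if y: "norm (y - x) < min d (min (x - a) (b - x))" for y
    proof -
      have yab: "a < y" "y < b" using y by auto
      consider "y = x" | "x < y" | "y < x" by linarith
      then show ?thesis
      proof cases
        case 2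
        have "integral {a..x} f + integral {x..y} f = integral {a..y} f"
          using x yab 2 by (intro Henstock_Kurzweil_Integration.integral_combine integrable_subinterval_real[OF f]) auto
        then have "norm (integral {a..y} f - integral {a..x} f - (y - x) *\<^sub>R f x)
            = norm ((y - x) *\<^sub>R f x - integral {x..y} f)"
          by (metis add_diff_cancel_left' norm_minus_commute)
        also have "\<dots> \<le> inverse (Suc n) * (y - x)"
          using small[of x y] 2 x yab y by auto
        also have "\<dots> \<le> e * norm (y - x)" using n 2 \<open>e > 0\<close> by (intro mult_mono) auto
        finally show ?thesis .
      next
        case 3
        have "integral {a..y} f + integral {y..x} f = integral {a..x} f"
          using x yab 3 by (intro Henstock_Kurzweil_Integration.integral_combine integrable_subinterval_real[OF f]) auto
        then have "integral {a..y} f - integral {a..x} f - (y - x) *\<^sub>R f x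
            = (x - y) *\<^sub>R f x - integral {y..x} f"
          by (simp add: algebra_simps)
        then have "norm (integral {a..y} f - integral {a..x} f - (y - x) *\<^sub>R f x)
            = norm ((x - y) *\<^sub>R f x - integral {y..x} f)" by simp
        also have "\<dots> \<le> inverse (Suc n) * (x - y)"
          using small[of y x] 3 x yab y by auto
        also have "\<dots> \<le> e * norm (y - x)" using n 3 \<open>e > 0\<close> by (intro mult_mono) auto
        finally show ?thesis .
      qed auto
    qed
    then show "\<exists>d>0. \<forall>y. norm (y - x) < d \<longrightarrow>
        norm (integral {a..y} f - integral {a..x} f - (y - x) *\<^sub>R f x) \<le> e * norm (y - x)"
      using d x by (intro exI[of _ "min d (min (x - a) (b - x))"]) auto
  qed
  then have "AE x in lebesgue. x \<in> {a<..<b} \<longrightarrow> ((\<lambda>t. integral {a..t} f) has_vector_derivative f x) (at x)"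
    using neg unfolding eventually_ae_filter_negligible by blast
  then show ?thesis by (simp add: AE_restrict_space_iff)
qed

lemma absolutely_continuous_on_subset:
  assumes "absolutely_continuous_on a b f" "a \<le> c" "d \<le> b"
  shows "absolutely_continuous_on c d f"
proof -
  have "{c..d} \<subseteq> {a..b}" using assms by auto
  with assms(1) show ?thesis unfolding absolutely_continuous_on_def by (meson subset_trans)
qed

text \<open>Intervals of a division meet only in null sets, so their lengths add up to the measure
  of the union. This turns the measure of an open cover into the length condition of absolute
  continuity.\<close>

lemma sum_lengths_division:
  fixes D :: "real set set"
  assumes D: "D division_of S" and T: "S \<subseteq> T" "T \<in> lmeasurable"
  shows "(\<Sum>k\<in>D. Sup k - Inf k) \<le> measure lebesgue T"
proof -
  note d = division_ofD[OF D]
  have k: "\<exists>s t. k = {s..t} \<and> s \<le> t" if "k \<in> D" for k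
    using d(3,4)[OF that] by (metis atLeastatMost_empty_iff box_real(2))
  have "(\<Sum>k\<in>D. Sup k - Inf k) = (\<Sum>k\<in>D. measure lebesgue k)"
    using k by (intro sum.cong) force+
  also have "\<dots> = measure lebesgue (\<Union>D)"
  proof (rule measure_negligible_finite_Union[symmetric])
    show "pairwise (\<lambda>S T. negligible (S \<inter> T)) D"
    proof (rule pairwiseI)
      fix S T assume ST: "S \<in> D" "T \<in> D" "S \<noteq> T"
      have "convex (S \<inter> T)" using k[OF ST(1)] k[OF ST(2)] by (auto intro: convex_Int)
      then show "negligible (S \<inter> T)"
        using d(5)[OF ST] by (simp add: negligible_convex_interior)
    qed
  qed (use d(1) k in force)+
  also have "\<dots> \<le> measure lebesgue T"
    using T d(6) k d(1) by (intro measure_mono_fmeasurable) (auto, force)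
  finally show ?thesis .
qed

text \<open>Away from a null set the gauge is chosen by differentiability; tags in the null set are forced
  into an open set of small measure, where absolute continuity takes over.\<close>

theorem has_integral_absolutely_continuous:
  fixes v w :: "real \<Rightarrow> complex"
  assumes ab: "a \<le> b" and ac: "absolutely_continuous_on a b v"
    and der: "AE x in lebesgue_on {a<..<b}. (v has_vector_derivative w x) (at x)"
  shows "(w has_integral (v b - v a)) {a..b}"
proof (cases "a = b")
  case True
  then show ?thesis by (simp add: has_integral_refl)
next
  case False
  with ab have ab: "a < b" by simp
  have "AE x in lebesgue. x \<in> {a<..<b} \<longrightarrow> (v has_vector_derivative w x) (at x)"
    using der by (simp add: AE_restrict_space_iff)
  then obtain N0 where N0: "negligible N0" "{x. \<not> (x \<in> {a<..<b} \<longrightarrow> (v has_vector_derivative w x) (at x))} \<subseteq> N0"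
    by (auto simp: eventually_ae_filter_negligible)
  \<comment> \<open>The endpoints join the null set because the derivative is known in the open
    interval only.\<close>
  define N where "N = N0 \<union> {a, b}"
  have N: "negligible N" using N0 by (simp add: N_def)
  have derN: "(v has_vector_derivative w x) (at x)" if "x \<in> {a..b} - N" for x
    using that N0 unfolding N_def by force
  \<comment> \<open>With the integrand zero on \<open>N\<close>, a tag in \<open>N\<close>
    contributes to the error nothing but the increment of \<open>v\<close> over its
    interval.\<close>
  define w' where "w' x = (if x \<in> N then 0 else w x)" for x
  have "(w' has_integral (v b - v a)) {a..b}"
    unfolding has_integral_real
  proof (intro allI impI)
    fix e :: real assume e: "e > 0"
    obtain \<delta> where \<delta>: "\<delta> > 0" and ac': "\<And>d. d division_of \<Union>d \<Longrightarrow> \<Union>d \<subseteq> {a..b} \<Longrightarrow>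
        (\<Sum>k\<in>d. Sup k - Inf k) < \<delta> \<Longrightarrow> (\<Sum>k\<in>d. norm (v (Sup k) - v (Inf k))) < e / 2"
      using ac e unfolding absolutely_continuous_on_def by (meson half_gt_zero)
    obtain T where T: "open T" "N \<subseteq> T" "T - N \<in> lmeasurable" "emeasure lebesgue (T - N) < ennreal \<delta>"
      using sets_lebesgue_outer_open[of N \<delta>] N \<delta> negligible_imp_sets by metis
    have NN: "N \<in> lmeasurable" "measure lebesgue N = 0" using N negligible_iff_measure by blast+
    have "T = (T - N) \<union> N" using T by auto
    then have Tm: "T \<in> lmeasurable" "measure lebesgue T \<le> measure lebesgue (T - N) + measure lebesgue N"
      using T NN measure_Un_le[of "T - N" lebesgue N] by (metis fmeasurable.Un, metis fmeasurableD)
    have T\<delta>: "measure lebesgue T < \<delta>"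
      using Tm(2) NN(2) T(3,4) \<delta> by (simp add: emeasure_eq_measure2 ennreal_less_iff)
    \<comment> \<open>The tags outside \<open>N\<close> then contribute at most
      \<open>\<epsilon> * (b - a) = e / 2\<close>; the other half is left to absolute
      continuity.\<close>
    define \<epsilon> where "\<epsilon> = e / (2 * (b - a))"
    have \<epsilon>: "\<epsilon> > 0" using e ab by (simp add: \<epsilon>_def)
    have "\<exists>\<eta>>0. x \<in> {a..b} - N \<longrightarrow> (\<forall>y. norm (y - x) < \<eta> \<longrightarrow> norm (v y - v x - (y - x) *\<^sub>R w x) \<le> \<epsilon> * norm (y - x))" for x
      using derN[of x] \<epsilon> unfolding has_vector_derivative_def has_derivative_at_alt
      by (cases "x \<in> {a..b} - N") (force, auto intro: exI[of _ 1])
    then obtain \<eta> where \<eta>: "\<And>x. \<eta> x > 0" "\<And>x y. x \<in> {a..b} - N \<Longrightarrow> norm (y - x) < \<eta> x \<Longrightarrow>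
        norm (v y - v x - (y - x) *\<^sub>R w x) \<le> \<epsilon> * norm (y - x)"
      by metis
    define \<gamma> where "\<gamma> x = (if x \<in> N then T else ball x (\<eta> x))" for x
    have "gauge \<gamma>" using T \<eta>(1) by (auto simp: gauge_def \<gamma>_def)
    moreover have "norm ((\<Sum>(x, k)\<in>p. measure lborel k *\<^sub>R w' x) - (v b - v a)) < e"
      if p: "p tagged_division_of {a..b}" and fine: "\<gamma> fine p" for p
    proof -
      note pD = tagged_division_ofD[OF p]
      have k: "\<exists>s t. K = {s..t} \<and> s \<le> x \<and> x \<le> t" if "(x, K) \<in> p" for x K
        using pD(2,4)[OF that] by auto
      define Q where "Q = {i \<in> p. fst i \<in> N}"
      have "(\<Sum>(x, K)\<in>p. measure lborel K *\<^sub>R w' x) - (v b - v a)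
          = (\<Sum>(x, K)\<in>p. measure lborel K *\<^sub>R w' x - (v (Sup K) - v (Inf K)))"
        using additive_tagged_division_1[of a b p v] ab p
        by (simp add: sum_subtractf split_def)
      also have "\<dots> = (\<Sum>(x, K)\<in>p - Q. measure lborel K *\<^sub>R w' x - (v (Sup K) - v (Inf K)))
                      + (\<Sum>(x, K)\<in>Q. measure lborel K *\<^sub>R w' x - (v (Sup K) - v (Inf K)))"
        using pD(1) by (intro sum.subset_diff) (auto simp: Q_def)
      also have "norm \<dots> \<le> (\<Sum>(x, K)\<in>p - Q. \<epsilon> * measure lborel K) + (\<Sum>(x, K)\<in>Q. norm (v (Sup K) - v (Inf K)))"
      proof (intro norm_triangle_mono sum_norm_le, goal_cases)
        case (1 i)
        obtain x K where i: "i = (x, K)" by fastforce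
        have xK: "(x, K) \<in> p" "x \<notin> N" using 1 i by (auto simp: Q_def)
        obtain s t where st: "K = {s..t}" "s \<le> x" "x \<le> t" using k xK by blast
        have "K \<subseteq> ball x (\<eta> x)" using fineD[OF fine xK(1)] xK by (simp add: \<gamma>_def)
        then have "s \<in> ball x (\<eta> x)" "t \<in> ball x (\<eta> x)" using st by (auto simp del: mem_ball)
        moreover have x: "x \<in> {a..b} - N" using xK pD(2,3)[OF xK(1)] by auto
        ultimately have "norm (v s - v x - (s - x) *\<^sub>R w x) \<le> \<epsilon> * norm (s - x)"
            "norm (v t - v x - (t - x) *\<^sub>R w x) \<le> \<epsilon> * norm (t - x)"
          using \<eta>(2)[OF x, of s] \<eta>(2)[OF x, of t] by (auto simp: dist_real_def abs_minus_commute)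
        moreover have "(t - s) *\<^sub>R w x - (v t - v s)
            = (v s - v x - (s - x) *\<^sub>R w x) - (v t - v x - (t - x) *\<^sub>R w x)"
          by (simp add: algebra_simps)
        ultimately have "norm ((t - s) *\<^sub>R w x - (v t - v s)) \<le> \<epsilon> * norm (s - x) + \<epsilon> * norm (t - x)"
          by (simp only:) (rule order_trans[OF norm_triangle_ineq4 add_mono])
        also have "\<dots> = \<epsilon> * (t - s)" using st by (simp add: algebra_simps)
        finally show ?case using st xK by (simp add: i w'_def)
      next
        case (2 i)
        then show ?case by (cases i) (auto simp: Q_def w'_def norm_minus_commute)
      qed
      also have "(\<Sum>(x, K)\<in>p - Q. \<epsilon> * measure lborel K) \<le> (\<Sum>(x, K)\<in>p. \<epsilon> * measure lborel K)"
        using pD(1) \<epsilon> by (intro sum_mono2) (auto simp: Q_def)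
      also have "\<dots> = \<epsilon> * (b - a)"
        using additive_content_tagged_division[of p a b] p ab
        by (simp add: sum_distrib_left[symmetric] split_def)
      also have "\<dots> = e / 2" using ab by (simp add: \<epsilon>_def divide_simps)
      also have "(\<Sum>(x, K)\<in>Q. norm (v (Sup K) - v (Inf K))) < e / 2"
      proof -
        have Qp: "Q tagged_partial_division_of {a..b}"
        proof (rule tagged_partial_division_subset[of p])
          show "p tagged_partial_division_of {a..b}" using p by (simp add: tagged_division_of_def)
        qed (auto simp: Q_def)
        have "(\<Sum>(x, K)\<in>Q. norm (v (Sup K) - v (Inf K))) = (\<Sum>K\<in>snd ` Q. norm (v (Sup K) - v (Inf K)))"
        proof -
          \<comment> \<open>Passing from tagged intervals to bare intervals needs a function that
            vanishes on degenerate ones; the default at \<open>{}\<close> replaces the unspecified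
            \<open>Sup {}\<close> and \<open>Inf {}\<close>.\<close>
          define h where "h K = (if K = {} then 0 else norm (v (Sup K) - v (Inf K)))" for K
          have "K \<noteq> {}" if "(x, K) \<in> Q" for x K using that pD(2) by (auto simp: Q_def)
          then have h: "h K = norm (v (Sup K) - v (Inf K))" if "(x, K) \<in> Q" for x K
            using that by (auto simp: h_def)
          have "(\<Sum>(x, K)\<in>Q. h K) = (\<Sum>K\<in>snd ` Q. h K)"
          proof (rule sum.over_tagged_division_lemma[OF tagged_partial_division_of_Union_self[OF Qp]])
            fix s t :: real assume "box s t = {}"
            then have "t \<le> s" by simp
            then show "h (cbox s t) = 0"
              by (cases "t = s") (auto simp: h_def)
          qed
          moreover have "(\<Sum>(x, K)\<in>Q. h K) = (\<Sum>(x, K)\<in>Q. norm (v (Sup K) - v (Inf K)))"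
            by (rule sum.cong) (auto simp: h)
          moreover have "(\<Sum>K\<in>snd ` Q. h K) = (\<Sum>K\<in>snd ` Q. norm (v (Sup K) - v (Inf K)))"
            by (rule sum.cong) (auto simp: h)
          ultimately show ?thesis by simp
        qed
        also have "\<dots> < e / 2"
        proof (rule ac')
          have div: "snd ` Q division_of \<Union>(snd ` Q)" by (rule partial_division_of_tagged_division[OF Qp])
          then show "snd ` Q division_of \<Union>(snd ` Q)" .
          show "\<Union>(snd ` Q) \<subseteq> {a..b}" using pD(3) unfolding Q_def by fastforce
          have "\<Union>(snd ` Q) \<subseteq> T" using fineD[OF fine] unfolding Q_def \<gamma>_def by fastforce
          from sum_lengths_division[OF div this Tm(1)] T\<delta>
          show "(\<Sum>k\<in>snd ` Q. Sup k - Inf k) < \<delta>" by simp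
        qed
        finally show ?thesis .
      qed
      finally show ?thesis by simp
    qed
    ultimately show "\<exists>\<gamma>. gauge \<gamma> \<and> (\<forall>\<D>. \<D> tagged_division_of {a..b} \<and> \<gamma> fine \<D> \<longrightarrow>
        norm ((\<Sum>(x, k)\<in>\<D>. measure lborel k *\<^sub>R w' x) - (v b - v a)) < e)"
      by (intro exI[of _ \<gamma>] conjI allI impI) auto
  qed
  then show ?thesis
    by (rule has_integral_spike[OF N, rotated]) (auto simp: w'_def)
qed

text \<open>Square integrability gives an explicit modulus: the pointwise inequality
  \<open>amgm\<close> splits each increment into a small multiple of the energy on the interval and
  a multiple of its length.\<close>

lemma absolutely_continuous_on_integral:
  fixes f :: "real \<Rightarrow> complex"
  assumes f: "f integrable_on {a..b}" and f2: "(\<lambda>x. (norm (f x))\<^sup>2) integrable_on {a..b}"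
  shows "absolutely_continuous_on a b (\<lambda>x. integral {a..x} f)"
  unfolding absolutely_continuous_on_def
proof (intro allI impI)
  fix e :: real assume e: "e > 0"
  define M where "M = integral {a..b} (\<lambda>x. (norm (f x))\<^sup>2)"
  have M: "M \<ge> 0" unfolding M_def by (rule integral_nonneg[OF f2]) auto
  \<comment> \<open>The energy part is \<open>c / 2 * M\<close>, at most \<open>e / 2\<close>, and
    total length below \<open>c * e\<close> makes the other part less than \<open>e / 2\<close>. The
    summand 1 covers \<open>M = 0\<close>.\<close>
  define c where "c = e / (M + 1)"
  have c: "c > 0" using e M by (simp add: c_def)
  have amgm: "t \<le> c / 2 * t\<^sup>2 + 1 / (2 * c)" for t :: real
  proof -
    have "0 \<le> (c * t - 1)\<^sup>2 / (2 * c)" using c by simp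
    also have "\<dots> = c / 2 * t\<^sup>2 - t + 1 / (2 * c)"
      using c by (simp add: power2_diff field_simps power2_eq_square)
    finally show ?thesis by simp
  qed
  show "\<exists>\<delta>>0. \<forall>d. d division_of \<Union>d \<and> \<Union>d \<subseteq> {a..b} \<and> (\<Sum>k\<in>d. Sup k - Inf k) < \<delta> \<longrightarrow>
        (\<Sum>k\<in>d. norm (integral {a..Sup k} f - integral {a..Inf k} f)) < e"
  proof (intro exI[of _ "c * e"] conjI allI impI; (elim conjE)?)
    show "c * e > 0" using c e by simp
    fix d assume div: "d division_of \<Union>d" and sub: "\<Union>d \<subseteq> {a..b}" and small: "(\<Sum>k\<in>d. Sup k - Inf k) < c * e"
    note dD = division_ofD[OF div]
    have f2': "(\<lambda>x. (norm (f x))\<^sup>2) integrable_on \<Union>d"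
      by (rule integrable_on_subdivision[OF div f2 sub])
    have "norm (integral {a..Sup k} f - integral {a..Inf k} f)
        \<le> c / 2 * integral k (\<lambda>x. (norm (f x))\<^sup>2) + (Sup k - Inf k) / (2 * c)" if kd: "k \<in> d" for k
    proof -
      obtain s t where k: "k = {s..t}" "s \<le> t"
        using dD(3,4)[OF kd] by (metis atLeastatMost_empty_iff box_real(2))
      have st: "{s..t} \<subseteq> {a..b}" using sub kd k by blast
      then have as: "a \<le> s" "t \<le> b" using k by auto
      have int: "f integrable_on {s..t}" "(\<lambda>x. (norm (f x))\<^sup>2) integrable_on {s..t}"
        using f f2 st integrable_subinterval_real by blast+
      have int': "(\<lambda>x. c / 2 * (norm (f x))\<^sup>2) integrable_on {s..t}"
        using integrable_cmul[OF int(2), of "c / 2"] by simp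
      have "integral {a..s} f + integral {s..t} f = integral {a..t} f"
        using as k by (intro Henstock_Kurzweil_Integration.integral_combine integrable_subinterval_real[OF f]) auto
      then have "norm (integral {a..t} f - integral {a..s} f) = norm (integral {s..t} f)"
        by (metis add_diff_cancel_left')
      also have "\<dots> \<le> integral {s..t} (\<lambda>x. c / 2 * (norm (f x))\<^sup>2 + 1 / (2 * c))"
        using int int' by (intro integral_norm_bound_integral integrable_add amgm) auto
      also have "\<dots> = c / 2 * integral {s..t} (\<lambda>x. (norm (f x))\<^sup>2) + (t - s) / (2 * c)"
        using int' k
        by (subst Henstock_Kurzweil_Integration.integral_add) auto
      finally show ?thesis using k by simp
    qed
    then have "(\<Sum>k\<in>d. norm (integral {a..Sup k} f - integral {a..Inf k} f))
        \<le> (\<Sum>k\<in>d. c / 2 * integral k (\<lambda>x. (norm (f x))\<^sup>2) + (Sup k - Inf k) / (2 * c))"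
      by (rule sum_mono)
    also have "\<dots> = c / 2 * (\<Sum>k\<in>d. integral k (\<lambda>x. (norm (f x))\<^sup>2)) + (\<Sum>k\<in>d. Sup k - Inf k) / (2 * c)"
      by (simp add: sum.distrib sum_distrib_left sum_divide_distrib)
    also have "(\<Sum>k\<in>d. integral k (\<lambda>x. (norm (f x))\<^sup>2)) = integral (\<Union>d) (\<lambda>x. (norm (f x))\<^sup>2)"
      by (rule integral_combine_division_topdown[OF f2' div, symmetric])
    also have "\<dots> \<le> M"
      unfolding M_def using f2 f2' sub by (intro integral_subset_le) auto
    also have "c / 2 * M + (\<Sum>k\<in>d. Sup k - Inf k) / (2 * c) < e / 2 + e / 2"
    proof (rule add_le_less_mono)
      show "c / 2 * M \<le> e / 2" using M e by (simp add: c_def field_simps)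
      show "(\<Sum>k\<in>d. Sup k - Inf k) / (2 * c) < e / 2" using small c by (simp add: field_simps)
    qed
    finally show "(\<Sum>k\<in>d. norm (integral {a..Sup k} f - integral {a..Inf k} f)) < e"
      using c by simp
  qed
qed

section \<open>Completeness of the cosines and sines\<close>

lemma borel_measurable_I01:
  fixes g :: "real \<Rightarrow> 'b::euclidean_space"
  assumes "continuous_on UNIV g"
  shows "g \<in> borel_measurable I01"
  by (rule continuous_imp_measurable_on_sets_lebesgue[OF continuous_on_subset[OF assms]]) auto

lemma integrable_I01_mult:
  fixes h :: "real \<Rightarrow> complex" and g :: "real \<Rightarrow> complex"
  assumes h: "integrable I01 h" and g: "continuous_on UNIV g" "\<And>x. norm (g x) \<le> C"
  shows "integrable I01 (\<lambda>x. h x * g x)"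
proof (rule Bochner_Integration.integrable_bound)
  show "integrable I01 (\<lambda>x. C * norm (h x))" using h by simp
  have [measurable]: "g \<in> borel_measurable I01" "h \<in> borel_measurable I01"
    using borel_measurable_I01[OF g(1)] h by auto
  show "(\<lambda>x. h x * g x) \<in> borel_measurable I01" by measurable
  have "C \<ge> 0" using g(2)[of 0] norm_ge_zero order_trans by blast
  have "norm (h x * g x) \<le> norm (C * norm (h x))" for x
    using mult_right_mono[OF g(2)[of x] norm_ge_zero[of "h x"]] \<open>C \<ge> 0\<close>
    by (simp add: norm_mult mult.commute)
  then show "AE x in I01. norm (h x * g x) \<le> norm (C * norm (h x))" by simp
qed

lemma integral_I01_eq:
  fixes f :: "real \<Rightarrow> 'b::euclidean_space"
  assumes "integrable I01 f"
  shows "integral\<^sup>L I01 f = integral {0..1} f"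
  using lebesgue_integral_eq_integral[OF assms] by (simp add: integral_open_interval_real)

lemma integrable_on_I01:
  fixes f :: "real \<Rightarrow> 'b::euclidean_space"
  assumes "integrable I01 f"
  shows "f integrable_on {0..1}"
  using integrable_on_lebesgue_on[OF assms] by (simp add: integrable_on_open_interval_real)

text \<open>By the Weierstrass theorem in the variable \<open>cos (\<pi> x)\<close>, the functions \<open>cos (j \<pi> x)\<close> are total.\<close>

lemma cos_coefficients_zero_imp_zero:
  fixes h :: "real \<Rightarrow> complex"
  assumes h: "integrable I01 h"
    and 0: "\<And>j::nat. (LINT x|I01. h x * of_real (cos (j * pi * x))) = 0"
  shows "AE x in I01. h x = 0"
proof -
  \<comment> \<open>Integer frequencies are needed because multiplication by
    \<open>cos (pi * x)\<close> in the induction below shifts the frequency by one in both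
    directions.\<close>
  have cos0: "(LINT x|I01. h x * of_real (cos (j * pi * x))) = 0" for j :: int
  proof (cases "j \<ge> 0")
    case True
    then show ?thesis using 0[of "nat j"] by simp
  next
    case False
    then have "cos (real_of_int j * pi * x) = cos (real (nat (- j)) * pi * x)" for x
    proof -
      have "real (nat (- j)) * pi * x = - (real_of_int j * pi * x)" using False by simp
      then show ?thesis by (simp only: cos_minus)
    qed
    then show ?thesis using 0[of "nat (- j)"] by simp
  qed
  have int_pow: "integrable I01 (\<lambda>x. h x * of_real (cos (of_int j * pi * x) * cos (pi * x) ^ m))" for j :: int and m
  proof (rule integrable_I01_mult[OF h])
    show "continuous_on UNIV (\<lambda>x. complex_of_real (cos (of_int j * pi * x) * cos (pi * x) ^ m))"
      by (intro continuous_intros)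
    have "\<bar>cos (of_int j * pi * x)\<bar> * \<bar>cos (pi * x)\<bar> ^ m \<le> 1" for x
      by (intro mult_le_one power_le_one) auto
    then show "norm (complex_of_real (cos (of_int j * pi * x) * cos (pi * x) ^ m)) \<le> 1" for x
      by (simp only: norm_of_real abs_mult power_abs)
  qed
  have pow: "(LINT x|I01. h x * of_real (cos (of_int j * pi * x) * cos (pi * x) ^ m)) = 0" for j :: int and m
  proof (induction m arbitrary: j)
    case 0
    then show ?case using cos0 by simp
  next
    case (Suc m)
    have "cos (of_int j * pi * x) * cos (pi * x) ^ Suc m
        = (cos (of_int (j + 1) * pi * x) * cos (pi * x) ^ m + cos (of_int (j - 1) * pi * x) * cos (pi * x) ^ m) / 2" for x
    proof -
      have "cos (of_int j * pi * x) * cos (pi * x) = (cos (of_int (j + 1) * pi * x) + cos (of_int (j - 1) * pi * x)) / 2"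
      proof -
        have "of_int (j + 1) * pi * x = of_int j * pi * x + pi * x" "of_int (j - 1) * pi * x = of_int j * pi * x - pi * x"
          by (simp_all add: algebra_simps)
        then show ?thesis by (simp only: cos_times_cos add.commute)
      qed
      then show ?thesis by (simp only: power_Suc mult.assoc[symmetric]) (simp add: algebra_simps)
    qed
    then have "(LINT x|I01. h x * of_real (cos (of_int j * pi * x) * cos (pi * x) ^ Suc m))
       = (LINT x|I01. (h x * of_real (cos (of_int (j + 1) * pi * x) * cos (pi * x) ^ m)
             + h x * of_real (cos (of_int (j - 1) * pi * x) * cos (pi * x) ^ m)) / 2)"
      by (simp only: of_real_divide of_real_add) (simp add: distrib_left)
    also have "\<dots> = 0"
      by (simp only: Bochner_Integration.integral_divide_zero
          Bochner_Integration.integral_add[OF int_pow int_pow] Suc.IH) simp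
    finally show ?case .
  qed
  have poly: "integrable I01 (\<lambda>x. h x * of_real (p (cos (pi * x)))) \<and> (LINT x|I01. h x * of_real (p (cos (pi * x)))) = 0"
    if p: "real_polynomial_function p" for p
  proof -
    obtain a n where p: "p = (\<lambda>x. \<Sum>i\<le>n. a i * x ^ i)"
      using p real_polynomial_function_iff_sum by auto
    have e: "h x * of_real (p (cos (pi * x))) = (\<Sum>i\<le>n. of_real (a i) * (h x * of_real (cos (of_int 0 * pi * x) * cos (pi * x) ^ i)))" for x
      by (simp add: p sum_distrib_left mult_ac)
    have i: "integrable I01 (\<lambda>x. of_real (a i) * (h x * of_real (cos (of_int 0 * pi * x) * cos (pi * x) ^ i)))" for i
      by (rule integrable_mult_right[OF int_pow])
    have z: "(LINT x|I01. of_real (a i) * (h x * of_real (cos (of_int 0 * pi * x) * cos (pi * x) ^ i))) = 0" for i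
      using pow[of 0 i] by (simp del: of_int_0)
    show ?thesis unfolding e
      by (intro conjI Bochner_Integration.integrable_sum i)
        (simp only: Bochner_Integration.integral_sum[OF i] z sum.neutral_const)
  qed
  have cont: "(LINT x|I01. h x * of_real (g x)) = 0"
    if g: "continuous_on UNIV g" "\<And>x. \<bar>g x\<bar> \<le> 1" for g :: "real \<Rightarrow> real"
  proof -
    define H where "H = (LINT x|I01. norm (h x))"
    have H: "H \<ge> 0" by (simp add: H_def)
    have int_g: "integrable I01 (\<lambda>x. h x * of_real (g x))"
      using g by (intro integrable_I01_mult[OF h, of _ 1] continuous_intros) auto
    have le: "norm (LINT x|I01. h x * of_real (g x)) \<le> e * H" if e: "e > 0" for e
    proof -
      \<comment> \<open>On the interval \<open>x = arccos (cos (pi * x)) / pi\<close>, so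
        \<open>g\<close> becomes a continuous function of \<open>y = cos (pi * x)\<close> and can be
        approximated by polynomials in \<open>y\<close>.\<close>
      have "continuous_on {-1..1} (\<lambda>y. g (arccos y / pi))"
        by (intro continuous_intros continuous_on_compose2[OF g(1)] continuous_on_arccos') auto
      then obtain p where p: "real_polynomial_function p" "\<And>y. y \<in> {-1..1} \<Longrightarrow> \<bar>g (arccos y / pi) - p y\<bar> < e"
        using Stone_Weierstrass_real_polynomial_function[OF compact_Icc _ e] by blast
      have close: "\<bar>g x - p (cos (pi * x))\<bar> \<le> e" if "x \<in> {0<..<1}" for x
      proof -
        have "arccos (cos (pi * x)) = pi * x" using that by (intro arccos_cos) auto
        then show ?thesis using p(2)[of "cos (pi * x)"] by auto
      qed
      note ip = poly[OF p(1)]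
      have "(LINT x|I01. h x * of_real (g x)) = (LINT x|I01. h x * of_real (g x) - h x * of_real (p (cos (pi * x))))"
        using ip int_g by simp
      also have "norm \<dots> \<le> (LINT x|I01. norm (h x * of_real (g x) - h x * of_real (p (cos (pi * x)))))"
        by (rule integral_norm_bound)
      also have "\<dots> \<le> (LINT x|I01. e * norm (h x))"
      proof (rule integral_mono_AE)
        have "norm (h x * of_real (g x) - h x * of_real (p (cos (pi * x)))) \<le> e * norm (h x)" if "x \<in> {0<..<1}" for x
        proof -
          have "norm (h x * of_real (g x) - h x * of_real (p (cos (pi * x)))) = norm (h x) * \<bar>g x - p (cos (pi * x))\<bar>"
            by (metis norm_mult norm_of_real of_real_diff right_diff_distrib)
          also have "\<dots> \<le> norm (h x) * e" using close[OF that] by (intro mult_left_mono) auto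
          finally show ?thesis by (simp add: mult.commute)
        qed
        then show "AE x in I01. norm (h x * of_real (g x) - h x * of_real (p (cos (pi * x)))) \<le> e * norm (h x)"
          by (intro AE_I2) auto
      qed (use ip int_g h in auto)
      also have "\<dots> = e * H" by (simp add: H_def)
      finally show ?thesis .
    qed
    have "norm (LINT x|I01. h x * of_real (g x)) \<le> 0"
    proof (rule field_le_epsilon)
      fix e :: real assume e: "e > 0"
      have "norm (LINT x|I01. h x * of_real (g x)) \<le> e / (H + 1) * H" using e H by (intro le) simp
      also have "\<dots> \<le> e" using e H by (simp add: field_simps)
      finally show "norm (LINT x|I01. h x * of_real (g x)) \<le> 0 + e" by simp
    qed
    then show ?thesis by simp
  qed
  have [measurable]: "h \<in> borel_measurable I01" using h by auto
  have zero: "integral {0..t} h = 0" if t: "t \<in> {0<..<1}" for t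
  proof -
    \<comment> \<open>Continuous ramps of slope \<open>n\<close> that tend pointwise to the
      indicator of \<open>{..<t}\<close>. They carry the vanishing over from continuous test
      functions to the primitive of \<open>h\<close>, whose derivative is \<open>h\<close> almost
      everywhere.\<close>
    define g where "g n x = max 0 (min 1 (real n * (t - x)))" for n :: nat and x
    have gc: "continuous_on UNIV (g n)" for n unfolding g_def by (intro continuous_intros)
    have [measurable]: "g n \<in> borel_measurable I01" for n by (rule borel_measurable_I01[OF gc])
    have lim: "(\<lambda>n. g n x) \<longlonglongrightarrow> indicator {..<t} x" for x
    proof (cases "x < t")
      case True
      obtain N where N: "1 / (t - x) < real N" using reals_Archimedean2 by blast
      have "g n x = 1" if "n \<ge> N" for n
      proof -
        have "1 < real N * (t - x)" using N True by (simp add: field_simps)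
        also have "\<dots> \<le> real n * (t - x)" using that True by (intro mult_right_mono) auto
        finally show ?thesis by (simp add: g_def)
      qed
      then have "eventually (\<lambda>n. g n x = indicator {..<t} x) sequentially"
        using True by (auto simp: eventually_sequentially)
      then show ?thesis by (rule tendsto_eventually)
    next
      case False
      then have "real n * (t - x) \<le> 0" for n by (intro mult_nonneg_nonpos) auto
      moreover have "max 0 (min 1 y) = 0" if "y \<le> 0" for y :: real using that by auto
      ultimately have "g n x = 0" for n unfolding g_def by blast
      with False show ?thesis by simp
    qed
    have ind [measurable]: "(indicator {..<t} :: real \<Rightarrow> real) \<in> borel_measurable I01"
      by (rule borel_measurable_LIMSEQ_real[OF lim]) measurable
    have "(\<lambda>n. LINT x|I01. h x * of_real (g n x)) \<longlonglongrightarrow> (LINT x|I01. h x * of_real (indicator {..<t} x))"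
    proof (rule integral_dominated_convergence[where w="\<lambda>x. norm (h x)"])
      show "(\<lambda>x. h x * of_real (indicator {..<t} x)) \<in> borel_measurable I01" by measurable
      show "(\<lambda>x. h x * of_real (g n x)) \<in> borel_measurable I01" for n by measurable
      show "integrable I01 (\<lambda>x. norm (h x))" using h by simp
      show "AE x in I01. (\<lambda>n. h x * of_real (g n x)) \<longlonglongrightarrow> h x * of_real (indicator {..<t} x)"
        by (intro AE_I2 tendsto_intros lim)
      have "\<bar>g n x\<bar> \<le> 1" for n x by (auto simp: g_def)
      then show "AE x in I01. norm (h x * of_real (g n x)) \<le> norm (h x)" for n
        by (intro AE_I2) (simp add: norm_mult mult_left_le)
    qed
    moreover have "(LINT x|I01. h x * of_real (g n x)) = 0" for n
      by (rule cont[OF gc]) (auto simp: g_def)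
    ultimately have z: "(LINT x|I01. h x * of_real (indicator {..<t} x)) = 0"
      by (simp add: LIMSEQ_const_iff)
    have "(LINT x|I01. h x * of_real (indicator {..<t} x)) = (LINT x|I01. indicator {..<t} x *\<^sub>R h x)"
      by (simp add: scaleR_conv_of_real mult.commute)
    also have "\<dots> = integral {0..1} (\<lambda>x. indicator {..<t} x *\<^sub>R h x)"
    proof (rule integral_I01_eq)
      show "integrable I01 (\<lambda>x. indicator {..<t} x *\<^sub>R h x)"
        by (rule Bochner_Integration.integrable_bound[OF h]) (measurable, simp add: indicator_def)
    qed
    also have "\<dots> = integral {0..1} (\<lambda>x. if x \<in> {0..t} then h x else 0)"
      using t by (intro integral_spike[of "{t}"]) (auto simp: indicator_def)
    also have "\<dots> = integral ({0..t} \<inter> {0..1}) h" by (rule Henstock_Kurzweil_Integration.integral_restrict_Int)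
    also have "{0..t} \<inter> {0..1} = {0..t}" using t by auto
    finally show ?thesis using z by simp
  qed
  have "AE x in I01. ((\<lambda>t. integral {0..t} h) has_vector_derivative h x) (at x)"
    by (rule AE_has_vector_derivative_integral[OF integrable_on_I01[OF h]])
  moreover have "AE x in I01. x \<in> {0<..<1}" by (rule AE_I2) simp
  ultimately show ?thesis
  proof eventually_elim
    case (elim x)
    have "((\<lambda>t. 0) has_vector_derivative h x) (at x)"
      by (rule has_vector_derivative_transform_within_open[OF elim(1), of "{0<..<1}"]) (use elim zero in auto)
    then show ?case
      by (rule vector_derivative_unique_at[OF _ has_vector_derivative_const])
  qed
qed

text \<open>Multiplication by \<open>sin (pi * x)\<close>, which has no zero inside the interval,
  turns cosine coefficient \<open>j\<close> of the product into half the difference of the sine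
  coefficients \<open>j + 1\<close> and \<open>j - 1\<close> of \<open>f\<close>. For
  \<open>j = 0\<close> the frequency -1 is covered by oddness of the sine.\<close>

lemma sin_coefficients_zero_imp_zero:
  fixes f :: "real \<Rightarrow> complex"
  assumes f: "integrable I01 f"
    and 0: "\<And>k::nat. (LINT x|I01. f x * of_real (sin (k * pi * x))) = 0"
  shows "AE x in I01. f x = 0"
proof -
  have int_s: "integrable I01 (\<lambda>x. f x * of_real (sin (c * x)))" for c
    by (rule integrable_I01_mult[OF f, of _ 1]) (auto intro!: continuous_intros)
  have int: "integrable I01 (\<lambda>x. f x * of_real (sin (pi * x)))"
    by (rule int_s)
  have "AE x in I01. f x * of_real (sin (pi * x)) = 0"
  proof (rule cos_coefficients_zero_imp_zero[OF int])
    fix j :: nat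
    have n: "(LINT x|I01. f x * of_real (sin ((real j - 1) * pi * x))) = 0"
    proof (cases j)
      case 0
      then show ?thesis using assms(2)[of 1] by simp
    next
      case (Suc i)
      then show ?thesis using assms(2)[of i] by simp
    qed
    have "sin (pi * x) * cos (real j * pi * x) = (sin (real (Suc j) * pi * x) - sin ((real j - 1) * pi * x)) / 2" for x
    proof -
      have "(real j - 1) * pi * x = - (pi * x - real j * pi * x)" "real (Suc j) * pi * x = pi * x + real j * pi * x"
        by (simp_all add: algebra_simps)
      then show ?thesis by (simp only: sin_times_cos sin_minus) simp
    qed
    then have "complex_of_real (sin (pi * x)) * of_real (cos (real j * pi * x))
        = of_real ((sin (real (Suc j) * pi * x) - sin ((real j - 1) * pi * x)) / 2)" for x
      by (simp only: of_real_mult[symmetric])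
    then have "f x * of_real (sin (pi * x)) * of_real (cos (real j * pi * x))
        = (f x * of_real (sin (real (Suc j) * pi * x)) - f x * of_real (sin ((real j - 1) * pi * x))) / 2" for x
      by (simp only: mult.assoc) (simp add: right_diff_distrib)
    then have "(LINT x|I01. f x * of_real (sin (pi * x)) * of_real (cos (real j * pi * x)))
      = (LINT x|I01. (f x * of_real (sin (real (Suc j) * pi * x)) - f x * of_real (sin ((real j - 1) * pi * x))) / 2)"
      by (simp only:)
    also have "\<dots> = 0"
      using int_s[of "real (Suc j) * pi"] int_s[of "(real j - 1) * pi"] n 0[of "Suc j"] by simp
    finally show "(LINT x|I01. f x * of_real (sin (pi * x)) * of_real (cos (real j * pi * x))) = 0" .
  qed
  moreover have "sin (pi * x) \<noteq> 0" if "x \<in> space I01" for x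
    using that sin_gt_zero[of "pi * x"] by auto
  then have "AE x in I01. sin (pi * x) \<noteq> 0" by (rule AE_I2)
  ultimately show ?thesis by eventually_elim auto
qed

section \<open>The Hilbert space $L^2(0,1)$\<close>

lemma l2_rel_refl [simp]: "l2_rel f f \<longleftrightarrow> square_integrable f"
  by (auto simp: l2_rel_def)

lemma class_L2_cases:
  obtains f where "square_integrable f" "x = class_L2 f"
  by (induct x rule: L2.abs_induct) auto

lemma class_L2_eq_iff:
  assumes "square_integrable f" "square_integrable g"
  shows "class_L2 f = class_L2 g \<longleftrightarrow> (AE x in I01. f x = g x)"
  using Quotient_rel[OF Quotient_L2, of f g] assms unfolding l2_rel_def by auto

lemma class_L2_add:
  assumes "square_integrable f" "square_integrable g"
  shows "class_L2 f + class_L2 g = class_L2 (\<lambda>x. f x + g x)"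
  using assms by (simp add: plus_L2.abs_eq)

lemma class_L2_scaleC:
  assumes "square_integrable f"
  shows "scaleC c (class_L2 f) = class_L2 (\<lambda>x. c * f x)"
  using assms by (simp add: scaleC.abs_eq)

lemma class_L2_uminus:
  assumes "square_integrable f"
  shows "- class_L2 f = class_L2 (\<lambda>x. - f x)"
  using class_L2_scaleC[OF assms, of "-1"] by (simp add: uminus_L2_def)

lemma square_integrable_uminus: "square_integrable f \<Longrightarrow> square_integrable (\<lambda>x. - f x)"
  using square_integrable_scale[of f "-1"] by simp

lemma square_integrable_diff:
  "square_integrable f \<Longrightarrow> square_integrable g \<Longrightarrow> square_integrable (\<lambda>x. f x - g x)"
  using square_integrable_add[of f "\<lambda>x. - g x"] square_integrable_uminus[of g] by simp

lemma class_L2_diff: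
  assumes "square_integrable f" "square_integrable g"
  shows "class_L2 f - class_L2 g = class_L2 (\<lambda>x. f x - g x)"
  using class_L2_add[OF assms(1) square_integrable_uminus[OF assms(2)]] class_L2_uminus[OF assms(2)]
  by (simp add: minus_L2_def)

lemma class_L2_sum:
  assumes "\<And>i. i \<in> A \<Longrightarrow> square_integrable (f i)"
  shows "square_integrable (\<lambda>x. \<Sum>i\<in>A. f i x)" "(\<Sum>i\<in>A. class_L2 (f i)) = class_L2 (\<lambda>x. \<Sum>i\<in>A. f i x)"
  using assms
  by (induct A rule: infinite_finite_induct)
     (auto simp: square_integrable_zero square_integrable_add class_L2_add zero_L2_def)

lemma cinner_class_L2:
  assumes "square_integrable f" "square_integrable g"
  shows "cinner (class_L2 f) (class_L2 g) = (LINT x|I01. cnj (f x) * g x)"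
  using assms by (simp add: cinner.abs_eq)

lemma norm_class_L2:
  assumes "square_integrable f"
  shows "(norm (class_L2 f))\<^sup>2 = (LINT x|I01. (cmod (f x))\<^sup>2)"
proof -
  have sq: "cnj z * z = of_real ((cmod z)\<^sup>2)" for z
    by (metis complex_norm_square mult.commute)
  show ?thesis using assms
    by (simp add: norm_L2_sq cinner_class_L2 sq del: of_real_power)
qed

text \<open>Riesz-Fischer in series form. Monotone convergence makes \<open>H\<close>, the pointwise
  sum of the moduli, square integrable; \<open>H\<close> then dominates all remainders, and
  dominated convergence gives convergence in norm.\<close>

lemma summable_L2:
  assumes sF: "summable (\<lambda>n. norm (F n))"
  shows "summable (F :: nat \<Rightarrow> L2)"
proof -
  have "\<forall>n. \<exists>f. square_integrable f \<and> F n = class_L2 f"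
    by (metis class_L2_cases)
  then obtain f where f: "\<And>n. square_integrable (f n)" and F: "\<And>n. F n = class_L2 (f n)"
    by metis
  have [measurable]: "f n \<in> borel_measurable I01" for n
    using f[of n] by (simp add: square_integrable_def)
  define C where "C = (\<Sum>n. norm (F n))"
  define h where "h N x = (\<Sum>n<N. cmod (f n x))" for N x
  have [measurable]: "h N \<in> borel_measurable I01" for N unfolding h_def by measurable
  have sa: "square_integrable (\<lambda>x. complex_of_real (cmod (f n x)))" for n
    using f[of n] by (simp add: square_integrable_def)
  have na: "norm (class_L2 (\<lambda>x. complex_of_real (cmod (f n x)))) = norm (F n)" for n
  proof -
    have "(norm (class_L2 (\<lambda>x. complex_of_real (cmod (f n x)))))\<^sup>2 = (norm (F n))\<^sup>2"
      by (simp only: F norm_class_L2[OF sa] norm_class_L2[OF f]) simp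
    then show ?thesis by (simp add: power2_eq_iff_nonneg)
  qed
  have sh: "square_integrable (\<lambda>x. complex_of_real (h N x))" for N
    using class_L2_sum(1)[of "{..<N}" "\<lambda>n x. complex_of_real (cmod (f n x))", OF sa] by (simp add: h_def)
  have ih: "integrable I01 (\<lambda>x. (h N x)\<^sup>2)" for N
    using sh[of N] by (simp add: square_integrable_def)
  have hC: "(LINT x|I01. (h N x)\<^sup>2) \<le> C\<^sup>2" for N
  proof -
    have "(LINT x|I01. (h N x)\<^sup>2) = (norm (class_L2 (\<lambda>x. complex_of_real (h N x))))\<^sup>2"
      by (simp only: norm_class_L2[OF sh]) simp
    also have "class_L2 (\<lambda>x. complex_of_real (h N x)) = (\<Sum>n<N. class_L2 (\<lambda>x. complex_of_real (cmod (f n x))))"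
      using class_L2_sum(2)[of "{..<N}" "\<lambda>n x. complex_of_real (cmod (f n x))", OF sa] by (simp add: h_def)
    also have "norm \<dots> \<le> C"
      unfolding C_def by (rule order_trans[OF norm_sum]) (simp only: na sum_le_suminf[OF sF] finite_lessThan norm_ge_zero)
    then have "(norm (\<Sum>n<N. class_L2 (\<lambda>x. complex_of_real (cmod (f n x)))))\<^sup>2 \<le> C\<^sup>2"
      by (intro power_mono) auto
    finally show ?thesis .
  qed
  \<comment> \<open>The supremum is taken in the extended reals because its finiteness almost
    everywhere is only deduced from the finite integral.\<close>
  define u where "u x = (SUP N. ennreal ((h N x)\<^sup>2))" for x
  have [measurable]: "u \<in> borel_measurable I01" unfolding u_def by measurable
  have hmono: "h m x \<le> h n x" if "m \<le> n" for m n x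
    unfolding h_def using that by (intro sum_mono2) auto
  have h0: "0 \<le> h n x" for n x unfolding h_def by (simp add: sum_nonneg)
  have "(\<integral>\<^sup>+ x. u x \<partial>I01) = (SUP N. \<integral>\<^sup>+ x. ennreal ((h N x)\<^sup>2) \<partial>I01)"
    unfolding u_def
  proof (rule nn_integral_monotone_convergence_SUP)
    show "incseq (\<lambda>N x. ennreal ((h N x)\<^sup>2))"
      by (intro incseq_SucI le_funI ennreal_leI power_mono hmono h0) simp
  qed measurable
  also have "\<dots> \<le> ennreal (C\<^sup>2)"
    using nn_integral_eq_integral[OF ih] hC by (intro SUP_least) (simp add: ennreal_leI)
  finally have uC: "(\<integral>\<^sup>+ x. u x \<partial>I01) \<le> ennreal (C\<^sup>2)" .
  then have ufin: "(\<integral>\<^sup>+ x. u x \<partial>I01) < \<infinity>" by (simp add: le_less_trans less_top)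
  have sumx: "AE x in I01. summable (\<lambda>n. cmod (f n x))"
  proof -
    have "AE x in I01. u x \<noteq> \<infinity>"
      using ufin by (intro nn_integral_noteq_infinite) auto
    then show ?thesis
    proof (rule eventually_mono)
      fix x assume ux: "u x \<noteq> \<infinity>"
      have "h N x \<le> sqrt (enn2real (u x))" for N
      proof (rule real_le_rsqrt)
        have "ennreal ((h N x)\<^sup>2) \<le> u x" unfolding u_def by (intro SUP_upper) auto
        then have "enn2real (ennreal ((h N x)\<^sup>2)) \<le> enn2real (u x)"
          using ux by (intro enn2real_mono) (auto simp: less_top)
        then show "(h N x)\<^sup>2 \<le> enn2real (u x)" by simp
      qed
      then show "summable (\<lambda>n. cmod (f n x))"
        unfolding h_def by (intro summableI_nonneg_bounded) auto
    qed
  qed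
  define H where "H x = (\<Sum>n. cmod (f n x))" for x
  define g where "g x = (\<Sum>n. f n x)" for x
  have [measurable]: "H \<in> borel_measurable I01" unfolding H_def by measurable
  have [measurable]: "g \<in> borel_measurable I01" unfolding g_def by measurable
  have iH: "integrable I01 (\<lambda>x. (H x)\<^sup>2)"
  proof (rule integrableI_bounded)
    have "AE x in I01. ennreal ((H x)\<^sup>2) \<le> u x"
      using sumx
    proof (rule eventually_mono)
      fix x assume "summable (\<lambda>n. cmod (f n x))"
      then have "(\<lambda>N. h N x) \<longlonglongrightarrow> H x" unfolding h_def H_def by (rule summable_LIMSEQ)
      then have "(\<lambda>N. ennreal ((h N x)\<^sup>2)) \<longlonglongrightarrow> ennreal ((H x)\<^sup>2)"
        by (intro tendsto_ennrealI tendsto_power)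
      then show "ennreal ((H x)\<^sup>2) \<le> u x"
        by (rule LIMSEQ_le_const2) (auto simp: u_def intro!: SUP_upper)
    qed
    then have "(\<integral>\<^sup>+ x. ennreal ((H x)\<^sup>2) \<partial>I01) \<le> (\<integral>\<^sup>+ x. u x \<partial>I01)"
      by (rule nn_integral_mono_AE)
    then show "(\<integral>\<^sup>+ x. ennreal (norm ((H x)\<^sup>2)) \<partial>I01) < \<infinity>" using ufin by simp
  qed measurable
  have tail: "AE x in I01. (\<lambda>N. \<Sum>n<N. f n x) \<longlonglongrightarrow> g x \<and> (\<forall>N. cmod (g x - (\<Sum>n<N. f n x)) \<le> H x)"
    using sumx
  proof (rule eventually_mono, intro conjI allI)
    fix x assume s: "summable (\<lambda>n. cmod (f n x))"
    then have sf: "summable (\<lambda>n. f n x)" by (rule summable_norm_cancel)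
    then show "(\<lambda>N. \<Sum>n<N. f n x) \<longlonglongrightarrow> g x" unfolding g_def by (rule summable_LIMSEQ)
    fix N
    have "g x - (\<Sum>n<N. f n x) = (\<Sum>n. f (n + N) x)"
      unfolding g_def by (rule suminf_minus_initial_segment[OF sf, symmetric])
    also have "cmod \<dots> \<le> (\<Sum>n. cmod (f (n + N) x))"
      by (intro summable_norm summable_ignore_initial_segment s)
    also have "\<dots> = H x - h N x"
      unfolding H_def h_def by (rule suminf_minus_initial_segment[OF s])
    also have "\<dots> \<le> H x" using h0 by simp
    finally show "cmod (g x - (\<Sum>n<N. f n x)) \<le> H x" .
  qed
  have sg: "square_integrable g"
    unfolding square_integrable_def
  proof
    show "integrable I01 (\<lambda>x. (cmod (g x))\<^sup>2)"
    proof (rule Bochner_Integration.integrable_bound[OF iH])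
      show "AE x in I01. norm ((cmod (g x))\<^sup>2) \<le> norm ((H x)\<^sup>2)"
        using tail
      proof (rule eventually_mono)
        fix x assume "(\<lambda>N. \<Sum>n<N. f n x) \<longlonglongrightarrow> g x \<and> (\<forall>N. cmod (g x - (\<Sum>n<N. f n x)) \<le> H x)"
        then have "cmod (g x - (\<Sum>n<0. f n x)) \<le> H x" by blast
        then have "cmod (g x) \<le> H x" by simp
        then show "norm ((cmod (g x))\<^sup>2) \<le> norm ((H x)\<^sup>2)" by (simp add: power_mono)
      qed
    qed measurable
  qed measurable
  have sS: "square_integrable (\<lambda>x. \<Sum>n<N. f n x)" for N
    by (rule class_L2_sum(1)) (rule f)
  have "(\<lambda>N. LINT x|I01. (cmod (g x - (\<Sum>n<N. f n x)))\<^sup>2) \<longlonglongrightarrow> (LINT x|I01. 0)"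
  proof (rule integral_dominated_convergence[where w="\<lambda>x. (H x)\<^sup>2"])
    show "AE x in I01. (\<lambda>N. (cmod (g x - (\<Sum>n<N. f n x)))\<^sup>2) \<longlonglongrightarrow> 0"
      using tail
    proof (rule eventually_mono)
      fix x assume "(\<lambda>N. \<Sum>n<N. f n x) \<longlonglongrightarrow> g x \<and> (\<forall>N. cmod (g x - (\<Sum>n<N. f n x)) \<le> H x)"
      then have "(\<lambda>N. (cmod (g x - (\<Sum>n<N. f n x)))\<^sup>2) \<longlonglongrightarrow> (cmod (g x - g x))\<^sup>2"
        by (intro tendsto_intros) auto
      then show "(\<lambda>N. (cmod (g x - (\<Sum>n<N. f n x)))\<^sup>2) \<longlonglongrightarrow> 0" by simp
    qed
    show "AE x in I01. norm ((cmod (g x - (\<Sum>n<N. f n x)))\<^sup>2) \<le> (H x)\<^sup>2" for N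
      using tail by (rule eventually_mono) (simp add: power_mono)
  qed (measurable, rule iH)
  moreover have "(LINT x|I01. (cmod (g x - (\<Sum>n<N. f n x)))\<^sup>2) = (norm (class_L2 g - (\<Sum>n<N. F n)))\<^sup>2" for N
  proof -
    have "class_L2 g - (\<Sum>n<N. F n) = class_L2 (\<lambda>x. g x - (\<Sum>n<N. f n x))"
      using class_L2_sum(2)[of "{..<N}" f, OF f] class_L2_diff[OF sg sS] by (simp add: F)
    then show ?thesis by (simp only: norm_class_L2[OF square_integrable_diff[OF sg sS]])
  qed
  ultimately have "(\<lambda>N. (norm (class_L2 g - (\<Sum>n<N. F n)))\<^sup>2) \<longlonglongrightarrow> 0" by simp
  then have "(\<lambda>N. sqrt ((norm (class_L2 g - (\<Sum>n<N. F n)))\<^sup>2)) \<longlonglongrightarrow> sqrt 0"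
    by (rule tendsto_real_sqrt)
  then have "(\<lambda>N. norm ((\<Sum>n<N. F n) - class_L2 g)) \<longlonglongrightarrow> 0"
    by (simp add: norm_minus_commute)
  then have "F sums class_L2 g"
    unfolding sums_def by (rule LIM_zero_cancel[OF tendsto_norm_zero_cancel])
  then show ?thesis by (rule sums_summable)
qed

text \<open>A Cauchy sequence converges once a subsequence does, and the increments of a fast
  subsequence form an absolutely convergent series. Completeness is what makes the expansions in
  \<open>orthonormal_basis_sums\<close> converge.\<close>

instance L2 :: banach
proof
  fix X :: "nat \<Rightarrow> L2" assume X: "Cauchy X"
  have "\<exists>N. \<forall>m\<ge>N. \<forall>n\<ge>N. norm (X m - X n) < (1/2) ^ k" for k :: nat
    using X unfolding Cauchy_iff by (auto dest: spec[of _ "(1/2) ^ k"])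
  then obtain N where N: "\<And>k m n. m \<ge> N k \<Longrightarrow> n \<ge> N k \<Longrightarrow> norm (X m - X n) < (1/2) ^ k"
    by metis
  \<comment> \<open>\<open>Suc rk\<close> keeps the subsequence strictly increasing, and
    \<open>N (Suc k)\<close> keeps its increments below \<open>(1/2) ^ k\<close>.\<close>
  define r where "r = rec_nat (N 0) (\<lambda>k rk. max (Suc rk) (N (Suc k)))"
  have r_Suc: "r (Suc k) = max (Suc (r k)) (N (Suc k))" for k by (simp add: r_def)
  have r: "strict_mono r" by (rule strict_monoI_Suc) (simp add: r_Suc)
  have rN: "r k \<ge> N k" for k by (cases k) (simp_all add: r_def)
  define F where "F k = X (r (Suc k)) - X (r k)" for k
  have "norm (F k) \<le> (1/2) ^ k" for k
  proof -
    have "N k \<le> r k" "N k \<le> r (Suc k)" using rN[of k] by (simp_all add: r_Suc)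
    then show ?thesis unfolding F_def by (rule less_imp_le[OF N[rotated]])
  qed
  then have "summable (\<lambda>k. norm (F k))"
    by (intro summable_comparison_test[OF _ summable_geometric[of "1/2::real"]] exI[of _ 0]) simp_all
  then have "(\<lambda>n. \<Sum>k<n. F k) \<longlonglongrightarrow> suminf F"
    by (intro summable_LIMSEQ summable_L2)
  moreover have "(\<Sum>k<n. F k) = X (r n) - X (r 0)" for n
    unfolding F_def by (rule sum_lessThan_telescope)
  ultimately have "(\<lambda>n. X (r n) - X (r 0) + X (r 0)) \<longlonglongrightarrow> suminf F + X (r 0)"
    by (intro tendsto_add tendsto_const) simp
  then have "(X \<circ> r) \<longlonglongrightarrow> suminf F + X (r 0)" by (simp add: o_def)
  then show "convergent X" using Cauchy_converges_subseq[OF X r] convergentI by blast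
qed

section \<open>Complex inner product: Cauchy-Schwarz, Bessel and Parseval\<close>

lemma cinner_commute: "cinner g f = cnj (cinner f g)"
proof transfer
  fix g f :: "real \<Rightarrow> complex"
  have "(LINT x|I01. cnj (g x) * f x) = (LINT x|I01. cnj (cnj (f x) * g x))"
    by (simp add: mult.commute)
  also have "\<dots> = cnj (LINT x|I01. cnj (f x) * g x)" by (rule Bochner_Integration.integral_cnj)
  finally show "(LINT x|I01. cnj (g x) * f x) = cnj (LINT x|I01. cnj (f x) * g x)" .
qed

lemma norm_scaleC: "norm (scaleC c f) = cmod c * norm f"
proof -
  have sq: "cnj z * z = of_real ((cmod z)\<^sup>2)" for z
    by (metis complex_norm_square mult.commute)
  have "cinner (scaleC c f) (scaleC c f) = (cnj c * c) * cinner f f"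
    by (simp only: cinner_scaleC_left cinner_scaleC_right mult.assoc mult.left_commute)
  also have "\<dots> = of_real ((cmod c * norm f)\<^sup>2)"
    by (simp only: sq cinner_same of_real_mult[symmetric] power_mult_distrib)
  finally have "(norm (scaleC c f))\<^sup>2 = (cmod c * norm f)\<^sup>2"
    by (simp only: norm_L2_sq Re_complex_of_real)
  then show ?thesis by (simp add: power2_eq_iff_nonneg)
qed

lemma cinner_Cauchy_Schwarz: "cmod (cinner f g) \<le> norm f * norm g"
proof (cases "cinner f g = 0")
  case False
  \<comment> \<open>The unit phase that rotates \<open>cinner f g\<close> onto its modulus, so that
    the real Cauchy-Schwarz inequality applies.\<close>
  define c where "c = cnj (cinner f g) / cmod (cinner f g)"
  have c1: "cmod c = 1" using False by (simp add: c_def norm_divide)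
  have "c * cinner f g = cmod (cinner f g)"
    using False by (simp add: c_def complex_norm_square[symmetric] power2_eq_square mult.commute)
  then have "cmod (cinner f g) = inner f (scaleC c g)"
    by (simp add: inner_L2_def cinner_scaleC_right)
  also have "\<dots> \<le> norm f * norm (scaleC c g)" by (rule norm_cauchy_schwarz)
  finally show ?thesis by (simp add: norm_scaleC c1)
qed simp

lemma bounded_linear_cinner_right: "bounded_linear (cinner f)"
  by (rule bounded_linear_intro[where K="norm f"])
     (simp_all add: cinner_add_right cinner_scaleR_right scaleR_conv_of_real, metis cinner_Cauchy_Schwarz mult.commute)

lemma bounded_linear_scaleC: "bounded_linear (scaleC c)"
  by (rule bounded_linear_intro[where K="cmod c"])
     (simp_all add: scaleC_add scaleR_L2_def scaleC_scaleC norm_scaleC mult.commute)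

lemma cinner_sum_right: "cinner f (\<Sum>i\<in>A. g i) = (\<Sum>i\<in>A. cinner f (g i))"
  by (rule linear_sum[OF bounded_linear.linear[OF bounded_linear_cinner_right]])

lemma cinner_sum_left: "cinner (\<Sum>i\<in>A. g i) f = (\<Sum>i\<in>A. cinner (g i) f)"
proof -
  have "cinner (\<Sum>i\<in>A. g i) f = cnj (cinner f (\<Sum>i\<in>A. g i))" by (rule cinner_commute)
  also have "\<dots> = (\<Sum>i\<in>A. cnj (cinner f (g i)))" by (simp add: cinner_sum_right)
  also have "\<dots> = (\<Sum>i\<in>A. cinner (g i) f)" by (simp only: cinner_commute[symmetric])
  finally show ?thesis .
qed

lemma cinner_diff_right: "cinner f (g - h) = cinner f g - cinner f h"
  by (rule linear_diff[OF bounded_linear.linear[OF bounded_linear_cinner_right]])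

lemma orthonormal_on_subset: "orthonormal_on N e \<Longrightarrow> M \<subseteq> N \<Longrightarrow> orthonormal_on M e"
  unfolding orthonormal_on_def by (simp add: subset_eq)

lemma cinner_orthonormal_sum:
  assumes "orthonormal_on A e" "finite A" "j \<in> A"
  shows "cinner (e j) (\<Sum>i\<in>A. scaleC (c i) (e i)) = c j"
proof -
  have "cinner (e j) (\<Sum>i\<in>A. scaleC (c i) (e i)) = (\<Sum>i\<in>A. if i = j then c i else 0)"
    unfolding cinner_sum_right
    using assms(1,3) by (intro sum.cong) (auto simp: cinner_scaleC_right orthonormal_on_def)
  then show ?thesis using assms by simp
qed

lemma norm_orthonormal_sum:
  assumes "orthonormal_on A e" "finite A"
  shows "(norm (\<Sum>i\<in>A. scaleC (c i) (e i)))\<^sup>2 = (\<Sum>i\<in>A. (cmod (c i))\<^sup>2)"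
proof -
  have "cinner (\<Sum>i\<in>A. scaleC (c i) (e i)) (\<Sum>i\<in>A. scaleC (c i) (e i))
      = (\<Sum>i\<in>A. cnj (c i) * c i)"
    unfolding cinner_sum_left[of _ A] using assms
    by (intro sum.cong refl) (simp only: cinner_scaleC_left cinner_orthonormal_sum)
  also have "\<dots> = (\<Sum>i\<in>A. of_real ((cmod (c i))\<^sup>2))"
    by (intro sum.cong refl) (metis complex_norm_square mult.commute)
  finally show ?thesis by (simp add: norm_L2_sq del: of_real_power)
qed

lemma Bessel_inequality:
  assumes "orthonormal_on A e" "finite A"
  shows "(\<Sum>i\<in>A. (cmod (cinner (e i) x))\<^sup>2) \<le> (norm x)\<^sup>2"
proof -
  define y where "y = (\<Sum>i\<in>A. scaleC (cinner (e i) x) (e i))"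
  have "cinner y (x - y) = (\<Sum>i\<in>A. cnj (cinner (e i) x) * cinner (e i) (x - y))"
    by (subst y_def) (simp only: cinner_sum_left cinner_scaleC_left)
  also have "\<dots> = 0"
    using cinner_orthonormal_sum[OF assms] by (simp add: cinner_diff_right y_def)
  finally have "inner y (x - y) = 0" by (simp add: inner_L2_def)
  then have "(norm (y + (x - y)))\<^sup>2 = (norm y)\<^sup>2 + (norm (x - y))\<^sup>2"
    by (rule norm_add_Pythagorean[unfolded orthogonal_def])
  then show ?thesis using norm_orthonormal_sum[OF assms, of "\<lambda>i. cinner (e i) x"]
    by (simp add: y_def)
qed

text \<open>Cauchy-Schwarz for sums on top of two Bessel inequalities. The bound does not depend on
  the number of vectors, which makes it fit for both the trace norm and the trace.\<close>

lemma Bessel_cinner_le: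
  assumes "orthonormal_on A e" "orthonormal_on A f" "finite A"
  shows "(\<Sum>i\<in>A. cmod (cinner (e i) x) * cmod (cinner (f i) y)) \<le> norm x * norm y"
proof -
  have "(\<Sum>i\<in>A. cmod (cinner (e i) x) * cmod (cinner (f i) y))
      \<le> L2_set (\<lambda>i. cmod (cinner (e i) x)) A * L2_set (\<lambda>i. cmod (cinner (f i) y)) A"
    using L2_set_mult_ineq[of "\<lambda>i. cmod (cinner (e i) x)" "\<lambda>i. cmod (cinner (f i) y)" A] by simp
  also have "\<dots> \<le> norm x * norm y"
    using Bessel_inequality[OF assms(1,3), of x] Bessel_inequality[OF assms(2,3), of y]
    by (intro mult_mono) (auto simp: L2_set_def real_le_lsqrt intro!: real_sqrt_ge_zero sum_nonneg)
  finally show ?thesis .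
qed

text \<open>Bessel makes the partial sums Cauchy. The limit has the same coefficients as
  \<open>x\<close>, and maximality, the defining property of a basis here, forces the difference to
  vanish.\<close>

theorem orthonormal_basis_sums:
  assumes e: "orthonormal_basis e"
  shows "(\<lambda>i. scaleC (cinner (e i) x) (e i)) sums x"
proof -
  have o: "orthonormal_on A e" for A
    using e orthonormal_on_subset unfolding orthonormal_basis_def by blast
  have s2: "summable (\<lambda>i. (cmod (cinner (e i) x))\<^sup>2)"
    using Bessel_inequality[OF o] by (intro summableI_nonneg_bounded) auto
  have s: "summable (\<lambda>i. scaleC (cinner (e i) x) (e i))"
    unfolding summable_Cauchy
  proof (intro allI impI)
    fix \<epsilon> :: real assume \<epsilon>: "\<epsilon> > 0"
    then have "\<epsilon>\<^sup>2 > 0" by simp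
    with s2 obtain N where N: "\<And>m n. m \<ge> N \<Longrightarrow> norm (\<Sum>i=m..<n. (cmod (cinner (e i) x))\<^sup>2) < \<epsilon>\<^sup>2"
      unfolding summable_Cauchy by blast
    have "norm (\<Sum>i=m..<n. scaleC (cinner (e i) x) (e i)) < \<epsilon>" if "m \<ge> N" for m n
    proof (rule power_less_imp_less_base)
      show "(norm (\<Sum>i=m..<n. scaleC (cinner (e i) x) (e i)))\<^sup>2 < \<epsilon>\<^sup>2"
        using N[OF that, of n] by (simp add: norm_orthonormal_sum[OF o])
    qed (use \<epsilon> in simp)
    then show "\<exists>N. \<forall>m\<ge>N. \<forall>n. norm (\<Sum>i=m..<n. scaleC (cinner (e i) x) (e i)) < \<epsilon>" by blast
  qed
  define y where "y = (\<Sum>i. scaleC (cinner (e i) x) (e i))"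
  have y: "(\<lambda>i. scaleC (cinner (e i) x) (e i)) sums y" unfolding y_def by (rule summable_sums[OF s])
  have "cinner (e j) (x - y) = 0" for j
  proof -
    have "(\<lambda>i. cinner (e j) (scaleC (cinner (e i) x) (e i))) sums cinner (e j) y"
      by (rule bounded_linear.sums[OF bounded_linear_cinner_right y])
    moreover have "(\<lambda>i. cinner (e j) (scaleC (cinner (e i) x) (e i))) = (\<lambda>i. if i = j then cinner (e j) x else 0)"
      using o[of UNIV] by (auto simp: cinner_scaleC_right orthonormal_on_def)
    ultimately have "cinner (e j) y = cinner (e j) x"
      using sums_unique2 sums_single[of j "\<lambda>i. cinner (e j) x"] by fastforce
    then show ?thesis by (simp add: cinner_diff_right)
  qed
  then have "x - y = 0" using e unfolding orthonormal_basis_def by blast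
  then show ?thesis using y by simp
qed

corollary Parseval:
  assumes "orthonormal_basis e"
  shows "(\<lambda>i. cinner x (e i) * cinner (e i) y) sums cinner x y"
  using bounded_linear.sums[OF bounded_linear_cinner_right orthonormal_basis_sums[OF assms], of x y]
  by (simp add: cinner_scaleC_right mult.commute)

section \<open>The trace of operators factoring through a diagonal trace class operator\<close>

lemma cmod_cinner_commute: "cmod (cinner f g) = cmod (cinner g f)"
  by (subst cinner_commute) (simp only: complex_mod_cnj)

lemma complex_linear_compose:
  "complex_linear A \<Longrightarrow> complex_linear B \<Longrightarrow> complex_linear (A o\<^sub>L B)"
  by (simp add: complex_linear_def)

lemma complex_linear_add: "complex_linear A \<Longrightarrow> complex_linear B \<Longrightarrow> complex_linear (A + B)"
  by (simp add: complex_linear_def plus_blinfun.rep_eq scaleC_add)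

lemma complex_linear_scaleR: "complex_linear A \<Longrightarrow> complex_linear (r *\<^sub>R A)"
  by (simp add: complex_linear_def scaleR_blinfun.rep_eq scaleR_L2_def scaleC_scaleC mult.commute)

lemma complex_linear_uminus: "complex_linear A \<Longrightarrow> complex_linear (- A)"
  using complex_linear_scaleR[of A "-1"] by simp

lemma complex_linear_diff: "complex_linear A \<Longrightarrow> complex_linear B \<Longrightarrow> complex_linear (A - B)"
  using complex_linear_add[of A "- B"] complex_linear_uminus[of B] by simp

lemma complex_linear_id: "complex_linear id_blinfun"
  by (simp add: complex_linear_def)

lemma complex_linear_mult_op: "complex_linear (mult_op a)"
  unfolding complex_linear_def
proof (intro allI)
  fix c f
  show "mult_op a (scaleC c f) = scaleC c (mult_op a f)"
    unfolding mult_op.rep_eq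
    by transfer (simp add: linf_rel_def l2_rel_def mult.left_commute square_integrable_scale
        ess_bounded_mult_square_integrable)
qed

text \<open>Elements of the operator type are real-linear already, so commuting with multiplication
  by the imaginary unit is all that remains.\<close>

lemma complex_linearI:
  assumes "\<And>f. blinfun_apply A (scaleC \<i> f) = scaleC \<i> (blinfun_apply A f)"
  shows "complex_linear A"
  unfolding complex_linear_def
proof (intro allI)
  fix c f
  have dec: "scaleC c g = Re c *\<^sub>R g + Im c *\<^sub>R scaleC \<i> g" for g
  proof (cases rule: class_L2_cases[of g])
    case (1 h)
    then have si: "square_integrable (\<lambda>x. of_real (Re c) * h x)" "square_integrable (\<lambda>x. \<i> * h x)"
        "square_integrable (\<lambda>x. of_real (Im c) * (\<i> * h x))"
      using square_integrable_scale by blast+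
    have "c * z = of_real (Re c) * z + of_real (Im c) * (\<i> * z)" for z
      by (subst complex_eq[of c]) (simp only: distrib_right mult.assoc mult.left_commute[of "\<i>"])
    then show ?thesis
      using 1 si by (simp only: scaleR_L2_def class_L2_scaleC class_L2_add)
  qed
  show "blinfun_apply A (scaleC c f) = scaleC c (blinfun_apply A f)"
    unfolding dec[of f] dec[of "blinfun_apply A f"]
    by (simp add: blinfun.add_right blinfun.scaleR_right assms)
qed

definition imag_op :: "L2 \<Rightarrow>\<^sub>L L2" where
  "imag_op = Blinfun (scaleC \<i>)"

lemma imag_op_apply [simp]: "blinfun_apply imag_op f = scaleC \<i> f"
  by (simp add: imag_op_def bounded_linear_Blinfun_apply bounded_linear_scaleC)

text \<open>The type of bounded operators contains all real-linear maps; this is the projection onto the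
  complex-linear ones.\<close>

definition complex_part :: "(L2 \<Rightarrow>\<^sub>L L2) \<Rightarrow> (L2 \<Rightarrow>\<^sub>L L2)" where
  "complex_part B = (1/2) *\<^sub>R (B - (imag_op o\<^sub>L B o\<^sub>L imag_op))"

lemma bounded_linear_complex_part: "bounded_linear complex_part"
proof -
  have "bounded_linear (\<lambda>B. (1/2) *\<^sub>R (B - (imag_op o\<^sub>L B o\<^sub>L imag_op)))"
    by (intro bounded_linear_const_scaleR bounded_linear_sub bounded_linear_ident
        bounded_linear_compose[OF bounded_bilinear.bounded_linear_left[OF bounded_bilinear_blinfun_compose]]
        bounded_bilinear.bounded_linear_right[OF bounded_bilinear_blinfun_compose])
  then show ?thesis by (simp add: complex_part_def[abs_def])
qed

lemma scaleC_minus_one: "scaleC (-1) f = - f"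
  by (simp add: uminus_L2_def)

lemma scaleC_uminus: "scaleC c (- f) = - scaleC c f"
  by (rule linear_neg[OF bounded_linear.linear[OF bounded_linear_scaleC]])

lemma scaleC_diff: "scaleC c (f - g) = scaleC c f - scaleC c g"
  by (rule linear_diff[OF bounded_linear.linear[OF bounded_linear_scaleC]])

lemma scaleC_scaleR: "scaleC c (r *\<^sub>R f) = r *\<^sub>R scaleC c f"
  by (simp add: scaleR_L2_def scaleC_scaleC mult.commute)

lemma complex_part_apply:
  "blinfun_apply (complex_part B) f
    = (1/2) *\<^sub>R (blinfun_apply B f - scaleC \<i> (blinfun_apply B (scaleC \<i> f)))"
  by (simp add: complex_part_def scaleR_blinfun.rep_eq minus_blinfun.rep_eq)

lemma complex_linear_complex_part: "complex_linear (complex_part B)"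
  by (rule complex_linearI)
     (simp add: complex_part_apply scaleC_scaleR scaleC_diff scaleC_scaleC scaleC_minus_one blinfun.minus_right
       scaleC_uminus add.commute)

lemma complex_part_eq:
  assumes "complex_linear B"
  shows "complex_part B = B"
proof (rule blinfun_eqI)
  fix f
  have "blinfun_apply B f + blinfun_apply B f = 2 *\<^sub>R blinfun_apply B f" by (simp add: scaleR_2)
  then show "blinfun_apply (complex_part B) f = blinfun_apply B f"
    using assms by (simp add: complex_part_apply complex_linear_def scaleC_scaleC scaleC_minus_one)
qed

lemma norm_orthonormal_basis: "orthonormal_basis e \<Longrightarrow> norm (e k) = 1"
proof -
  assume "orthonormal_basis e"
  then have "cinner (e k) (e k) = 1" by (simp add: orthonormal_basis_def orthonormal_on_def)
  then have "complex_of_real ((norm (e k))\<^sup>2) = 1" by (simp only: cinner_same)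
  then have "(norm (e k))\<^sup>2 = 1" by (simp only: of_real_eq_1_iff)
  then show ?thesis by (simp add: power2_eq_1_iff) (metis norm_ge_zero less_minus_one_simps(1) not_less)
qed

text \<open>The features of the Dirichlet inverse on which the trace computations rest: an
  eigenbasis with nonnegative, summable eigenvalues.\<close>

locale diagonal_operator =
  fixes \<phi> :: "nat \<Rightarrow> L2" and lam :: "nat \<Rightarrow> real" and G :: "L2 \<Rightarrow>\<^sub>L L2"
  assumes basis: "orthonormal_basis \<phi>"
    and lam_nonneg: "\<And>k. 0 \<le> lam k"
    and lam_summable: "summable lam"
    and G_linear: "complex_linear G"
    and G_eigen: "\<And>k. blinfun_apply G (\<phi> k) = lam k *\<^sub>R \<phi> k"
begin

lemma G_sums: "(\<lambda>k. scaleC (of_real (lam k) * cinner (\<phi> k) x) (\<phi> k)) sums blinfun_apply G x"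
proof -
  have "(\<lambda>k. blinfun_apply G (scaleC (cinner (\<phi> k) x) (\<phi> k))) sums blinfun_apply G x"
    by (rule bounded_linear.sums[OF blinfun.bounded_linear_right orthonormal_basis_sums[OF basis]])
  moreover have "blinfun_apply G (scaleC (cinner (\<phi> k) x) (\<phi> k)) = scaleC (of_real (lam k) * cinner (\<phi> k) x) (\<phi> k)" for k
    using G_linear unfolding complex_linear_def
    by (simp add: G_eigen scaleR_L2_def scaleC_scaleC mult.commute)
  ultimately show ?thesis by simp
qed

lemma cinner_G: "cinner (\<phi> k) (blinfun_apply G x) = of_real (lam k) * cinner (\<phi> k) x"
proof -
  have "(\<lambda>i. cinner (\<phi> k) (scaleC (of_real (lam i) * cinner (\<phi> i) x) (\<phi> i))) sums cinner (\<phi> k) (blinfun_apply G x)"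
    by (rule bounded_linear.sums[OF bounded_linear_cinner_right G_sums])
  moreover have "cinner (\<phi> k) (scaleC (of_real (lam i) * cinner (\<phi> i) x) (\<phi> i))
      = (if i = k then of_real (lam k) * cinner (\<phi> k) x else 0)" for i
    using basis by (simp add: cinner_scaleC_right orthonormal_basis_def orthonormal_on_def)
  ultimately have "(\<lambda>i. if i = k then of_real (lam k) * cinner (\<phi> k) x else 0) sums cinner (\<phi> k) (blinfun_apply G x)"
    by simp
  then show ?thesis using sums_single[of k "\<lambda>i. of_real (lam k) * cinner (\<phi> k) x"] by (rule sums_unique2)
qed

lemma cinner_compose_G_sums:
  assumes B: "complex_linear B"
  shows "(\<lambda>k. of_real (lam k) * (cinner (\<phi> k) x * cinner y (blinfun_apply B (\<phi> k))))
           sums cinner y (blinfun_apply B (blinfun_apply G x))"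
proof -
  have "(\<lambda>k. cinner y (blinfun_apply B (scaleC (of_real (lam k) * cinner (\<phi> k) x) (\<phi> k))))
      sums cinner y (blinfun_apply B (blinfun_apply G x))"
    by (intro bounded_linear.sums[OF bounded_linear_cinner_right]
        bounded_linear.sums[OF blinfun.bounded_linear_right] G_sums)
  then show ?thesis using B by (simp add: complex_linear_def cinner_scaleC_right mult.assoc)
qed

lemma norm_apply_basis: "norm (blinfun_apply B (\<phi> k)) \<le> norm B"
  using norm_blinfun[of B "\<phi> k"] norm_orthonormal_basis[OF basis] by simp

text \<open>Each pairing expands into a series over the eigenbasis. For fixed \<open>k\<close>,
  Bessel bounds the sum over the finite families by \<open>norm B * lam k\<close>, and summing over
  \<open>k\<close> last gives a bound that is linear in \<open>norm B\<close>.\<close>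

lemma trace_class_compose:
  assumes B: "complex_linear B"
  shows "trace_class_op (B o\<^sub>L G)" "trace_norm (B o\<^sub>L G) \<le> norm B * suminf lam"
proof -
  have "s \<le> norm B * suminf lam" if "s \<in> trace_sums (B o\<^sub>L G)" for s
  proof -
    obtain n e f where o: "orthonormal_on {..<n} e" "orthonormal_on {..<n} f"
      and s: "s = (\<Sum>i<n. cmod (cinner (f i) (blinfun_apply (B o\<^sub>L G) (e i))))"
      using \<open>s \<in> trace_sums (B o\<^sub>L G)\<close> unfolding trace_sums_def by blast
    define a where "a i k = lam k * (cmod (cinner (e i) (\<phi> k)) * cmod (cinner (f i) (blinfun_apply B (\<phi> k))))" for i k
    have a_sum: "(\<Sum>i<n. a i k) \<le> norm B * lam k" for k
    proof -
      have "(\<Sum>i<n. cmod (cinner (e i) (\<phi> k)) * cmod (cinner (f i) (blinfun_apply B (\<phi> k)))) \<le> 1 * norm B"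
        using Bessel_cinner_le[OF o, of "\<phi> k" "blinfun_apply B (\<phi> k)"] norm_apply_basis[of B k]
          norm_orthonormal_basis[OF basis, of k] by simp
      then show ?thesis unfolding a_def sum_distrib_left[symmetric]
        using mult_left_mono[OF _ lam_nonneg[of k]] by (simp only: mult_1 mult.commute[of "norm B"])
    qed
    have a0: "0 \<le> a i k" for i k unfolding a_def using lam_nonneg by simp
    have sB: "summable (\<lambda>k. norm B * lam k)" by (rule summable_mult[OF lam_summable])
    have sa: "summable (a i)" if "i < n" for i
    proof (rule summable_comparison_test'[OF sB, of 0])
      fix k
      have "a i k \<le> (\<Sum>i<n. a i k)"
        using that a0 by (intro member_le_sum) auto
      then show "norm (a i k) \<le> norm B * lam k" using a_sum[of k] a0 by simp
    qed
    have "cmod (cinner (f i) (blinfun_apply (B o\<^sub>L G) (e i))) \<le> suminf (a i)" if "i < n" for i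
    proof -
      have "cinner (f i) (blinfun_apply (B o\<^sub>L G) (e i))
          = (\<Sum>k. of_real (lam k) * (cinner (\<phi> k) (e i) * cinner (f i) (blinfun_apply B (\<phi> k))))"
        using sums_unique[OF cinner_compose_G_sums[OF B]] by simp
      also have "cmod \<dots> \<le> suminf (a i)"
        by (rule norm_suminf_le[OF _ sa[OF that]])
           (simp add: a_def norm_mult lam_nonneg cmod_cinner_commute[of "\<phi> _"])
      finally show ?thesis .
    qed
    then have "s \<le> (\<Sum>i<n. suminf (a i))" unfolding s by (intro sum_mono) auto
    also have "\<dots> = (\<Sum>k. \<Sum>i<n. a i k)"
      using sa by (intro suminf_sum[symmetric]) auto
    also have "\<dots> \<le> (\<Sum>k. norm B * lam k)"
      using sa by (intro suminf_le a_sum sB summable_sum) auto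
    also have "\<dots> = norm B * suminf lam" by (rule suminf_mult[OF lam_summable])
    finally show ?thesis .
  qed
  then show "trace_class_op (B o\<^sub>L G)" "trace_norm (B o\<^sub>L G) \<le> norm B * suminf lam"
    using trace_class_opI[OF complex_linear_compose[OF B G_linear]] by blast+
qed

text \<open>A functional on all bounded operators, so that it is bounded linear on a full normed
  space. For complex-linear \<open>B\<close> it is the trace of
  \<open>B o\<^sub>L G\<close>.\<close>

definition diag_trace :: "(L2 \<Rightarrow>\<^sub>L L2) \<Rightarrow> complex" where
  "diag_trace B = (\<Sum>k. of_real (lam k) * cinner (\<phi> k) (blinfun_apply B (\<phi> k)))"

lemma cinner_basis_le: "cmod (cinner (\<phi> k) (blinfun_apply B (\<phi> k))) \<le> norm B"
  using cinner_Cauchy_Schwarz[of "\<phi> k" "blinfun_apply B (\<phi> k)"] norm_apply_basis[of B k]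
    norm_orthonormal_basis[OF basis, of k] by simp

lemma norm_diag_trace_term:
  "norm (of_real (lam k) * cinner (\<phi> k) (blinfun_apply B (\<phi> k))) \<le> norm B * lam k"
  using mult_right_mono[OF cinner_basis_le lam_nonneg, of k B k]
  by (simp add: norm_mult lam_nonneg mult.commute)

lemma summable_diag_trace: "summable (\<lambda>k. of_real (lam k) * cinner (\<phi> k) (blinfun_apply B (\<phi> k)))"
  by (rule summable_comparison_test'[OF summable_mult[OF lam_summable], of 0]) (rule norm_diag_trace_term)

lemma bounded_linear_diag_trace: "bounded_linear diag_trace"
proof (rule bounded_linear_intro[where K="suminf lam"])
  fix A B :: "L2 \<Rightarrow>\<^sub>L L2" and r :: real
  show "diag_trace (A + B) = diag_trace A + diag_trace B"
    unfolding diag_trace_def suminf_add[OF summable_diag_trace summable_diag_trace]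
    by (simp add: plus_blinfun.rep_eq cinner_add_right distrib_left)
  show "diag_trace (r *\<^sub>R A) = r *\<^sub>R diag_trace A"
    unfolding diag_trace_def scaleR_conv_of_real suminf_mult[OF summable_diag_trace, symmetric]
    by (simp add: scaleR_blinfun.rep_eq cinner_scaleR_right mult.left_commute)
  show "norm (diag_trace A) \<le> norm A * suminf lam"
    unfolding diag_trace_def suminf_mult[OF lam_summable, symmetric]
    by (rule norm_suminf_le[OF norm_diag_trace_term summable_mult[OF lam_summable]])
qed

text \<open>Exchanging the two sums is licensed by the bound \<open>norm B * lam k\<close>, uniform in the number of
  basis vectors, that Bessel's inequality provides.\<close>

lemma trace_compose_sums:
  assumes B: "complex_linear B" and e: "orthonormal_basis e"
  shows "(\<lambda>n. cinner (e n) (blinfun_apply (B o\<^sub>L G) (e n))) sums diag_trace B"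
proof -
  \<comment> \<open>The partial trace over the first \<open>N\<close> vectors of \<open>e\<close>,
    expanded over \<phi> with the sum over \<open>n\<close> moved inside; Parseval gives the limit
    of each term, and Tannery's theorem that of the series.\<close>
  define a where "a k N = of_real (lam k) * (\<Sum>n<N. cinner (\<phi> k) (e n) * cinner (e n) (blinfun_apply B (\<phi> k)))" for k N
  have o: "orthonormal_on A e" for A
    using e orthonormal_on_subset unfolding orthonormal_basis_def by blast
  have lim: "(\<lambda>N. a k N) \<longlonglongrightarrow> of_real (lam k) * cinner (\<phi> k) (blinfun_apply B (\<phi> k))" for k
    unfolding a_def using Parseval[OF e, of "\<phi> k" "blinfun_apply B (\<phi> k)"]
    by (intro tendsto_mult tendsto_const) (simp only: sums_def)
  have bound: "norm (a k N) \<le> norm B * lam k" for k N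
  proof -
    have "cmod (\<Sum>n<N. cinner (\<phi> k) (e n) * cinner (e n) (blinfun_apply B (\<phi> k)))
        \<le> (\<Sum>n<N. cmod (cinner (e n) (\<phi> k)) * cmod (cinner (e n) (blinfun_apply B (\<phi> k))))"
      by (rule sum_norm_le) (simp add: norm_mult cmod_cinner_commute[of "\<phi> k"])
    also have "\<dots> \<le> norm B"
      using Bessel_cinner_le[OF o o, of "{..<N}" "\<phi> k" "blinfun_apply B (\<phi> k)"] norm_apply_basis[of B k]
          norm_orthonormal_basis[OF basis, of k] by simp
    finally show ?thesis
      using mult_left_mono[OF _ lam_nonneg[of k]]
      by (simp add: a_def norm_mult lam_nonneg mult.commute[of "norm B"])
  qed
  have "((\<lambda>N. \<Sum>k. a k N) \<longlongrightarrow> (\<Sum>k. of_real (lam k) * cinner (\<phi> k) (blinfun_apply B (\<phi> k)))) sequentially"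
    using tannerys_theorem[of a "\<lambda>k. of_real (lam k) * cinner (\<phi> k) (blinfun_apply B (\<phi> k))" sequentially "\<lambda>k. norm B * lam k",
        OF lim always_eventually summable_mult[OF lam_summable]] bound by auto
  moreover have "(\<Sum>k. a k N) = (\<Sum>n<N. cinner (e n) (blinfun_apply (B o\<^sub>L G) (e n)))" for N
  proof -
    have "(\<lambda>k. \<Sum>n<N. of_real (lam k) * (cinner (\<phi> k) (e n) * cinner (e n) (blinfun_apply B (\<phi> k))))
        sums (\<Sum>n<N. cinner (e n) (blinfun_apply B (blinfun_apply G (e n))))"
      by (intro sums_sum cinner_compose_G_sums B)
    then show ?thesis unfolding a_def sum_distrib_left by (simp add: sums_iff)
  qed
  ultimately show ?thesis unfolding sums_def diag_trace_def by simp
qed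

text \<open>\<open>Abs_trace_class\<close> is meaningful only on complex-linear arguments; composing
  with the projection \<open>complex_part\<close> makes the map linear on all bounded operators, so
  that derivatives pass through it.\<close>

definition compose_tc :: "(L2 \<Rightarrow>\<^sub>L L2) \<Rightarrow> trace_class" where
  "compose_tc B = Abs_trace_class (complex_part B o\<^sub>L G)"

lemma Rep_compose_tc: "Rep_trace_class (compose_tc B) = complex_part B o\<^sub>L G"
  unfolding compose_tc_def
  by (rule Abs_trace_class_inverse) (simp add: trace_class_compose complex_linear_complex_part)

lemma bounded_linear_compose_tc: "bounded_linear compose_tc"
proof -
  obtain K where K: "\<And>B. norm (complex_part B) \<le> norm B * K"
    using bounded_linear.bounded[OF bounded_linear_complex_part] by blast
  have lin: "linear complex_part" by (rule bounded_linear.linear[OF bounded_linear_complex_part])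
  show ?thesis
  proof (rule bounded_linear_intro[where K="K * suminf lam"])
    fix A B :: "L2 \<Rightarrow>\<^sub>L L2" and r :: real
    show "compose_tc (A + B) = compose_tc A + compose_tc B"
      by (simp add: Rep_trace_class_inject[symmetric] plus_trace_class.rep_eq Rep_compose_tc
          linear_add[OF lin] bounded_bilinear.add_left[OF bounded_bilinear_blinfun_compose])
    show "compose_tc (r *\<^sub>R A) = r *\<^sub>R compose_tc A"
      by (simp add: Rep_trace_class_inject[symmetric] scaleR_trace_class.rep_eq Rep_compose_tc
          linear_scale[OF lin] bounded_bilinear.scaleR_left[OF bounded_bilinear_blinfun_compose])
    have "norm (compose_tc A) \<le> norm (complex_part A) * suminf lam"
      unfolding norm_trace_class.rep_eq Rep_compose_tc
      by (rule trace_class_compose(2)[OF complex_linear_complex_part])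
    also have "\<dots> \<le> norm A * K * suminf lam"
      by (intro mult_right_mono K suminf_nonneg lam_summable lam_nonneg)
    finally show "norm (compose_tc A) \<le> norm A * (K * suminf lam)" by (simp add: mult.assoc)
  qed
qed

lemma op_trace_compose_tc: "op_trace (compose_tc B) = diag_trace (complex_part B)"
  unfolding op_trace_def Rep_compose_tc
proof (rule the_equality)
  show "\<forall>e. orthonormal_basis e \<longrightarrow>
      (\<lambda>n. cinner (e n) (blinfun_apply (complex_part B o\<^sub>L G) (e n))) sums diag_trace (complex_part B)"
    using trace_compose_sums[OF complex_linear_complex_part] by blast
  fix t
  assume "\<forall>e. orthonormal_basis e \<longrightarrow>
      (\<lambda>n. cinner (e n) (blinfun_apply (complex_part B o\<^sub>L G) (e n))) sums t"
  \<comment> \<open>Uniqueness needs one orthonormal basis to exist, since otherwise every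
    \<open>t\<close> would qualify; \<phi> is such a basis.\<close>
  then have "(\<lambda>n. cinner (\<phi> n) (blinfun_apply (complex_part B o\<^sub>L G) (\<phi> n))) sums t"
    using basis by blast
  then show "t = diag_trace (complex_part B)"
    using trace_compose_sums[OF complex_linear_complex_part basis] by (rule sums_unique2)
qed

end

section \<open>The Dirichlet inverse\<close>

lemma integral_I01_const: "(LINT x|I01. c) = (c :: real)"
  by (simp add: measure_restrict_space)

lemma absolutely_continuous_on_cong:
  assumes "\<And>x. x \<in> {a..b} \<Longrightarrow> f x = g x"
  shows "absolutely_continuous_on a b f \<longleftrightarrow> absolutely_continuous_on a b g"
proof -
  have "(\<Sum>k\<in>d. norm (f (Sup k) - f (Inf k))) = (\<Sum>k\<in>d. norm (g (Sup k) - g (Inf k)))"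
    if d: "d division_of \<Union>d" "\<Union>d \<subseteq> {a..b}" for d
  proof (rule sum.cong)
    fix k assume k: "k \<in> d"
    obtain s t where st: "k = {s..t}" "k \<noteq> {}"
      using division_ofD(3,4)[OF d(1) k] by (metis box_real(2))
    then have "Sup k \<in> k" "Inf k \<in> k" by auto
    then have "Sup k \<in> {a..b}" "Inf k \<in> {a..b}" using d(2) k by blast+
    then show "norm (f (Sup k) - f (Inf k)) = norm (g (Sup k) - g (Inf k))" using assms by simp
  qed simp
  then show ?thesis unfolding absolutely_continuous_on_def by (metis (no_types, lifting))
qed

lemma absolutely_continuous_on_const_diff:
  "absolutely_continuous_on a b f \<Longrightarrow> absolutely_continuous_on a b (\<lambda>x. c - f x)"
proof -
  assume *: "absolutely_continuous_on a b f"
  have "norm ((c - y) - (c - z)) = norm (y - z)" for y z :: complex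
    by (simp add: norm_minus_commute)
  then show ?thesis using * unfolding absolutely_continuous_on_def by (simp only:)
qed

lemma square_integrable_continuous:
  assumes u: "continuous_on {0..1} u"
  shows "square_integrable u"
  unfolding square_integrable_def
proof
  show m [measurable]: "u \<in> borel_measurable I01"
    by (rule continuous_imp_measurable_on_sets_lebesgue[OF continuous_on_subset[OF u]]) auto
  interpret finite_measure I01 by (rule finite_measure_lebesgue_on) simp
  have "compact (u ` {0..1})" using u by (intro compact_continuous_image) auto
  then obtain B where B: "\<And>x. x \<in> {0..1} \<Longrightarrow> norm (u x) \<le> B"
    using compact_imp_bounded[of "u ` {0..1}"] unfolding bounded_iff by blast
  show "integrable I01 (\<lambda>x. (cmod (u x))\<^sup>2)"
  proof (rule integrable_const_bound[where B="B\<^sup>2"])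
    show "AE x in I01. norm ((cmod (u x))\<^sup>2) \<le> B\<^sup>2"
      using B by (intro AE_I2) (simp add: power_mono)
  qed measurable
qed

text \<open>The fundamental theorem of calculus writes \<open>u\<close> as a primitive of its
  continuous derivative. The sign change in the proof brings it into the form of
  \<open>absolutely_continuous_on_const_diff\<close>.\<close>

lemma absolutely_continuous_on_C1:
  fixes u :: "real \<Rightarrow> complex"
  assumes v: "continuous_on {0..1} v"
    and uv: "\<And>x. x \<in> {0..1} \<Longrightarrow> (u has_vector_derivative v x) (at x within {0..1})"
  shows "absolutely_continuous_on 0 1 u"
proof -
  have e: "u x = u 0 - integral {0..x} (\<lambda>x. - v x)" if x: "x \<in> {0..1}" for x
  proof -
    have "(v has_integral u x - u 0) {0..x}"
      using x uv by (intro fundamental_theorem_of_calculus)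
        (auto intro: has_vector_derivative_within_subset[of u _ _ "{0..1}"])
    then show ?thesis by (simp add: integral_unique)
  qed
  have "absolutely_continuous_on 0 1 (\<lambda>x. u 0 - integral {0..x} (\<lambda>x. - v x))"
    using v by (intro absolutely_continuous_on_const_diff absolutely_continuous_on_integral
        integrable_continuous_real continuous_intros)
  then show ?thesis using absolutely_continuous_on_cong[of 0 1 u, OF e] by blast
qed

lemma square_integrable_imp_integrable:
  assumes "square_integrable g"
  shows "integrable I01 g" "g integrable_on {0..1}" "(\<lambda>x. (cmod (g x))\<^sup>2) integrable_on {0..1}"
proof -
  have "square_integrable (\<lambda>x. 1)" by (rule square_integrable_continuous) simp
  from square_integrable_mult[OF this assms] show i: "integrable I01 g" by simp
  show "g integrable_on {0..1}" by (rule integrable_on_I01[OF i])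
  show "(\<lambda>x. (cmod (g x))\<^sup>2) integrable_on {0..1}"
    using assms by (intro integrable_on_I01) (simp add: square_integrable_def)
qed

lemma integral_norm_le_norm_L2:
  assumes g: "square_integrable g"
  shows "integral {0..1} (\<lambda>x. cmod (g x)) \<le> norm (class_L2 g)"
proof -
  have s1: "square_integrable (\<lambda>x. 1)" by (rule square_integrable_continuous) simp
  have sa: "square_integrable (\<lambda>x. complex_of_real (cmod (g x)))"
  proof -
    have [measurable]: "g \<in> borel_measurable I01" using g by (simp add: square_integrable_def)
    have "(\<lambda>x. complex_of_real (cmod (g x))) \<in> borel_measurable I01" by measurable
    then show ?thesis using g by (simp add: square_integrable_def)
  qed
  have n1: "norm (class_L2 (\<lambda>x. 1)) = 1"
  proof -
    have "(norm (class_L2 (\<lambda>x. 1)))\<^sup>2 = (LINT x|I01. (1::real))"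
      by (simp only: norm_class_L2[OF s1]) simp
    also have "\<dots> = 1" by (simp add: measure_restrict_space)
    finally show ?thesis by (simp add: power2_eq_1_iff) (metis norm_ge_zero less_minus_one_simps(1) not_less)
  qed
  have na: "norm (class_L2 (\<lambda>x. complex_of_real (cmod (g x)))) = norm (class_L2 g)"
  proof -
    have "(norm (class_L2 (\<lambda>x. complex_of_real (cmod (g x)))))\<^sup>2 = (norm (class_L2 g))\<^sup>2"
      by (simp only: norm_class_L2[OF sa] norm_class_L2[OF g]) simp
    then show ?thesis by (simp add: power2_eq_iff_nonneg)
  qed
  have ig: "integrable I01 (\<lambda>x. cmod (g x))" using square_integrable_imp_integrable(1)[OF g] by simp
  have "cinner (class_L2 (\<lambda>x. 1)) (class_L2 (\<lambda>x. complex_of_real (cmod (g x)))) = of_real (LINT x|I01. cmod (g x))"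
    by (simp add: cinner_class_L2[OF s1 sa])
  also have "(LINT x|I01. cmod (g x)) = integral {0..1} (\<lambda>x. cmod (g x))"
    by (rule integral_I01_eq[OF ig])
  finally show ?thesis
    using cinner_Cauchy_Schwarz[of "class_L2 (\<lambda>x. 1)" "class_L2 (\<lambda>x. complex_of_real (cmod (g x)))"]
    by (simp add: n1 na)
qed

text \<open>The derivative of the solution of \<open>- u'' = g\<close>: a constant minus the
  primitive of \<open>g\<close>. The constant is the mean of that primitive, which is exactly what
  makes \<open>u 1 = 0\<close>.\<close>

definition green_slope :: "(real \<Rightarrow> complex) \<Rightarrow> real \<Rightarrow> complex" where
  "green_slope g x = integral {0..1} (\<lambda>t. integral {0..t} g) - integral {0..x} g"

definition green :: "(real \<Rightarrow> complex) \<Rightarrow> real \<Rightarrow> complex" where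
  "green g x = integral {0..x} (green_slope g)"

lemma continuous_on_primitive:
  fixes g :: "real \<Rightarrow> complex"
  assumes "g integrable_on {0..1}"
  shows "continuous_on {0..1} (\<lambda>x. integral {0..x} g)"
  by (rule indefinite_integral_continuous_1[OF assms])

lemma continuous_on_green_slope:
  assumes "g integrable_on {0..1}"
  shows "continuous_on {0..1} (green_slope g)"
  unfolding green_slope_def by (intro continuous_intros continuous_on_primitive assms)

lemma continuous_on_green:
  assumes "g integrable_on {0..1}"
  shows "continuous_on {0..1} (green g)"
  unfolding green_def
  by (intro continuous_on_primitive integrable_continuous_real continuous_on_green_slope assms)

lemma green_0: "green g 0 = 0" by (simp add: green_def)

lemma green_1:
  assumes "g integrable_on {0..1}"
  shows "green g 1 = 0"
  unfolding green_def green_slope_def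
  by (subst Henstock_Kurzweil_Integration.integral_diff)
     (auto intro: integrable_continuous_real continuous_on_primitive assms)

lemma integral_cong_AE_I01:
  fixes g h :: "real \<Rightarrow> complex"
  assumes "AE x in I01. g x = h x" "x \<le> 1"
  shows "integral {0..x} g = integral {0..x} h"
proof -
  have "AE x in lebesgue. x \<in> {0<..<1} \<longrightarrow> g x = h x"
    using assms(1) by (simp add: AE_restrict_space_iff)
  then obtain N where N: "negligible N" "{x. \<not> (x \<in> {0<..<1} \<longrightarrow> g x = h x)} \<subseteq> N"
    by (auto simp: eventually_ae_filter_negligible)
  show ?thesis
  proof (rule integral_spike[of "N \<union> {0, 1}"])
    show "negligible (N \<union> {0, 1})" using N(1) by simp
    fix y assume "y \<in> {0..x} - (N \<union> {0, 1})"
    then have "y \<in> {0<..<1}" "y \<notin> N" using assms(2) by auto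
    then show "h y = g y" using N(2) by auto
  qed
qed

lemma green_cong:
  assumes "AE x in I01. g x = h x" "x \<in> {0..1}"
  shows "green g x = green h x"
proof -
  have s: "green_slope g t = green_slope h t" if "t \<in> {0..1}" for t
  proof -
    have "integral {0..1} (\<lambda>t. integral {0..t} g) = integral {0..1} (\<lambda>t. integral {0..t} h)"
      by (intro integral_cong integral_cong_AE_I01[OF assms(1)]) simp
    moreover have "integral {0..t} g = integral {0..t} h"
      using that by (intro integral_cong_AE_I01[OF assms(1)]) simp
    ultimately show ?thesis unfolding green_slope_def by simp
  qed
  show ?thesis unfolding green_def using assms(2) by (intro integral_cong s) auto
qed

text \<open>Existence. The slope is a primitive of a square integrable function, hence absolutely
  continuous, and Lebesgue differentiation gives its derivative almost everywhere.\<close>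

lemma dirichlet_laplacian_green:
  assumes g: "square_integrable g"
  shows "dirichlet_laplacian (class_L2 (green g)) (class_L2 g)"
  unfolding dirichlet_laplacian_def
proof (intro exI conjI ballI)
  note gi = square_integrable_imp_integrable[OF g]
  show "absolutely_continuous_on 0 1 (green g)"
    unfolding green_def
    by (intro absolutely_continuous_on_integral integrable_continuous_real continuous_intros
        continuous_on_green_slope gi)
  show "absolutely_continuous_on 0 1 (green_slope g)"
    unfolding green_slope_def
    by (intro absolutely_continuous_on_const_diff absolutely_continuous_on_integral gi)
  show "green g 0 = 0" "green g 1 = 0" using green_0 green_1[OF gi(2)] by auto
  show "(green g has_vector_derivative green_slope g x) (at x within {0..1})" if "x \<in> {0..1}" for x
    unfolding green_def[abs_def] using that
    by (intro integral_has_vector_derivative continuous_on_green_slope gi)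
  show "AE x in I01. (green_slope g has_vector_derivative - g x) (at x)"
    using AE_has_vector_derivative_integral[OF gi(2)]
  proof (rule eventually_mono)
    fix x assume "((\<lambda>t. integral {0..t} g) has_vector_derivative g x) (at x)"
    then have "((\<lambda>t. integral {0..1} (\<lambda>t. integral {0..t} g) - integral {0..t} g) has_vector_derivative 0 - g x) (at x)"
      by (intro has_vector_derivative_diff has_vector_derivative_const)
    then show "(green_slope g has_vector_derivative - g x) (at x)"
      by (simp add: green_slope_def[abs_def])
  qed
  show "square_integrable (\<lambda>x. - g x)" by (rule square_integrable_uminus[OF g])
  show "class_L2 g = - class_L2 (\<lambda>x. - g x)" by (simp add: class_L2_uminus[OF g, symmetric])
qed simp

text \<open>Uniqueness. An almost everywhere derivative alone would not determine \<open>v\<close>;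
  absolute continuity recovers it from \<open>w\<close> by integration, and the boundary values fix
  the remaining constants.\<close>

lemma dirichlet_laplacian_imp_green:
  assumes "dirichlet_laplacian f (class_L2 g)" and g: "square_integrable g"
  shows "f = class_L2 (green g)"
proof -
  obtain u v w where ac: "absolutely_continuous_on 0 1 v"
    and bc: "u 0 = 0" "u 1 = 0"
    and uv: "\<And>x. x \<in> {0..1} \<Longrightarrow> (u has_vector_derivative v x) (at x within {0..1})"
    and vw: "AE x in I01. (v has_vector_derivative w x) (at x)"
    and w: "square_integrable w" and f: "f = class_L2 u" and gw: "class_L2 g = - class_L2 w"
    using assms(1) unfolding dirichlet_laplacian_def by blast
  have AE: "AE x in I01. g x = - w x"
    using gw class_L2_eq_iff[OF g square_integrable_uminus[OF w]] by (simp add: class_L2_uminus[OF w])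
  have int_w: "integral {0..x} (\<lambda>x. - w x) = v 0 - v x" if x: "x \<in> {0..1}" for x
  proof -
    have "AE y in lebesgue_on {0<..<x}. (v has_vector_derivative w y) (at y)"
      using vw x by (auto simp: AE_restrict_space_iff elim!: eventually_mono)
    then have "(w has_integral v x - v 0) {0..x}"
      using x by (intro has_integral_absolutely_continuous absolutely_continuous_on_subset[OF ac]) auto
    then show ?thesis by (simp add: integral_unique)
  qed
  have int_v: "(v has_integral u x) {0..x}" if x: "x \<in> {0..1}" for x
  proof -
    have "(v has_integral u x - u 0) {0..x}"
      using x uv by (intro fundamental_theorem_of_calculus)
        (auto intro: has_vector_derivative_within_subset[of u _ _ "{0..1}"])
    then show ?thesis using bc by simp
  qed
  \<comment> \<open>Since \<open>u\<close> vanishes at both ends, \<open>v\<close> has mean zero, so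
    the constant in \<open>green_slope\<close> is \<open>v 0\<close>.\<close>
  have "integral {0..1} (\<lambda>t. integral {0..t} (\<lambda>x. - w x)) = integral {0..1} (\<lambda>t. v 0 - v t)"
    by (rule integral_cong) (rule int_w)
  also have "\<dots> = v 0"
    using int_v[of 1] bc by (subst Henstock_Kurzweil_Integration.integral_diff) (auto simp: integral_unique has_integral_integrable)
  finally have c: "integral {0..1} (\<lambda>t. integral {0..t} (\<lambda>x. - w x)) = v 0" .
  have slope: "green_slope (\<lambda>x. - w x) x = v x" if "x \<in> {0..1}" for x
    unfolding green_slope_def c using int_w[OF that] by simp
  have gu: "green g x = u x" if x: "x \<in> {0..1}" for x
  proof -
    have "green g x = green (\<lambda>x. - w x) x" by (rule green_cong[OF AE x])
    also have "\<dots> = integral {0..x} v"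
      unfolding green_def using x by (intro integral_cong slope) auto
    also have "\<dots> = u x" using int_v[OF x] by (rule integral_unique)
    finally show ?thesis .
  qed
  have "continuous_on {0..1} u"
    unfolding continuous_on_eq_continuous_within using has_vector_derivative_continuous[OF uv] by blast
  then have "square_integrable u" by (rule square_integrable_continuous)
  moreover have "square_integrable (green g)"
    by (intro square_integrable_continuous continuous_on_green square_integrable_imp_integrable g)
  moreover have "AE x in I01. u x = green g x" using gu by (intro AE_I2) simp
  ultimately show ?thesis unfolding f by (simp add: class_L2_eq_iff)
qed

lift_definition green_L2 :: "L2 \<Rightarrow> L2" is green
proof -
  fix g h assume "l2_rel g h"
  then have gh: "square_integrable g" "square_integrable h" "AE x in I01. g x = h x"
    by (auto simp: l2_rel_def)
  have "square_integrable (green g)" "square_integrable (green h)"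
    by (intro square_integrable_continuous continuous_on_green square_integrable_imp_integrable gh)+
  moreover have "AE x in I01. green g x = green h x"
    using green_cong[OF gh(3)] by (intro AE_I2) simp
  ultimately show "l2_rel (green g) (green h)" by (simp add: l2_rel_def)
qed

lemma green_L2_class: "square_integrable g \<Longrightarrow> green_L2 (class_L2 g) = class_L2 (green g)"
  by (simp add: green_L2.abs_eq)

lemma square_integrable_green: "square_integrable g \<Longrightarrow> square_integrable (green g)"
  by (rule square_integrable_continuous[OF continuous_on_green[OF square_integrable_imp_integrable(2)]])

lemma green_L2_graph: "green_L2 h = f \<longleftrightarrow> dirichlet_laplacian f h"
proof (cases rule: class_L2_cases[of h])
  case (1 g)
  then show ?thesis
    using dirichlet_laplacian_green dirichlet_laplacian_imp_green green_L2_class by auto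
qed

section \<open>The Green operator as a bounded linear map\<close>

lemma primitive_add:
  fixes g h :: "real \<Rightarrow> complex"
  assumes "g integrable_on {0..1}" "h integrable_on {0..1}" "x \<in> {0..1}"
  shows "integral {0..x} (\<lambda>t. g t + h t) = integral {0..x} g + integral {0..x} h"
proof (rule Henstock_Kurzweil_Integration.integral_add)
  have "{0..x} \<subseteq> {0..1}" using assms by auto
  then show "g integrable_on {0..x}" "h integrable_on {0..x}"
    using assms integrable_subinterval_real by blast+
qed

lemma green_add:
  assumes g: "g integrable_on {0..1}" and h: "h integrable_on {0..1}" and x: "x \<in> {0..1}"
  shows "green (\<lambda>t. g t + h t) x = green g x + green h x"
proof -
  have p: "(\<lambda>t. integral {0..t} f) integrable_on {0..1}" if "f integrable_on {0..1}" for f :: "real \<Rightarrow> complex"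
    by (intro integrable_continuous_real continuous_on_primitive that)
  have "integral {0..1} (\<lambda>t. integral {0..t} (\<lambda>t. g t + h t)) = integral {0..1} (\<lambda>t. integral {0..t} g + integral {0..t} h)"
    by (intro integral_cong primitive_add g h)
  also have "\<dots> = integral {0..1} (\<lambda>t. integral {0..t} g) + integral {0..1} (\<lambda>t. integral {0..t} h)"
    by (intro Henstock_Kurzweil_Integration.integral_add p g h)
  finally have s: "green_slope (\<lambda>t. g t + h t) t = green_slope g t + green_slope h t" if "t \<in> {0..1}" for t
    using primitive_add[OF g h that] by (simp add: green_slope_def)
  have "green (\<lambda>t. g t + h t) x = integral {0..x} (\<lambda>t. green_slope g t + green_slope h t)"
    unfolding green_def using x by (intro integral_cong s) auto
  also have "\<dots> = green g x + green h x"
    unfolding green_def by (intro primitive_add integrable_continuous_real continuous_on_green_slope g h x)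
  finally show ?thesis .
qed

lemma green_mult: "green (\<lambda>t. c * g t) x = c * green g x"
  by (simp add: green_def green_slope_def[abs_def] flip: right_diff_distrib)

lemma norm_green_le:
  assumes g: "square_integrable g" and x: "x \<in> {0..1}"
  shows "cmod (green g x) \<le> 2 * norm (class_L2 g)"
proof -
  define m where "m = norm (class_L2 g)"
  note gi = square_integrable_imp_integrable[OF g]
  have p: "cmod (integral {0..t} g) \<le> m" if t: "t \<in> {0..1}" for t
  proof -
    have sub: "{0..t} \<subseteq> {0..1}" using t by auto
    have n: "(\<lambda>x. cmod (g x)) integrable_on {0..1}"
      using gi(1) by (intro integrable_on_I01) simp
    have "cmod (integral {0..t} g) \<le> integral {0..t} (\<lambda>x. cmod (g x))"
      using integrable_subinterval_real[OF gi(2) sub] integrable_subinterval_real[OF n sub]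
      by (intro integral_norm_bound_integral) auto
    also have "\<dots> \<le> integral {0..1} (\<lambda>x. cmod (g x))"
      using integrable_subinterval_real[OF n sub] n sub by (intro integral_subset_le) auto
    also have "\<dots> \<le> m" unfolding m_def by (rule integral_norm_le_norm_L2[OF g])
    finally show ?thesis .
  qed
  have b: "cmod (integral {0..t} f) \<le> B" if "continuous_on {0..1} f" "\<And>s. s \<in> {0..1} \<Longrightarrow> cmod (f s) \<le> B" "t \<in> {0..1}" "B \<ge> 0"
    for f :: "real \<Rightarrow> complex" and B t
  proof -
    have "cmod (integral {0..t} f) \<le> B * (t - 0)"
      using that by (intro integral_bound continuous_on_subset[OF that(1)]) auto
    also have "\<dots> \<le> B * 1" using that by (intro mult_left_mono) auto
    finally show ?thesis by simp
  qed
  have "m \<ge> 0" by (simp add: m_def)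
  have "cmod (integral {0..1} (\<lambda>t. integral {0..t} g)) \<le> m"
    using \<open>m \<ge> 0\<close> by (intro b continuous_on_primitive gi p) auto
  then have s: "cmod (green_slope g t) \<le> 2 * m" if "t \<in> {0..1}" for t
    unfolding green_slope_def using p[OF that] norm_triangle_ineq4[of "integral {0..1} (\<lambda>t. integral {0..t} g)" "integral {0..t} g"]
    by linarith
  show ?thesis
    unfolding green_def m_def[symmetric] using \<open>m \<ge> 0\<close> by (intro b continuous_on_green_slope gi s x) auto
qed

lemma bounded_linear_green_L2: "bounded_linear green_L2"
proof (rule bounded_linear_intro[where K=2])
  fix f g :: L2 and r :: real
  obtain f' where f: "square_integrable f'" "f = class_L2 f'" by (rule class_L2_cases)
  obtain g' where g: "square_integrable g'" "g = class_L2 g'" by (rule class_L2_cases)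
  show "green_L2 (f + g) = green_L2 f + green_L2 g"
  proof -
    have "class_L2 (green (\<lambda>x. f' x + g' x)) = class_L2 (\<lambda>x. green f' x + green g' x)"
      using f g green_add[OF square_integrable_imp_integrable(2) square_integrable_imp_integrable(2)]
      by (subst class_L2_eq_iff) (auto intro!: square_integrable_green square_integrable_add)
    then show ?thesis
      using f g by (simp add: class_L2_add green_L2_class square_integrable_add square_integrable_green)
  qed
  show "green_L2 (r *\<^sub>R f) = r *\<^sub>R green_L2 f"
    using f by (simp add: scaleR_L2_def class_L2_scaleC green_L2_class square_integrable_scale
        square_integrable_green green_mult[abs_def])
  have "(norm (green_L2 f))\<^sup>2 \<le> (norm f * 2)\<^sup>2"
  proof -
    interpret finite_measure I01 by (rule finite_measure_lebesgue_on) simp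
    have "(norm (green_L2 f))\<^sup>2 = (LINT x|I01. (cmod (green f' x))\<^sup>2)"
      using f by (simp add: green_L2_class norm_class_L2 square_integrable_green)
    also have "\<dots> \<le> (LINT x|I01. (norm f * 2)\<^sup>2)"
    proof (rule integral_mono_AE)
      show "integrable I01 (\<lambda>x. (cmod (green f' x))\<^sup>2)"
        using square_integrable_green[OF f(1)] by (simp add: square_integrable_def)
      show "AE x in I01. (cmod (green f' x))\<^sup>2 \<le> (norm f * 2)\<^sup>2"
        using norm_green_le[OF f(1)] f(2) by (intro AE_I2 power_mono) (auto simp: mult.commute)
    qed simp
    also have "\<dots> = (norm f * 2)\<^sup>2" by (rule integral_I01_const)
    finally show ?thesis .
  qed
  then show "norm (green_L2 f) \<le> norm f * 2" by (rule power2_le_imp_le) simp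
qed

text \<open>The defining equivalence prescribes the whole graph, so it determines the operator
  pointwise, and \<open>green_L2_graph\<close> says that the Green operator has this graph.\<close>

theorem dirichlet_inverse_apply: "blinfun_apply dirichlet_inverse = green_L2"
proof -
  have "dirichlet_inverse = Blinfun green_L2"
    unfolding dirichlet_inverse_def
  proof (rule the_equality)
    show "\<forall>f g. blinfun_apply (Blinfun green_L2) g = f \<longleftrightarrow> dirichlet_laplacian f g"
      by (simp add: bounded_linear_Blinfun_apply bounded_linear_green_L2 green_L2_graph)
    fix G assume G: "\<forall>f g. blinfun_apply G g = f \<longleftrightarrow> dirichlet_laplacian f g"
    show "G = Blinfun green_L2"
    proof (rule blinfun_eqI)
      fix g
      have "dirichlet_laplacian (blinfun_apply G g) g" using G by blast
      then show "blinfun_apply G g = blinfun_apply (Blinfun green_L2) g"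
        by (simp add: bounded_linear_Blinfun_apply bounded_linear_green_L2 green_L2_graph[symmetric])
    qed
  qed
  then have "blinfun_apply dirichlet_inverse = blinfun_apply (Blinfun green_L2)" by (rule arg_cong)
  also have "\<dots> = green_L2" by (rule bounded_linear_Blinfun_apply[OF bounded_linear_green_L2])
  finally show ?thesis .
qed

lemma complex_linear_dirichlet_inverse: "complex_linear dirichlet_inverse"
  unfolding complex_linear_def dirichlet_inverse_apply
proof (intro allI)
  fix c f
  obtain f' where f: "square_integrable f'" "f = class_L2 f'" by (rule class_L2_cases)
  then show "green_L2 (scaleC c f) = scaleC c (green_L2 f)"
    by (simp add: class_L2_scaleC green_L2_class square_integrable_scale
        square_integrable_green green_mult[abs_def])
qed

section \<open>The sine eigenbasis of the Dirichlet Laplacian\<close>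

definition sine :: "nat \<Rightarrow> real \<Rightarrow> complex" where
  "sine k x = of_real (sqrt 2 * sin (real (Suc k) * pi * x))"

definition sine_basis :: "nat \<Rightarrow> L2" where
  "sine_basis k = class_L2 (sine k)"

text \<open>The shift to \<open>Suc k\<close> gives index 0 the lowest eigenvalue and excludes a
  zero mode.\<close>

definition dirichlet_eigenvalue :: "nat \<Rightarrow> real" where
  "dirichlet_eigenvalue k = (real (Suc k) * pi)\<^sup>2"

lemma square_integrable_sine: "square_integrable (sine k)"
  by (rule square_integrable_continuous) (auto simp: sine_def[abs_def] intro!: continuous_intros)

lemma dirichlet_laplacian_sine:
  "dirichlet_laplacian (sine_basis k) (dirichlet_eigenvalue k *\<^sub>R sine_basis k)"
proof -
  define m where "m = real (Suc k) * pi"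
  define v where "v x = complex_of_real (sqrt 2 * (m * cos (m * x)))" for x
  define w where "w x = complex_of_real (- (m\<^sup>2) * (sqrt 2 * sin (m * x)))" for x
  have sm: "sine k = (\<lambda>x. of_real (sqrt 2 * sin (m * x)))" by (rule ext) (simp add: sine_def m_def)
  have uv: "(sine k has_vector_derivative v x) (at x within S)" for x S
    unfolding sm v_def
    by (rule has_vector_derivative_of_real) (auto intro!: derivative_eq_intros)
  have vw: "(v has_vector_derivative w x) (at x within S)" for x S
    unfolding v_def[abs_def] w_def
    by (rule has_vector_derivative_of_real) (auto intro!: derivative_eq_intros simp: power2_eq_square)
  have cv: "continuous_on {0..1} v" unfolding v_def by (intro continuous_intros)
  have cw: "continuous_on {0..1} w" unfolding w_def by (intro continuous_intros)
  have "dirichlet_laplacian (class_L2 (sine k)) (- class_L2 w)"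
    unfolding dirichlet_laplacian_def
  proof (intro exI conjI ballI)
    show "absolutely_continuous_on 0 1 (sine k)" by (rule absolutely_continuous_on_C1[OF cv uv])
    show "absolutely_continuous_on 0 1 v" by (rule absolutely_continuous_on_C1[OF cw vw])
    show "sine k 0 = 0" by (simp add: sine_def)
    show "sine k 1 = 0" unfolding sine_def using sin_npi[of "Suc k"] by simp
    show "(sine k has_vector_derivative v x) (at x within {0..1})" for x by (rule uv)
    show "AE x in I01. (v has_vector_derivative w x) (at x)" by (intro AE_I2 vw)
    show "square_integrable w" by (rule square_integrable_continuous[OF cw])
  qed simp_all
  moreover have "- class_L2 w = dirichlet_eigenvalue k *\<^sub>R sine_basis k"
  proof -
    have "w = (\<lambda>x. of_real (- dirichlet_eigenvalue k) * sine k x)"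
      by (simp add: w_def[abs_def] sm dirichlet_eigenvalue_def m_def)
    then have "class_L2 w = scaleC (of_real (- dirichlet_eigenvalue k)) (sine_basis k)"
      by (simp add: sine_basis_def class_L2_scaleC square_integrable_sine)
    also have "\<dots> = (- dirichlet_eigenvalue k) *\<^sub>R sine_basis k" by (simp only: scaleR_L2_def)
    finally show ?thesis by simp
  qed
  ultimately show ?thesis by (simp add: sine_basis_def)
qed

lemma dirichlet_eigenvalue_pos: "dirichlet_eigenvalue k > 0"
  by (simp add: dirichlet_eigenvalue_def)

lemma dirichlet_inverse_sine:
  "blinfun_apply dirichlet_inverse (sine_basis k) = (1 / dirichlet_eigenvalue k) *\<^sub>R sine_basis k"
proof -
  have "blinfun_apply dirichlet_inverse (dirichlet_eigenvalue k *\<^sub>R sine_basis k) = sine_basis k"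
    using dirichlet_laplacian_sine green_L2_graph by (simp add: dirichlet_inverse_apply)
  then show ?thesis
    using dirichlet_eigenvalue_pos[of k]
    by (metis blinfun.scaleR_right divide_inverse_commute inverse_eq_divide less_irrefl
        mult.right_neutral scaleR_left_imp_eq scaleR_one scaleR_scaleR right_inverse)
qed

lemma integral_cos_int_zero:
  assumes "j \<noteq> (0::int)"
  shows "(LINT x|I01. cos (of_int j * pi * x)) = 0"
proof -
  have i: "integrable I01 (\<lambda>x. cos (of_int j * pi * x))"
  proof -
    interpret finite_measure I01 by (rule finite_measure_lebesgue_on) simp
    show ?thesis
      by (rule integrable_const_bound[where B=1])
         (auto intro!: borel_measurable_I01 continuous_intros)
  qed
  define c where "c = of_int j * pi"
  have c: "c \<noteq> 0" using assms by (simp add: c_def)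
  have "((\<lambda>x. cos (c * x)) has_integral (sin (c * 1) / c - sin (c * 0) / c)) {0..1}"
    using c by (intro fundamental_theorem_of_calculus)
      (auto simp flip: has_real_derivative_iff_has_vector_derivative intro!: derivative_eq_intros)
  moreover have "sin c = 0" unfolding c_def by (metis mult.commute sin_zero_iff_int2)
  ultimately have "((\<lambda>x. cos (c * x)) has_integral 0) {0..1}" by simp
  then show ?thesis by (simp only: integral_I01_eq[OF i] c_def integral_unique)
qed

lemma orthonormal_sine: "orthonormal_on UNIV sine_basis"
  unfolding orthonormal_on_def
proof (intro ballI)
  fix i j
  have i: "integrable I01 (\<lambda>x. cos (c * x))" for c :: real
  proof -
    interpret finite_measure I01 by (rule finite_measure_lebesgue_on) simp
    show ?thesis
      by (rule integrable_const_bound[where B=1])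
         (auto intro!: borel_measurable_I01 continuous_intros)
  qed
  have "cinner (sine_basis i) (sine_basis j) = (LINT x|I01. cnj (sine i x) * sine j x)"
    unfolding sine_basis_def by (rule cinner_class_L2[OF square_integrable_sine square_integrable_sine])
  also have "\<dots> = (LINT x|I01. of_real (cos (of_int (int i - int j) * pi * x) - cos (of_int (int i + int j + 2) * pi * x)))"
  proof (rule Bochner_Integration.integral_cong[OF refl])
    fix x
    have "(of_int (int i - int j) * pi * x) = real (Suc i) * pi * x - real (Suc j) * pi * x"
        "of_int (int i + int j + 2) * pi * x = real (Suc i) * pi * x + real (Suc j) * pi * x"
      by (simp_all add: algebra_simps)
    then have "cos (of_int (int i - int j) * pi * x) - cos (of_int (int i + int j + 2) * pi * x)
        = 2 * (sin (real (Suc i) * pi * x) * sin (real (Suc j) * pi * x))"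
      by (simp only: cos_diff cos_add)
    also have "\<dots> = (sqrt 2 * sin (real (Suc i) * pi * x)) * (sqrt 2 * sin (real (Suc j) * pi * x))"
      by simp
    finally show "cnj (sine i x) * sine j x = of_real (cos (of_int (int i - int j) * pi * x) - cos (of_int (int i + int j + 2) * pi * x))"
      unfolding sine_def by (simp only: complex_cnj_mult complex_cnj_complex_of_real of_real_mult)
  qed
  also have "\<dots> = of_real ((LINT x|I01. cos (of_int (int i - int j) * pi * x)) - (LINT x|I01. cos (of_int (int i + int j + 2) * pi * x)))"
    by (simp only: integral_complex_of_real Bochner_Integration.integral_diff[OF i i])
  also have "(LINT x|I01. cos (of_int (int i + int j + 2) * pi * x)) = 0"
    by (rule integral_cos_int_zero) linarith
  also have "(LINT x|I01. cos (of_int (int i - int j) * pi * x)) = (if i = j then 1 else 0)"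
    using integral_cos_int_zero[of "int i - int j"] by (simp add: measure_restrict_space)
  finally show "cinner (sine_basis i) (sine_basis j) = (if i = j then 1 else 0)" by simp
qed

theorem orthonormal_basis_sine: "orthonormal_basis sine_basis"
  unfolding orthonormal_basis_def
proof (intro conjI allI impI orthonormal_sine)
  fix f assume 0: "\<forall>n. cinner (sine_basis n) f = 0"
  obtain g where g: "square_integrable g" "f = class_L2 g" by (rule class_L2_cases)
  have z: "(LINT x|I01. g x * of_real (sin (real k * pi * x))) = 0" for k
  proof (cases k)
    case (Suc n)
    have "0 = (LINT x|I01. cnj (sine n x) * g x)"
      using 0 g(2) cinner_class_L2[OF square_integrable_sine g(1)] by (simp add: sine_basis_def)
    also have "\<dots> = (LINT x|I01. of_real (sqrt 2) * (g x * of_real (sin (real k * pi * x))))"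
      unfolding sine_def Suc by (simp add: mult_ac)
    also have "\<dots> = of_real (sqrt 2) * (LINT x|I01. g x * of_real (sin (real k * pi * x)))"
      by (rule integral_mult_right_zero)
    finally show ?thesis by simp
  qed simp
  have "AE x in I01. g x = 0"
    by (rule sin_coefficients_zero_imp_zero[OF square_integrable_imp_integrable(1)[OF g(1)] z])
  then show "f = 0"
    using class_L2_eq_iff[OF g(1) square_integrable_zero] by (simp add: g(2) zero_L2_def)
qed

section \<open>Moments and even functions\<close>

text \<open>Taylor coefficients in \<open>\<zeta>\<close> of \<open>1 / (1 + l (\<zeta>\<^sup>2 + a \<zeta>))\<close>.\<close>

fun resolvent_coeff :: "real \<Rightarrow> real \<Rightarrow> nat \<Rightarrow> real" where
  "resolvent_coeff a l 0 = 1"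
| "resolvent_coeff a l (Suc 0) = - (a * l)"
| "resolvent_coeff a l (Suc (Suc n)) = - (a * l * resolvent_coeff a l (Suc n)) - l * resolvent_coeff a l n"

text \<open>A crude geometric bound, uniform in \<open>l\<close>, that follows from the recursion
  because \<open>\<bar>a\<bar> + 1 \<ge> 1\<close>. It serves to make the weighted series over all
  \<open>l k\<close> absolutely summable.\<close>

lemma abs_resolvent_coeff_le:
  assumes l: "0 \<le> l" "l \<le> 1"
  shows "\<bar>resolvent_coeff a l n\<bar> \<le> (\<bar>a\<bar> + 1) ^ n"
proof (induction n rule: induct_nat_012)
  case 0
  show ?case by simp
next
  case 1
  have "\<bar>a\<bar> * l \<le> \<bar>a\<bar> * 1" using l by (intro mult_left_mono) auto
  then show ?case using l by (simp add: abs_mult)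
next
  case (ge2 n)
  define A where "A = \<bar>a\<bar> + 1"
  have le: "\<bar>a * l * resolvent_coeff a l (Suc n)\<bar> \<le> \<bar>a\<bar> * A ^ Suc n" "\<bar>l * resolvent_coeff a l n\<bar> \<le> A ^ n"
  proof -
    have "\<bar>a\<bar> * l * \<bar>resolvent_coeff a l (Suc n)\<bar> \<le> \<bar>a\<bar> * 1 * A ^ Suc n"
      using l ge2(2) unfolding A_def by (intro mult_mono) auto
    then show "\<bar>a * l * resolvent_coeff a l (Suc n)\<bar> \<le> \<bar>a\<bar> * A ^ Suc n" using l by (simp add: abs_mult)
    have "l * \<bar>resolvent_coeff a l n\<bar> \<le> 1 * A ^ n"
      using l ge2(1) unfolding A_def by (intro mult_mono) auto
    then show "\<bar>l * resolvent_coeff a l n\<bar> \<le> A ^ n" using l by (simp add: abs_mult)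
  qed
  have "\<bar>resolvent_coeff a l (Suc (Suc n))\<bar> \<le> \<bar>a\<bar> * A ^ Suc n + A ^ n"
    using le by simp
  also have "A ^ n \<le> A ^ Suc n" by (rule power_increasing) (simp_all add: A_def)
  also have "\<bar>a\<bar> * A ^ Suc n + A ^ Suc n = A ^ Suc (Suc n)" by (simp add: A_def algebra_simps)
  finally show ?case by (simp add: A_def)
qed

text \<open>The recursion for the coefficients gives \<open>a T\<^sub>0 = 0\<close> and \<open>a T\<^sub>n\<^sub>+\<^sub>1 + T\<^sub>n = 0\<close> for the sums \<open>T\<^sub>n\<close> in
  the conclusion; both for \<open>a = 0\<close> and for \<open>a \<noteq> 0\<close> all \<open>T\<^sub>n\<close> vanish.\<close>

lemma resolvent_coeff_sums_shift:
  fixes e :: "nat \<Rightarrow> complex"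
  assumes e: "summable (\<lambda>k. cmod (e k))" and l: "\<And>k. 0 \<le> l k" "\<And>k. l k \<le> 1"
    and 0: "\<And>n. (\<Sum>k. e k * of_real (resolvent_coeff a (l k) n)) = 0"
  shows "(\<Sum>k. e k * of_real (l k) * of_real (resolvent_coeff a (l k) n)) = 0"
proof -
  define T where "T n = (\<Sum>k. e k * of_real (l k) * of_real (resolvent_coeff a (l k) n))" for n
  have s: "summable (\<lambda>k. e k * of_real (l k) * of_real (resolvent_coeff a (l k) n))" for n
  proof (rule summable_norm_cancel, rule summable_comparison_test'[of _ 0])
    show "summable (\<lambda>k. cmod (e k) * (\<bar>a\<bar> + 1) ^ n)" by (rule summable_mult2[OF e])
    fix k
    have "cmod (e k) * l k * \<bar>resolvent_coeff a (l k) n\<bar> \<le> cmod (e k) * 1 * (\<bar>a\<bar> + 1) ^ n"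
      using l by (intro mult_mono abs_resolvent_coeff_le) auto
    then show "norm (cmod (e k * of_real (l k) * of_real (resolvent_coeff a (l k) n))) \<le> cmod (e k) * (\<bar>a\<bar> + 1) ^ n"
      using l by (simp add: norm_mult)
  qed
  have "of_real a * T 0 = 0"
  proof -
    have "of_real a * T 0 = (\<Sum>k. of_real a * (e k * of_real (l k) * of_real (resolvent_coeff a (l k) 0)))"
      unfolding T_def by (rule suminf_mult[OF s, symmetric])
    also have "\<dots> = (\<Sum>k. - (e k * of_real (resolvent_coeff a (l k) 1)))"
      by (simp add: mult_ac)
    also have "\<dots> = 0"
    proof -
      have "summable (\<lambda>k. of_real a * (e k * of_real (l k) * of_real (resolvent_coeff a (l k) 0)))"
        by (rule summable_mult[OF s])
      then have "summable (\<lambda>k. - (e k * of_real (resolvent_coeff a (l k) 1)))" by (simp add: mult_ac)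
      then have "summable (\<lambda>k. e k * of_real (resolvent_coeff a (l k) 1))" by (simp only: summable_minus_iff)
      from suminf_minus[OF this] 0[of 1] show ?thesis by simp
    qed
    finally show ?thesis .
  qed
  moreover have step: "of_real a * T (Suc n) + T n = 0" for n
  proof -
    have sn: "summable (\<lambda>k. of_real a * (e k * of_real (l k) * of_real (resolvent_coeff a (l k) (Suc n)))
        + e k * of_real (l k) * of_real (resolvent_coeff a (l k) n))"
      by (intro summable_add summable_mult s)
    have "of_real a * T (Suc n) + T n
        = (\<Sum>k. of_real a * (e k * of_real (l k) * of_real (resolvent_coeff a (l k) (Suc n)))
        + e k * of_real (l k) * of_real (resolvent_coeff a (l k) n))"
      unfolding T_def suminf_mult[OF s, symmetric] by (rule suminf_add[OF summable_mult[OF s] s])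
    also have eq: "(\<lambda>k. of_real a * (e k * of_real (l k) * of_real (resolvent_coeff a (l k) (Suc n)))
        + e k * of_real (l k) * of_real (resolvent_coeff a (l k) n))
        = (\<lambda>k. - (e k * of_real (resolvent_coeff a (l k) (Suc (Suc n)))))"
      by (rule ext) (simp add: algebra_simps)
    also have "(\<Sum>k. - (e k * of_real (resolvent_coeff a (l k) (Suc (Suc n))))) = 0"
    proof -
      have "summable (\<lambda>k. e k * of_real (resolvent_coeff a (l k) (Suc (Suc n))))"
        using sn unfolding eq by (simp only: summable_minus_iff)
      from suminf_minus[OF this] 0[of "Suc (Suc n)"] show ?thesis by simp
    qed
    finally show ?thesis .
  qed
  ultimately have "T n = 0" for n
  proof (cases "a = 0")
    case True
    then show ?thesis using step[of n] by simp
  next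
    case False
    show ?thesis
    proof (induction n)
      case 0
      then show ?case using False \<open>of_real a * T 0 = 0\<close> by simp
    next
      case (Suc n)
      then show ?case using step[of n] False by simp
    qed
  qed
  then show ?thesis by (simp add: T_def)
qed

text \<open>One shift multiplies the weights by \<open>l k\<close> and preserves the hypothesis for
  every \<open>n\<close>. After \<open>m\<close> shifts the coefficient at \<open>n = 0\<close>,
  which is 1, exposes the \<open>m\<close>-th moment; hence the induction over arbitrary
  weights.\<close>

lemma resolvent_coeff_sums_imp_moments:
  fixes e :: "nat \<Rightarrow> complex"
  assumes "summable (\<lambda>k. cmod (e k))" and l: "\<And>k. 0 \<le> l k" "\<And>k. l k \<le> 1"
    and "\<And>n. (\<Sum>k. e k * of_real (resolvent_coeff a (l k) n)) = 0"
  shows "(\<Sum>k. e k * of_real (l k) ^ m) = 0"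
  using assms(1,4)
proof (induction m arbitrary: e)
  case 0
  then show ?case using "0.prems"(2)[of 0] by simp
next
  case (Suc m)
  have "(\<Sum>k. (e k * of_real (l k)) * of_real (l k) ^ m) = 0"
  proof (rule Suc.IH)
    show "summable (\<lambda>k. cmod (e k * of_real (l k)))"
    proof (rule summable_comparison_test'[OF Suc.prems(1), of 0])
      fix k show "norm (cmod (e k * of_real (l k))) \<le> cmod (e k)"
        using l[of k] by (simp add: norm_mult mult_left_le)
    qed
  qed (rule resolvent_coeff_sums_shift[OF Suc.prems(1) l Suc.prems(2)])
  then show ?case by (simp add: mult_ac)
qed

text \<open>After division by the \<open>m\<close>-th power of the largest \<open>l k\<close> with \<open>e k \<noteq> 0\<close> only the term of that
  index survives as \<open>m \<rightarrow> \<infinity>\<close>.\<close>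

lemma moments_zero_imp_zero:
  fixes e :: "nat \<Rightarrow> complex"
  assumes e: "summable (\<lambda>k. cmod (e k))" and l: "\<And>k. 0 < l k" "\<And>i j. i < j \<Longrightarrow> l j < l i"
    and 0: "\<And>m::nat. (\<Sum>k. e k * of_real (l k) ^ m) = 0"
  shows "e k = 0"
proof (induction k rule: less_induct)
  case (less k)
  define q where "q i = l (i + k) / l k" for i
  have q: "q 0 = 1" "\<And>i. 0 \<le> q i" "\<And>i. q i \<le> 1" "\<And>i. i > 0 \<Longrightarrow> q i < 1"
  proof -
    show "q 0 = 1" using l(1)[of k] by (simp add: q_def)
    show "0 \<le> q i" for i using l(1)[of k] l(1)[of "i + k"] by (simp add: q_def)
    show lt: "q i < 1" if "i > 0" for i using l(2)[of k "i + k"] l(1)[of k] that by (simp add: q_def)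
    show "q i \<le> 1" for i using lt[of i] \<open>q 0 = 1\<close> by (cases "i = 0") auto
  qed
  \<comment> \<open>The weights before \<open>k\<close> vanish by induction, so the series may start
    at \<open>k\<close>, where the node is largest, and be divided by
    \<open>l k ^ m\<close>.\<close>
  have z: "(\<Sum>i. e (i + k) * of_real (q i) ^ m) = 0" for m
  proof -
    have ls: "l i \<le> l 0" for i using l(2)[of 0 i] by (cases "i = 0") auto
    have s: "summable (\<lambda>i. e i * of_real (l i) ^ m)"
    proof (rule summable_norm_cancel, rule summable_comparison_test'[of _ 0])
      show "summable (\<lambda>i. cmod (e i) * l 0 ^ m)" by (rule summable_mult2[OF e])
      fix i
      have "cmod (e i) * l i ^ m \<le> cmod (e i) * l 0 ^ m"
        using l(1)[of i] ls[of i] by (intro mult_left_mono power_mono) auto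
      then show "norm (cmod (e i * of_real (l i) ^ m)) \<le> cmod (e i) * l 0 ^ m"
        using l(1)[of i] by (simp add: norm_mult norm_power)
    qed
    have "(\<Sum>i. e (i + k) * of_real (l (i + k)) ^ m) = (\<Sum>i. e i * of_real (l i) ^ m) - (\<Sum>i<k. e i * of_real (l i) ^ m)"
      by (rule suminf_minus_initial_segment[OF s])
    also have "\<dots> = 0" using 0[of m] less.IH by simp
    finally have "(\<Sum>i. e (i + k) * of_real (l (i + k)) ^ m) / of_real (l k) ^ m = 0" by simp
    also have "(\<Sum>i. e (i + k) * of_real (l (i + k)) ^ m) / of_real (l k) ^ m
        = (\<Sum>i. e (i + k) * of_real (l (i + k)) ^ m / of_real (l k) ^ m)"
      by (rule suminf_divide[symmetric]) (rule summable_ignore_initial_segment[OF s])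
    also have "\<dots> = (\<Sum>i. e (i + k) * of_real (q i) ^ m)"
      by (simp add: q_def power_divide)
    finally show ?thesis .
  qed
  have bound: "norm (e (i + k) * of_real (q i) ^ m) \<le> cmod (e (i + k))" for i m
    using q(2,3)[of i] by (simp add: norm_mult norm_power mult_left_le power_le_one)
  have lim: "(\<lambda>m. e (i + k) * of_real (q i) ^ m) \<longlonglongrightarrow> (if i = 0 then e k else 0)" for i
  proof (cases "i = 0")
    case False
    then have "norm (complex_of_real (q i)) < 1" using q(2,4)[of i] by simp
    then have "(\<lambda>m. e (i + k) * of_real (q i) ^ m) \<longlonglongrightarrow> e (i + k) * 0"
      by (intro tendsto_mult tendsto_const LIMSEQ_power_zero)
    then show ?thesis using False by simp
  qed (simp add: q)
  have "(\<lambda>m. \<Sum>i. e (i + k) * of_real (q i) ^ m) \<longlonglongrightarrow> (\<Sum>i. if i = 0 then e k else 0)"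
    using tannerys_theorem[of "\<lambda>i m. e (i + k) * of_real (q i) ^ m" "\<lambda>i. if i = 0 then e k else 0" sequentially "\<lambda>i. cmod (e (i + k))",
        OF lim always_eventually summable_ignore_initial_segment[OF e]] bound by auto
  moreover have "(\<Sum>i::nat. if i = 0 then e k else 0) = e k"
    using sums_single[of 0 "\<lambda>i. e k"] by (simp add: sums_iff)
  ultimately show ?case unfolding z by (simp add: LIMSEQ_const_iff)
qed

section \<open>Even functions and their cosine coefficients\<close>

lemma integral_I01_odd:
  fixes f :: "real \<Rightarrow> real"
  assumes f: "integrable I01 f" and odd: "AE x in I01. f (1 - x) = - f x"
  shows "(LINT x|I01. f x) = 0"
proof -
  have hf: "(f has_integral (LINT x|I01. f x)) {0..1}"
    using integrable_on_I01[OF f] integral_I01_eq[OF f] by (simp add: has_integral_integral)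
  then have "(f has_integral (LINT x|I01. f x)) (cbox 0 1)" by simp
  from has_integral_affinity[OF this, of "-1" 1]
  have "((\<lambda>x. f (1 - x)) has_integral (LINT x|I01. f x)) ((\<lambda>x. 1 - x) ` {0..1})"
    by simp
  moreover have "(\<lambda>x. 1 - x) ` {0..1::real} = {0..1}"
    by (auto intro: image_eqI[of _ _ "1 - _"])
  ultimately have r: "((\<lambda>x. f (1 - x)) has_integral (LINT x|I01. f x)) {0..1}" by simp
  have "AE x in lebesgue. x \<in> {0<..<1} \<longrightarrow> f (1 - x) = - f x"
    using odd by (simp add: AE_restrict_space_iff)
  then obtain N where N: "negligible N" "{x. \<not> (x \<in> {0<..<1} \<longrightarrow> f (1 - x) = - f x)} \<subseteq> N"
    by (auto simp: eventually_ae_filter_negligible)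
  have "((\<lambda>x. - f x) has_integral (LINT x|I01. f x)) {0..1}"
  proof (rule has_integral_spike[OF _ _ r])
    show "negligible (N \<union> {0, 1})" using N(1) by simp
    fix x :: real assume "x \<in> {0..1} - (N \<union> {0, 1})"
    then have "x \<in> {0<..<1}" "x \<notin> N" by auto
    then show "- f x = f (1 - x)" using N(2) by auto
  qed
  moreover have "((\<lambda>x. - f x) has_integral - (LINT x|I01. f x)) {0..1}"
    using hf by (rule has_integral_neg)
  ultimately have "(LINT x|I01. f x) = - (LINT x|I01. f x)" by (rule has_integral_unique)
  then show ?thesis by simp
qed

text \<open>Evenness kills the odd cosine coefficients, the hypothesis says that the even ones all agree, and
  multiplication by \<open>1 - cos (2 \<pi> x)\<close> then kills these as well.\<close>

lemma even_equal_cos_coefficients_imp_zero: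
  fixes f :: "real \<Rightarrow> real"
  assumes f: "integrable I01 f" and even: "AE x in I01. f x = f (1 - x)"
    and 0: "\<And>k::nat. (LINT x|I01. f x * (1 - cos (2 * (real (Suc k) * pi * x)))) = 0"
  shows "AE x in I01. f x = 0"
proof -
  define c where "c j = (LINT x|I01. f x * cos (of_int j * pi * x))" for j :: int
  have int: "integrable I01 (\<lambda>x. f x * cos (s * x + t))" for s t
  proof (rule Bochner_Integration.integrable_bound[OF f])
    have [measurable]: "f \<in> borel_measurable I01" "(\<lambda>x. cos (s * x + t)) \<in> borel_measurable I01"
      using f by (auto intro!: borel_measurable_I01 continuous_intros)
    show "(\<lambda>x. f x * cos (s * x + t)) \<in> borel_measurable I01" by measurable
    show "AE x in I01. norm (f x * cos (s * x + t)) \<le> norm (f x)"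
      by (intro AE_I2) (simp add: abs_mult mult_left_le)
  qed
  have int0: "integrable I01 (\<lambda>x. f x * cos (s * x))" for s
    using int[of s 0] by simp
  have even0: "c (2 * int k) = c 0" for k
  proof (cases k)
    case (Suc n)
    have "0 = (LINT x|I01. f x - f x * cos (of_int (2 * int k) * pi * x))"
      using 0[of n] by (simp add: Suc right_diff_distrib mult_ac)
    also have "\<dots> = c 0 - c (2 * int k)"
      unfolding c_def using Bochner_Integration.integral_diff[OF f int0] by simp
    finally show ?thesis by simp
  qed simp
  have minus: "c (- j) = c j" for j
  proof -
    have "cos (of_int (- j) * pi * x) = cos (of_int j * pi * x)" for x
      by (simp only: of_int_minus mult_minus_left cos_minus)
    then show ?thesis unfolding c_def by simp
  qed
  have c_even: "c j = c 0" if ev: "even j" for j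
  proof -
    obtain i where i: "j = 2 * i" using ev by blast
    show ?thesis
    proof (cases "i \<ge> 0")
      case True
      then show ?thesis using even0[of "nat i"] i by simp
    next
      case False
      then show ?thesis using even0[of "nat (- i)"] i minus[of j] by simp
    qed
  qed
  have c_odd: "c j = 0" if od: "odd j" for j
  proof -
    have cr: "cos (of_int j * pi * (1 - x)) = - cos (of_int j * pi * x)" for x
    proof -
      have "cos (of_int j * pi) = -1" "sin (of_int j * pi) = 0"
      proof -
        obtain i where "j = 2 * i + 1" using od by (rule oddE)
        then have "of_int j * pi = 2 * pi * of_int i + pi" by (simp add: algebra_simps)
        then show "cos (of_int j * pi) = -1" "sin (of_int j * pi) = 0"
          by (simp_all only: cos_periodic_pi sin_periodic_pi cos_int_2pin sin_int_2pin minus_zero)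
      qed
      moreover have "of_int j * pi * (1 - x) = of_int j * pi - of_int j * pi * x" by (simp add: algebra_simps)
      ultimately show ?thesis by (simp only: cos_diff)
    qed
    have "AE x in I01. f (1 - x) * cos (of_int j * pi * (1 - x)) = - (f x * cos (of_int j * pi * x))"
      using even by (rule eventually_mono) (simp only: cr mult_minus_right)
    then show ?thesis unfolding c_def by (rule integral_I01_odd[OF int0])
  qed
  \<comment> \<open>Coefficient \<open>j\<close> of the product is
    \<open>c j - (c (j + 2) + c (j - 2)) / 2\<close>. It stays within one parity class, where
    \<open>c\<close> is constant, and therefore vanishes.\<close>
  define h where "h x = complex_of_real (f x * (1 - cos (2 * pi * x)))" for x
  have ih: "integrable I01 h"
    unfolding h_def
    by (rule integrable_of_real) (simp add: right_diff_distrib f int0)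
  have "AE x in I01. h x = 0"
  proof (rule cos_coefficients_zero_imp_zero[OF ih])
    fix j :: nat
    have e: "f x * (1 - cos (2 * pi * x)) * cos (real j * pi * x)
        = f x * cos (of_int (int j) * pi * x)
          - (f x * cos (of_int (int j + 2) * pi * x) + f x * cos (of_int (int j - 2) * pi * x)) / 2" for x
    proof -
      have "of_int (int j + 2) * pi * x = real j * pi * x + 2 * pi * x"
           "of_int (int j - 2) * pi * x = real j * pi * x - 2 * pi * x"
        by (simp_all add: algebra_simps)
      then have "cos (of_int (int j + 2) * pi * x) + cos (of_int (int j - 2) * pi * x)
          = 2 * (cos (2 * pi * x) * cos (real j * pi * x))"
        by (simp only: cos_add cos_diff) simp
      then have "f x * cos (of_int (int j + 2) * pi * x) + f x * cos (of_int (int j - 2) * pi * x)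
          = 2 * (f x * (cos (2 * pi * x) * cos (real j * pi * x)))"
        by (simp only: distrib_left[symmetric] mult.left_commute)
      then show ?thesis by (simp add: algebra_simps)
    qed
    have "(LINT x|I01. f x * (1 - cos (2 * pi * x)) * cos (real j * pi * x))
        = c (int j) - (c (int j + 2) + c (int j - 2)) / 2"
      unfolding e c_def using int0 by simp
    also have "\<dots> = 0"
    proof (cases "even (int j)")
      case True
      then have "c (int j) = c 0" "c (int j + 2) = c 0" "c (int j - 2) = c 0"
        by (intro c_even; simp)+
      then show ?thesis by simp
    next
      case False
      then have "c (int j) = 0" "c (int j + 2) = 0" "c (int j - 2) = 0"
        by (intro c_odd; simp)+
      then show ?thesis by simp
    qed
    finally show "(LINT x|I01. h x * of_real (cos (real j * pi * x))) = 0"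
      unfolding h_def by (simp only: of_real_mult[symmetric] integral_complex_of_real of_real_0)
  qed
  moreover have "cos (2 * pi * x) \<noteq> 1" if "x \<in> space I01" for x
  proof -
    have "sin (pi * x) > 0" using that by (intro sin_gt_zero) auto
    moreover have "cos (2 * pi * x) = 1 - 2 * (sin (pi * x))\<^sup>2"
      using cos_double_sin[of "pi * x"] by (simp add: mult.assoc)
    ultimately show ?thesis by simp
  qed
  then have "AE x in I01. cos (2 * pi * x) \<noteq> 1" by (rule AE_I2)
  ultimately show ?thesis by eventually_elim (simp add: h_def)
qed

section \<open>The derivative of the trace map\<close>

interpretation dirichlet: diagonal_operator sine_basis "\<lambda>k. 1 / dirichlet_eigenvalue k" dirichlet_inverse
proof
  show "summable (\<lambda>k. 1 / dirichlet_eigenvalue k)"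
  proof -
    have "summable (\<lambda>k. 1 / pi\<^sup>2 * inverse (real (Suc k) ^ 2))"
      using inverse_power_summable[of 2, where 'a=real] by (intro summable_mult) (subst summable_Suc_iff, simp)
    moreover have "1 / (a * b)\<^sup>2 = 1 / b\<^sup>2 * inverse (a ^ 2)" for a b :: real
      by (simp add: power_mult_distrib divide_inverse)
    ultimately show ?thesis by (simp only: dirichlet_eigenvalue_def)
  qed
qed (auto simp: orthonormal_basis_sine complex_linear_dirichlet_inverse dirichlet_inverse_sine
    less_imp_le[OF dirichlet_eigenvalue_pos])

lemma mult_L2_add_left: "mult_L2 (a + b) f = mult_L2 a f + mult_L2 b f"
  by transfer (simp add: linf_rel_def l2_rel_def distrib_right square_integrable_add
      ess_bounded_mult_square_integrable)

lemma mult_L2_scaleR_left: "mult_L2 (r *\<^sub>R a) f = r *\<^sub>R mult_L2 a f"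
  unfolding scaleR_L2_def
  by transfer (simp add: linf_rel_def l2_rel_def mult.assoc square_integrable_scale
      ess_bounded_mult_square_integrable)

lemma bounded_linear_mult_op: "bounded_linear mult_op"
proof (rule bounded_linear_intro[where K=1])
  fix a b :: Linf and r :: real
  show "mult_op (a + b) = mult_op a + mult_op b"
    by (rule blinfun_eqI) (simp add: plus_blinfun.rep_eq mult_op.rep_eq mult_L2_add_left)
  show "mult_op (r *\<^sub>R a) = r *\<^sub>R mult_op a"
    by (rule blinfun_eqI) (simp add: scaleR_blinfun.rep_eq mult_op.rep_eq mult_L2_scaleR_left)
  have "norm (mult_op a) \<le> norm a"
    by (rule norm_blinfun_bound) (simp_all add: mult_op.rep_eq norm_mult_L2_le)
  then show "norm (mult_op a) \<le> norm a * 1" by simp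
qed

text \<open>Here constancy of the base point enters: multiplication by it is a scalar and commutes
  with the Dirichlet inverse.\<close>

lemma mult_op_const: "mult_op (const_Linf a) = a *\<^sub>R id_blinfun"
proof (rule blinfun_eqI)
  fix f
  show "mult_op (const_Linf a) f = (a *\<^sub>R id_blinfun) f"
    unfolding mult_op.rep_eq scaleR_blinfun.rep_eq id_blinfun.rep_eq scaleR_L2_def
    by transfer (simp add: l2_rel_def square_integrable_scale)
qed

text \<open>Every \<open>R_op n \<alpha>\<close> ends in a factor \<open>dirichlet_inverse\<close>; splitting it off leaves a polynomial in
  \<open>\<alpha>\<close> with values in the bounded operators.\<close>

fun R_factor :: "nat \<Rightarrow> Linf \<Rightarrow> (L2 \<Rightarrow>\<^sub>L L2)" where
  "R_factor 0 \<alpha> = - mult_op \<alpha>"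
| "R_factor (Suc 0) \<alpha> = - 2 *\<^sub>R id_blinfun + (mult_op \<alpha> o\<^sub>L dirichlet_inverse o\<^sub>L mult_op \<alpha>)"
| "R_factor (Suc (Suc n)) \<alpha> = - (R_factor n \<alpha> o\<^sub>L dirichlet_inverse)
     - (R_factor (Suc n) \<alpha> o\<^sub>L dirichlet_inverse o\<^sub>L mult_op \<alpha>)"

lemma R_op_eq: "R_op n \<alpha> = R_factor n \<alpha> o\<^sub>L dirichlet_inverse"
  by (induction n \<alpha> rule: R_op.induct)
     (rule blinfun_eqI; simp add: uminus_blinfun.rep_eq plus_blinfun.rep_eq minus_blinfun.rep_eq scaleR_blinfun.rep_eq)+

lemma complex_linear_R_factor: "complex_linear (R_factor n \<alpha>)"
  by (induction n \<alpha> rule: R_factor.induct)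
     (simp_all only: R_factor.simps complex_linear_uminus complex_linear_add complex_linear_diff complex_linear_scaleR
       complex_linear_id complex_linear_compose complex_linear_mult_op complex_linear_dirichlet_inverse)

text \<open>The product rule applied to the recursion of \<open>R_factor\<close> at the constant
  \<open>a\<close>, with multiplication by the constant already replaced by the scalar.\<close>

fun R_factor_deriv :: "nat \<Rightarrow> real \<Rightarrow> Linf \<Rightarrow> (L2 \<Rightarrow>\<^sub>L L2)" where
  "R_factor_deriv 0 a \<delta> = - mult_op \<delta>"
| "R_factor_deriv (Suc 0) a \<delta>
     = a *\<^sub>R ((mult_op \<delta> o\<^sub>L dirichlet_inverse) + (dirichlet_inverse o\<^sub>L mult_op \<delta>))"
| "R_factor_deriv (Suc (Suc n)) a \<delta> = - (R_factor_deriv n a \<delta> o\<^sub>L dirichlet_inverse)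
     - (a *\<^sub>R (R_factor_deriv (Suc n) a \<delta> o\<^sub>L dirichlet_inverse)
        + (R_factor (Suc n) (const_Linf a) o\<^sub>L dirichlet_inverse o\<^sub>L mult_op \<delta>))"

lemma complex_linear_R_factor_deriv: "complex_linear (R_factor_deriv n a \<delta>)"
  by (induction n a \<delta> rule: R_factor_deriv.induct)
     (simp_all only: R_factor_deriv.simps complex_linear_uminus complex_linear_add complex_linear_diff complex_linear_scaleR
       complex_linear_id complex_linear_compose complex_linear_mult_op complex_linear_dirichlet_inverse complex_linear_R_factor)

lemmas blinfun_compose_has_derivative =
  bounded_bilinear.FDERIV[OF bounded_bilinear_blinfun_compose]

lemma has_derivative_compose_const:
  "(f has_derivative f') F \<Longrightarrow> ((\<lambda>\<alpha>. f \<alpha> o\<^sub>L A) has_derivative (\<lambda>h. f' h o\<^sub>L A)) F"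
  by (rule bounded_linear.has_derivative[OF bounded_bilinear.bounded_linear_left[OF bounded_bilinear_blinfun_compose]])

lemma has_derivative_mult_op: "(mult_op has_derivative mult_op) F"
  by (rule bounded_linear_imp_has_derivative[OF bounded_linear_mult_op])

lemma R_factor_has_derivative: "(R_factor n has_derivative R_factor_deriv n a) (at (const_Linf a))"
proof (induction n rule: induct_nat_012)
  case 0
  show ?case unfolding R_factor.simps[abs_def] R_factor_deriv.simps[abs_def]
    by (rule has_derivative_minus[OF has_derivative_mult_op])
next
  case 1
  have "((\<lambda>\<alpha>. - 2 *\<^sub>R id_blinfun + (mult_op \<alpha> o\<^sub>L dirichlet_inverse o\<^sub>L mult_op \<alpha>)) has_derivative
      (\<lambda>\<delta>. 0 + ((mult_op (const_Linf a) o\<^sub>L dirichlet_inverse o\<^sub>L mult_op \<delta>)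
         + (mult_op \<delta> o\<^sub>L dirichlet_inverse o\<^sub>L mult_op (const_Linf a))))) (at (const_Linf a))"
    by (intro has_derivative_add has_derivative_const blinfun_compose_has_derivative
        has_derivative_compose_const has_derivative_mult_op)
  then show ?case unfolding R_factor.simps[abs_def]
  proof (rule has_derivative_eq_rhs)
    show "(\<lambda>\<delta>. 0 + ((mult_op (const_Linf a) o\<^sub>L dirichlet_inverse o\<^sub>L mult_op \<delta>)
         + (mult_op \<delta> o\<^sub>L dirichlet_inverse o\<^sub>L mult_op (const_Linf a)))) = R_factor_deriv (Suc 0) a"
      by (rule ext, rule blinfun_eqI)
         (simp add: mult_op_const plus_blinfun.rep_eq scaleR_blinfun.rep_eq blinfun.scaleR_right scaleR_add_right)
  qed
next
  case (ge2 n)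
  have "((\<lambda>\<alpha>. - (R_factor n \<alpha> o\<^sub>L dirichlet_inverse) - (R_factor (Suc n) \<alpha> o\<^sub>L dirichlet_inverse o\<^sub>L mult_op \<alpha>)) has_derivative
      (\<lambda>\<delta>. - (R_factor_deriv n a \<delta> o\<^sub>L dirichlet_inverse)
         - ((R_factor (Suc n) (const_Linf a) o\<^sub>L dirichlet_inverse o\<^sub>L mult_op \<delta>)
         + (R_factor_deriv (Suc n) a \<delta> o\<^sub>L dirichlet_inverse o\<^sub>L mult_op (const_Linf a))))) (at (const_Linf a))"
    by (intro has_derivative_diff has_derivative_minus blinfun_compose_has_derivative
        has_derivative_compose_const has_derivative_mult_op ge2)
  then show ?case unfolding R_factor.simps[abs_def]
  proof (rule has_derivative_eq_rhs)
    show "(\<lambda>\<delta>. - (R_factor_deriv n a \<delta> o\<^sub>L dirichlet_inverse)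
         - ((R_factor (Suc n) (const_Linf a) o\<^sub>L dirichlet_inverse o\<^sub>L mult_op \<delta>)
         + (R_factor_deriv (Suc n) a \<delta> o\<^sub>L dirichlet_inverse o\<^sub>L mult_op (const_Linf a)))) = R_factor_deriv (Suc (Suc n)) a"
      by (rule ext, rule blinfun_eqI)
         (simp add: mult_op_const plus_blinfun.rep_eq minus_blinfun.rep_eq uminus_blinfun.rep_eq scaleR_blinfun.rep_eq
           blinfun.scaleR_right add.commute)
  qed
qed

text \<open>\<open>complex_part\<close> is the identity on the complex-linear
  \<open>R_factor n \<alpha>\<close>. Thus \<open>R_tc n\<close> factors through a bounded linear
  map, and differentiability in operator norm yields it in trace norm.\<close>

lemma R_tc_eq: "R_tc n = (\<lambda>\<alpha>. dirichlet.compose_tc (R_factor n \<alpha>))"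
  by (rule ext) (simp add: R_tc_def R_op_eq dirichlet.compose_tc_def complex_part_eq complex_linear_R_factor)

lemma R_tc_has_derivative:
  "(R_tc n has_derivative (\<lambda>\<delta>. dirichlet.compose_tc (R_factor_deriv n a \<delta>))) (at (const_Linf a))"
  unfolding R_tc_eq
  by (rule bounded_linear.has_derivative[OF dirichlet.bounded_linear_compose_tc R_factor_has_derivative])

lemma trace_map_eq: "trace_map \<alpha> n = dirichlet.diag_trace (R_factor n \<alpha>)"
  by (simp add: trace_map_def R_tc_eq dirichlet.op_trace_compose_tc complex_part_eq complex_linear_R_factor)

lemma trace_map_has_derivative:
  "((\<lambda>\<alpha>. trace_map \<alpha> n) has_derivative (\<lambda>\<delta>. dirichlet.diag_trace (R_factor_deriv n a \<delta>))) (at (const_Linf a))"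
  unfolding trace_map_eq
  by (rule bounded_linear.has_derivative[OF dirichlet.bounded_linear_diag_trace R_factor_has_derivative])

lemma op_trace_compose_R_factor_deriv:
  "op_trace (dirichlet.compose_tc (R_factor_deriv n a \<delta>)) = dirichlet.diag_trace (R_factor_deriv n a \<delta>)"
  by (simp add: dirichlet.op_trace_compose_tc complex_part_eq complex_linear_R_factor_deriv)

text \<open>The scalar by which \<open>R_factor n\<close> at the constant \<open>a\<close> acts on
  an eigenvector of the Dirichlet inverse with eigenvalue \<open>l\<close>.\<close>

fun R_symbol :: "real \<Rightarrow> real \<Rightarrow> nat \<Rightarrow> real" where
  "R_symbol a l 0 = - a"
| "R_symbol a l (Suc 0) = - 2 + a\<^sup>2 * l"
| "R_symbol a l (Suc (Suc n)) = - (l * R_symbol a l n) - a * l * R_symbol a l (Suc n)"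

text \<open>Coefficient form of \<open>- (2 \<zeta> + a) / (1 + l (\<zeta>\<^sup>2 + a \<zeta>))\<close>.\<close>

lemma R_symbol_Suc:
  "R_symbol a l (Suc n) = - (a * resolvent_coeff a l (Suc n) + 2 * resolvent_coeff a l n)"
proof (induction n rule: induct_nat_012)
  case (ge2 n)
  show ?case unfolding R_symbol.simps(3)[of a l "Suc n"] ge2 by (simp add: algebra_simps)
qed (simp_all add: algebra_simps power2_eq_square)

lemma cinner_uminus_right: "cinner f (- g) = - cinner f g"
  by (rule linear_neg[OF bounded_linear.linear[OF bounded_linear_cinner_right]])

text \<open>The vector \<open>f\<close> is arbitrary because the derivative applies this to the
  image of \<delta> times an eigenfunction, which is no eigenvector; diagonality is used in the left
  argument only.\<close>

lemma cinner_R_factor: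
  "cinner (sine_basis k) (R_factor n (const_Linf a) f)
     = of_real (R_symbol a (1 / dirichlet_eigenvalue k) n) * cinner (sine_basis k) f"
proof (induction n arbitrary: f rule: induct_nat_012)
  case 0
  show ?case by (simp add: mult_op_const uminus_blinfun.rep_eq scaleR_blinfun.rep_eq cinner_uminus_right cinner_scaleR_right)
next
  case 1
  show ?case
    by (simp add: mult_op_const minus_blinfun.rep_eq scaleR_blinfun.rep_eq blinfun.scaleR_right
        cinner_diff_right cinner_scaleR_right dirichlet.cinner_G power2_eq_square left_diff_distrib)
next
  case (ge2 n)
  show ?case
    by (simp add: mult_op_const minus_blinfun.rep_eq uminus_blinfun.rep_eq scaleR_blinfun.rep_eq blinfun.scaleR_right
        cinner_diff_right cinner_uminus_right cinner_scaleR_right dirichlet.cinner_G ge2 left_diff_distrib right_diff_distrib mult_ac)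
qed

text \<open>This is \<open>- d/d\<zeta> (\<zeta> / (1 + l (\<zeta>\<^sup>2 + a \<zeta>)))\<close>, read coefficientwise.\<close>

lemma cinner_R_factor_deriv:
  "cinner (sine_basis k) (R_factor_deriv n a \<delta> (sine_basis k))
     = - of_nat (Suc n) * of_real (resolvent_coeff a (1 / dirichlet_eigenvalue k) n)
        * cinner (sine_basis k) (mult_op \<delta> (sine_basis k))"
proof (induction n rule: induct_nat_012)
  case 0
  show ?case by (simp add: uminus_blinfun.rep_eq cinner_uminus_right)
next
  case 1
  show ?case
    by (simp add: plus_blinfun.rep_eq scaleR_blinfun.rep_eq blinfun.scaleR_right scaleR_add_right dirichlet_inverse_sine
        cinner_add_right cinner_scaleR_right dirichlet.cinner_G)
next
  case (ge2 n)
  define l where "l = 1 / dirichlet_eigenvalue k"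
  define d where "d = cinner (sine_basis k) (mult_op \<delta> (sine_basis k))"
  have "cinner (sine_basis k) (R_factor_deriv (Suc (Suc n)) a \<delta> (sine_basis k))
      = - (of_real l * (- of_nat (Suc n) * of_real (resolvent_coeff a l n) * d))
        - (of_real a * (of_real l * (- of_nat (Suc (Suc n)) * of_real (resolvent_coeff a l (Suc n)) * d))
           + of_real (R_symbol a l (Suc n)) * (of_real l * d))"
    unfolding R_factor_deriv.simps minus_blinfun.rep_eq uminus_blinfun.rep_eq plus_blinfun.rep_eq scaleR_blinfun.rep_eq
      blinfun_apply_blinfun_compose dirichlet_inverse_sine blinfun.scaleR_right cinner_diff_right cinner_uminus_right
      cinner_add_right cinner_scaleR_right cinner_R_factor dirichlet.cinner_G ge2 l_def d_def
    by (simp only:)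
  \<comment> \<open>By \<open>R_symbol_Suc\<close> the last term adds 2 to the factor
    \<open>n + 1\<close> of \<open>resolvent_coeff a l n\<close> and 1 to the factor
    \<open>n + 2\<close> of \<open>resolvent_coeff a l (Suc n)\<close>. Both become
    \<open>n + 3\<close>, and the recursion of \<open>resolvent_coeff\<close> applies.\<close>
  also have "\<dots> = - of_nat (Suc (Suc (Suc n))) * of_real (resolvent_coeff a l (Suc (Suc n))) * d"
    unfolding R_symbol_Suc by (simp add: algebra_simps)
  finally show ?case by (simp only: l_def d_def)
qed

text \<open>Places the reciprocals in the unit interval, where the coefficient bounds hold.\<close>

lemma dirichlet_eigenvalue_ge_1: "1 \<le> dirichlet_eigenvalue k"
proof -
  have "1 * 1 \<le> real (Suc k) * pi" using pi_gt3 by (intro mult_mono) auto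
  then show ?thesis unfolding dirichlet_eigenvalue_def by (intro one_le_power) simp
qed

lemma diag_trace_zero_imp_diagonal_zero:
  assumes "\<And>n. dirichlet.diag_trace (R_factor_deriv n a \<delta>) = 0"
  shows "cinner (sine_basis k) (mult_op \<delta> (sine_basis k)) = 0"
proof -
  define l where "l k = 1 / dirichlet_eigenvalue k" for k
  define e where "e k = of_real (l k) * cinner (sine_basis k) (mult_op \<delta> (sine_basis k))" for k
  have l: "0 < l k" "l k \<le> 1" for k
    using dirichlet_eigenvalue_pos[of k] dirichlet_eigenvalue_ge_1[of k] by (simp_all add: l_def)
  \<comment> \<open>Simplicity of the Dirichlet spectrum: distinct nodes are what allows the moments
    to separate the modes.\<close>
  have l_dec: "l j < l i" if "i < j" for i j
  proof -
    have "real (Suc i) * pi < real (Suc j) * pi" using that by (intro mult_strict_right_mono) auto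
    then have "dirichlet_eigenvalue i < dirichlet_eigenvalue j"
      unfolding dirichlet_eigenvalue_def by (intro power_strict_mono) auto
    then show ?thesis using dirichlet_eigenvalue_pos[of i] unfolding l_def by (intro divide_strict_left_mono) auto
  qed
  have se: "summable (\<lambda>k. cmod (e k))"
    unfolding e_def l_def
    by (rule summable_comparison_test'[OF summable_mult[OF dirichlet.lam_summable, of "norm (mult_op \<delta>)"], of 0])
       (simp only: real_norm_def abs_norm_cancel dirichlet.norm_diag_trace_term)
  have z: "(\<Sum>k. e k * of_real (resolvent_coeff a (l k) n)) = 0" for n
  proof -
    have s: "summable (\<lambda>k. e k * of_real (resolvent_coeff a (l k) n))"
    proof (rule summable_norm_cancel, rule summable_comparison_test'[of _ 0])
      show "summable (\<lambda>k. cmod (e k) * (\<bar>a\<bar> + 1) ^ n)" by (rule summable_mult2[OF se])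
      show "norm (cmod (e k * of_real (resolvent_coeff a (l k) n))) \<le> cmod (e k) * (\<bar>a\<bar> + 1) ^ n" for k
        using abs_resolvent_coeff_le[of "l k" a n] l[of k] by (simp add: norm_mult mult_left_mono)
    qed
    have "0 = (\<Sum>k. of_real (l k) * cinner (sine_basis k) (R_factor_deriv n a \<delta> (sine_basis k)))"
      using assms[of n] by (simp add: dirichlet.diag_trace_def l_def)
    also have "\<dots> = (\<Sum>k. - of_nat (Suc n) * (e k * of_real (resolvent_coeff a (l k) n)))"
      unfolding cinner_R_factor_deriv e_def l_def by (simp only: mult_ac)
    also have "\<dots> = - of_nat (Suc n) * (\<Sum>k. e k * of_real (resolvent_coeff a (l k) n))"
      by (rule suminf_mult[OF s])
    finally show ?thesis by (metis mult_eq_0_iff neg_equal_0_iff_equal of_nat_eq_0_iff nat.distinct(1))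
  qed
  have "e k = 0"
  proof (rule moments_zero_imp_zero[of e l])
    show "(\<Sum>k. e k * of_real (l k) ^ m) = 0" for m
      by (rule resolvent_coeff_sums_imp_moments[OF se less_imp_le[OF l(1)] l(2) z])
  qed (simp_all only: se l(1) l_dec)
  then show ?thesis using l(1)[of k] by (simp add: e_def)
qed

section \<open>Even perturbations with zero diagonal\<close>

lemma class_Linf_cases:
  obtains f where "ess_bounded f" "a = class_Linf f"
  by (induct a rule: Linf.abs_induct) (auto simp: linf_rel_def)

lemma ess_bounded_imp_integrable:
  assumes "ess_bounded f"
  shows "integrable I01 f"
proof -
  interpret finite_measure I01 by (rule finite_measure_lebesgue_on) simp
  obtain c where "AE x in I01. \<bar>f x\<bar> \<le> c" using assms unfolding ess_bounded_def by blast
  then show ?thesis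
    using assms by (intro integrable_const_bound[of f c]) (auto simp: ess_bounded_def)
qed

lemma even_diagonal_zero_imp_zero:
  assumes even: "even_Linf \<delta>" and 0: "\<And>k. cinner (sine_basis k) (mult_op \<delta> (sine_basis k)) = 0"
  shows "\<delta> = 0"
proof -
  obtain f where f: "ess_bounded f" "\<delta> = class_Linf f" by (rule class_Linf_cases)
  have fr: "linf_rel f f" using f(1) by (simp add: linf_rel_def)
  have ev: "AE x in I01. f x = f (1 - x)"
    using even by (simp add: f(2) even_Linf.abs_eq[OF fr])
  have "(LINT x|I01. f x * (1 - cos (2 * (real (Suc k) * pi * x)))) = 0" for k
  proof -
    have "mult_op \<delta> (sine_basis k) = class_L2 (\<lambda>x. of_real (f x) * sine k x)"
      unfolding mult_op.rep_eq f(2) sine_basis_def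
      using mult_L2.abs_eq[OF fr, of "sine k"] square_integrable_sine by simp
    then have "0 = cinner (class_L2 (sine k)) (class_L2 (\<lambda>x. of_real (f x) * sine k x))"
      using 0[of k] by (simp add: sine_basis_def)
    also have "\<dots> = (LINT x|I01. cnj (sine k x) * (of_real (f x) * sine k x))"
      by (intro cinner_class_L2 square_integrable_sine ess_bounded_mult_square_integrable f(1))
    also have "\<dots> = (LINT x|I01. of_real (f x * (1 - cos (2 * (real (Suc k) * pi * x)))))"
    proof (rule Bochner_Integration.integral_cong[OF refl])
      fix x
      have "f x * (1 - cos (2 * (real (Suc k) * pi * x)))
          = (sqrt 2 * sin (real (Suc k) * pi * x)) * (f x * (sqrt 2 * sin (real (Suc k) * pi * x)))"
        by (simp only: cos_double_sin) (simp add: power2_eq_square)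
      then show "cnj (sine k x) * (of_real (f x) * sine k x) = of_real (f x * (1 - cos (2 * (real (Suc k) * pi * x))))"
        unfolding sine_def by (simp only: complex_cnj_mult complex_cnj_complex_of_real of_real_mult)
    qed
    also have "\<dots> = of_real (LINT x|I01. f x * (1 - cos (2 * (real (Suc k) * pi * x))))"
      by (rule integral_complex_of_real)
    finally show ?thesis by (metis of_real_eq_0_iff)
  qed
  then have "AE x in I01. f x = 0"
    by (rule even_equal_cos_coefficients_imp_zero[OF ess_bounded_imp_integrable[OF f(1)] ev])
  then have "linf_rel f (\<lambda>x. 0)"
    using f(1) ess_bounded_const[of 0] by (simp add: linf_rel_def)
  then show ?thesis
    unfolding f(2) zero_Linf_def using Quotient_rel[OF Quotient_Linf, of f "\<lambda>x. 0"] by simp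
qed

text \<open>Injectivity on the even perturbations reduces to a trivial kernel because they are
  closed under differences.\<close>

lemma even_Linf_diff: "even_Linf a \<Longrightarrow> even_Linf b \<Longrightarrow> even_Linf (a - b)"
proof -
  have "even_Linf (a + (-1) *\<^sub>R b)" if "even_Linf a" "even_Linf b"
    using that by transfer (auto elim: eventually_elim2)
  then show "even_Linf a \<Longrightarrow> even_Linf b \<Longrightarrow> even_Linf (a - b)" by simp
qed

theorem theorem3p1:
  fixes \<alpha>\<^sub>0 :: real
  shows "(\<forall>n \<alpha>. trace_class_op (R_op n \<alpha>)) \<and>
    (\<forall>n. R_tc n differentiable (at (const_Linf \<alpha>\<^sub>0))) \<and>
    (\<forall>n. (\<lambda>\<alpha>. trace_map \<alpha> n) differentiable (at (const_Linf \<alpha>\<^sub>0))) \<and>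
    (\<forall>\<delta>\<alpha> n. componentwise_derivative trace_map (const_Linf \<alpha>\<^sub>0) \<delta>\<alpha> n
       = op_trace (frechet_derivative (R_tc n) (at (const_Linf \<alpha>\<^sub>0)) \<delta>\<alpha>)) \<and>
    inj_on (componentwise_derivative trace_map (const_Linf \<alpha>\<^sub>0)) {\<delta>\<alpha>. even_Linf \<delta>\<alpha>} \<and>
    (\<forall>\<delta>\<alpha>. even_Linf \<delta>\<alpha> \<and>
       (\<forall>n. op_trace (frechet_derivative (R_tc n) (at (const_Linf \<alpha>\<^sub>0)) \<delta>\<alpha>) = 0) \<longrightarrow> \<delta>\<alpha> = 0)"
proof -
  have R': "op_trace (frechet_derivative (R_tc n) (at (const_Linf \<alpha>\<^sub>0)) \<delta>)
      = dirichlet.diag_trace (R_factor_deriv n \<alpha>\<^sub>0 \<delta>)" for n \<delta>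
    by (simp only: frechet_derivative_at[OF R_tc_has_derivative, symmetric] op_trace_compose_R_factor_deriv)
  have t': "componentwise_derivative trace_map (const_Linf \<alpha>\<^sub>0) \<delta> n
      = dirichlet.diag_trace (R_factor_deriv n \<alpha>\<^sub>0 \<delta>)" for n \<delta>
    unfolding componentwise_derivative_def
    by (simp only: frechet_derivative_at[OF trace_map_has_derivative, symmetric])
  have zero: "\<delta> = 0" if "even_Linf \<delta>" "\<And>n. dirichlet.diag_trace (R_factor_deriv n \<alpha>\<^sub>0 \<delta>) = 0" for \<delta>
    by (rule even_diagonal_zero_imp_zero[OF that(1) diag_trace_zero_imp_diagonal_zero[OF that(2)]])
  have "inj_on (componentwise_derivative trace_map (const_Linf \<alpha>\<^sub>0)) {\<delta>\<alpha>. even_Linf \<delta>\<alpha>}"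
  proof (rule inj_onI)
    fix \<delta> \<epsilon> assume ev: "\<delta> \<in> {\<delta>\<alpha>. even_Linf \<delta>\<alpha>}" "\<epsilon> \<in> {\<delta>\<alpha>. even_Linf \<delta>\<alpha>}"
      and eq: "componentwise_derivative trace_map (const_Linf \<alpha>\<^sub>0) \<delta> = componentwise_derivative trace_map (const_Linf \<alpha>\<^sub>0) \<epsilon>"
    have "dirichlet.diag_trace (R_factor_deriv n \<alpha>\<^sub>0 (\<delta> - \<epsilon>)) = 0" for n
      using linear_diff[OF has_derivative_linear[OF trace_map_has_derivative], of n \<alpha>\<^sub>0 \<delta> \<epsilon>] fun_cong[OF eq, of n]
      by (simp add: t')
    then have "\<delta> - \<epsilon> = 0" using ev by (intro zero even_Linf_diff) auto
    then show "\<delta> = \<epsilon>" by simp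
  qed
  moreover have "trace_class_op (R_op n \<alpha>)" for n \<alpha>
    unfolding R_op_eq by (rule dirichlet.trace_class_compose(1)[OF complex_linear_R_factor])
  moreover have "R_tc n differentiable (at (const_Linf \<alpha>\<^sub>0))"
      "(\<lambda>\<alpha>. trace_map \<alpha> n) differentiable (at (const_Linf \<alpha>\<^sub>0))" for n
    using R_tc_has_derivative trace_map_has_derivative differentiableI by blast+
  ultimately show ?thesis using R' t' zero by simp
qed

end
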